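(* Let $G$ be a finite simple polyhedral map on a closed surface $\mathbb{M}$ with Euler characteristic $\chi(\mathbb{M}) \le 0$. If $G$ has more than $126|\chi(\mathbb{M})|$ vertices, then $G$ contains a vertex $v$ of degree $n \in \{3,4,5,6\}$ such that the multiset $\{a_1,\ldots,a_n\}$ of degrees of the faces incident with $v$ is one of the following (here "$\forall$" means the corresponding face may have any degree, and "$\le 2518$" means that face has degree at most $2518$): (1) $n=3$: $(3,3,\forall)$, $(3,4,\forall)$, $(3,5,\forall)$, $(3,6,\le 2518)$, $(3,7,\le 2518)$, $(3,8,\le 2518)$, $(3,9,\le 2518)$, $(3,10,\le 2518)$, $(3,11,\le 2518)$, $(3,12,\le 2518)$, $(4,4,\forall)$, $(4,5,\le 2518)$, $(4,6,\le 2518)$, $(4,7,\le 2518)$, $(4,8,\le 2518)$, $(5,5,\le 2518)$, $(5,6,\le 2518)$, $(6,6,6)$; (2) $n=4$: $(3,3,3,\forall)$, $(3,3,4,\le 2518)$, $(3,3,5,\le 2518)$, $(3,3,6,6)$, $(3,4,4,4)$, $(3,4,4,5)$, $(3,4,4,6)$, $(4,4,4,4)$; (3) $n=5$: $(3,3,3,3,3)$, $(3,3,3,3,4)$, $(3,3,3,3,5)$, $(3,3,3,3,6)$, $(3,3,3,4,4)$; (4) $n=6$: $(3,3,3,3,3,3)$.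
   Context: Graphs are finite, simple, undirected and connected. The orientable surface $\mathbb{S}_g$ (sphere with $g$ handles) has Euler characteristic $2-2g$; the non-orientable surface $\mathbb{N}_q$ (sphere with $q$ crosscaps) has Euler characteristic $2-q$. For a graph $G$ embedded in a surface $\mathbb{M}$, the faces are the connected components of $\mathbb{M}-G$; the embedding is a $2$-cell embedding if every face is an open disc. A map on $\mathbb{M}$ is a $2$-cell embedded graph in which every vertex has degree at least $3$. The representativity (face-width) of a $2$-cell embedding is the smallest number $k$ such that $\mathbb{M}$ contains a non-contractible closed curve meeting $G$ in exactly $k$ points. A polyhedral map is a map that is $3$-connected and whose embedding has representativity at least $3$. The facial walk of a face is the shortest closed walk following the edges around its boundary, and the degree of a face is the length of its facial walk. A vertex $v$ is called an $(a_1,\ldots,a_n)$-vertex if the faces incident with $v$ have degrees $a_1,\ldots,a_n$. *)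

theory Defs
  imports
    "HOL-Homology.Homology"
    "HOL-Library.Extended_Nat"
    "HOL-Library.Multiset"
    "Graph_Theory.Digraph_Component"
begin

section \<open>Closed surfaces\<close>

definition open_disc :: "complex topology" where
  "open_disc = top_of_set (ball 0 1)"

definition closed_surface :: "'a topology \<Rightarrow> bool" where
  "closed_surface M \<longleftrightarrow>
     topspace M \<noteq> {} \<and> compact_space M \<and> connected_space M \<and> Hausdorff_space M \<and>
     (\<forall>x\<in>topspace M. \<exists>U. openin M U \<and> x \<in> U \<and> subtopology M U homeomorphic_space open_disc)"

text \<open>The rank of an Abelian group is the largest size of a set of elements that are linearly
  independent over the integers. It exists for the homology groups of a closed surface, which are
  finitely generated. The Euler characteristic is the alternating sum of the Betti numbers; on a
  surface these vanish above dimension 2. Its value is \<open>2 - 2g\<close> on the sphere with \<open>g\<close> handles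
  and \<open>2 - q\<close> on the sphere with \<open>q\<close> crosscaps (the crosscaps contribute \<open>q - 1\<close> to the first
  Betti number, and the second is then 0, since the coefficients are integers).\<close>

definition int_independent :: "('b, 'c) monoid_scheme \<Rightarrow> 'b set \<Rightarrow> bool" where
  "int_independent A B \<longleftrightarrow> finite B \<and> B \<subseteq> carrier A \<and>
     (\<forall>c::'b \<Rightarrow> int. finprod A (\<lambda>b. b [^]\<^bsub>A\<^esub> c b) B = \<one>\<^bsub>A\<^esub> \<longrightarrow> (\<forall>b\<in>B. c b = 0))"

definition group_rank :: "('b, 'c) monoid_scheme \<Rightarrow> nat" where
  "group_rank A = (GREATEST n. \<exists>B. int_independent A B \<and> card B = n)"

definition euler_characteristic :: "'a topology \<Rightarrow> int" where
  "euler_characteristic M =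
     (\<Sum>p\<le>2. (- 1) ^ p * int (group_rank (homology_group (int p) M)))"


section \<open>Embedded graphs\<close>

text \<open>A finite simple undirected graph is a \<^locale>\<open>pair_graph\<close>: an edge between \<open>u\<close> and \<open>v\<close> is
  the pair of opposite arcs \<open>(u, v)\<close> and \<open>(v, u)\<close>. The vertices of an embedded graph are points of
  the surface, and \<open>\<gamma> (u, v) = \<gamma> (v, u)\<close> is the point set of the edge, a simple arc from \<open>u\<close>
  to \<open>v\<close>.\<close>

definition graph_embedding ::
    "'a topology \<Rightarrow> 'a pair_pre_digraph \<Rightarrow> ('a \<times> 'a \<Rightarrow> 'a set) \<Rightarrow> bool" where
  "graph_embedding M G \<gamma> \<longleftrightarrow>
     pverts G \<subseteq> topspace M \<and>
     (\<forall>(u, v)\<in>parcs G.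
        \<gamma> (v, u) = \<gamma> (u, v) \<and>
        (\<exists>g. embedding_map (top_of_set {0..1::real}) M g \<and>
             g 0 = u \<and> g 1 = v \<and> g ` {0..1} = \<gamma> (u, v)) \<and>
        \<gamma> (u, v) \<inter> pverts G = {u, v}) \<and>
     (\<forall>(u, v)\<in>parcs G. \<forall>(u', v')\<in>parcs G.
        {u, v} \<noteq> {u', v'} \<longrightarrow> \<gamma> (u, v) \<inter> \<gamma> (u', v') \<subseteq> pverts G)"

definition graph_points :: "'a pair_pre_digraph \<Rightarrow> ('a \<times> 'a \<Rightarrow> 'a set) \<Rightarrow> 'a set" where
  "graph_points G \<gamma> = pverts G \<union> (\<Union>e\<in>parcs G. \<gamma> e)"

definition faces ::
    "'a topology \<Rightarrow> 'a pair_pre_digraph \<Rightarrow> ('a \<times> 'a \<Rightarrow> 'a set) \<Rightarrow> 'a set set" where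
  "faces M G \<gamma> = connected_components_of (subtopology M (topspace M - graph_points G \<gamma>))"

text \<open>A closed walk \<open>p\<close> follows the boundary of the face \<open>F\<close> if a homeomorphism from the open unit
  disc onto \<open>F\<close> extends continuously to the closed disc in such a way that, once the unit circle is
  divided into \<open>length p\<close> equal arcs, the \<open>i\<close>-th of them runs along the \<open>i\<close>-th edge of \<open>p\<close>,
  in the direction of \<open>p\<close>. An edge with \<open>F\<close> on both sides thus occurs twice in \<open>p\<close>.\<close>

definition boundary_walk ::
    "'a topology \<Rightarrow> 'a pair_pre_digraph \<Rightarrow> ('a \<times> 'a \<Rightarrow> 'a set) \<Rightarrow> 'a set \<Rightarrow> ('a \<times> 'a) list \<Rightarrow> bool"
where
  "boundary_walk M G \<gamma> F p \<longleftrightarrow>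
     p \<noteq> [] \<and> (\<exists>u. pre_digraph.awalk (with_proj G) u p u) \<and>
     (\<exists>\<phi>. continuous_map (top_of_set (cball (0::complex) 1)) M \<phi> \<and>
          homeomorphic_map open_disc (subtopology M F) \<phi> \<and>
          (\<forall>i<length p.
             let s = (\<lambda>t. \<phi> (cis (2 * pi * (real i + t) / real (length p))))
             in inj_on s {0..1} \<and> s ` {0..1} = \<gamma> (p ! i) \<and>
                s 0 = fst (p ! i) \<and> s 1 = snd (p ! i)))"

text \<open>The existence of a boundary walk is no restriction: Caratheodory's extension theorem yields one
  for every open disc among the faces of a connected graph with at least one edge. It is stated so
  that facial walks are available.\<close>

definition two_cell_embedding ::
    "'a topology \<Rightarrow> 'a pair_pre_digraph \<Rightarrow> ('a \<times> 'a \<Rightarrow> 'a set) \<Rightarrow> bool" where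
  "two_cell_embedding M G \<gamma> \<longleftrightarrow>
     graph_embedding M G \<gamma> \<and>
     (\<forall>F\<in>faces M G \<gamma>. subtopology M F homeomorphic_space open_disc \<and>
                      (\<exists>p. boundary_walk M G \<gamma> F p))"

definition facial_walk ::
    "'a topology \<Rightarrow> 'a pair_pre_digraph \<Rightarrow> ('a \<times> 'a \<Rightarrow> 'a set) \<Rightarrow> 'a set \<Rightarrow> ('a \<times> 'a) list" where
  "facial_walk M G \<gamma> F = arg_min length (boundary_walk M G \<gamma> F)"

definition face_degree ::
    "'a topology \<Rightarrow> 'a pair_pre_digraph \<Rightarrow> ('a \<times> 'a \<Rightarrow> 'a set) \<Rightarrow> 'a set \<Rightarrow> nat" where
  "face_degree M G \<gamma> F = length (facial_walk M G \<gamma> F)"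

text \<open>The degrees of the faces incident with \<open>v\<close>. A face counts once for each visit of its facial
  walk to \<open>v\<close>, so that the multiset has as many elements as \<open>v\<close> has edges; in a polyhedral map
  every incident face is visited exactly once.\<close>

definition incident_face_degrees ::
    "'a topology \<Rightarrow> 'a pair_pre_digraph \<Rightarrow> ('a \<times> 'a \<Rightarrow> 'a set) \<Rightarrow> 'a \<Rightarrow> nat multiset" where
  "incident_face_degrees M G \<gamma> v =
     (\<Sum>F\<in>faces M G \<gamma>.
        replicate_mset (count_list (map fst (facial_walk M G \<gamma> F)) v) (face_degree M G \<gamma> F))"

abbreviation vertex_degree :: "'a pair_pre_digraph \<Rightarrow> 'a \<Rightarrow> nat" where
  "vertex_degree G v \<equiv> out_degree (with_proj G) v"


section \<open>Polyhedral maps\<close>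

definition k_connected :: "nat \<Rightarrow> 'a pair_pre_digraph \<Rightarrow> bool" where
  "k_connected k G \<longleftrightarrow>
     k < card (pverts G) \<and>
     (\<forall>S\<subseteq>pverts G. card S < k \<longrightarrow>
        Digraph_Component.connected (with_proj G \<restriction> (pverts G - S)))"

definition noncontractible_curve :: "'a topology \<Rightarrow> (complex \<Rightarrow> 'a) \<Rightarrow> bool" where
  "noncontractible_curve M c \<longleftrightarrow>
     continuous_map (top_of_set (sphere 0 1)) M c \<and>
     \<not> (\<exists>a. homotopic_with (\<lambda>_. True) (top_of_set (sphere 0 1)) M c (\<lambda>_. a))"

text \<open>The infimum is infinite on the sphere, where there is no noncontractible curve, and is a
  minimum on every other surface.\<close>

definition representativity ::
    "'a topology \<Rightarrow> 'a pair_pre_digraph \<Rightarrow> ('a \<times> 'a \<Rightarrow> 'a set) \<Rightarrow> enat" where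
  "representativity M G \<gamma> =
     Inf {enat (card (c ` sphere 0 1 \<inter> graph_points G \<gamma>)) |c.
            noncontractible_curve M c \<and> finite (c ` sphere 0 1 \<inter> graph_points G \<gamma>)}"

definition is_map :: "'a topology \<Rightarrow> 'a pair_pre_digraph \<Rightarrow> ('a \<times> 'a \<Rightarrow> 'a set) \<Rightarrow> bool" where
  "is_map M G \<gamma> \<longleftrightarrow>
     pair_graph G \<and> Digraph_Component.connected (with_proj G) \<and>
     two_cell_embedding M G \<gamma> \<and> (\<forall>v\<in>pverts G. vertex_degree G v \<ge> 3)"

definition polyhedral_map ::
    "'a topology \<Rightarrow> 'a pair_pre_digraph \<Rightarrow> ('a \<times> 'a \<Rightarrow> 'a set) \<Rightarrow> bool" where
  "polyhedral_map M G \<gamma> \<longleftrightarrow>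
     is_map M G \<gamma> \<and> k_connected 3 G \<and> representativity M G \<gamma> \<ge> 3"

end

(* The curvature 1 - n/2 + sum of 1/a over the faces at a vertex of degree n adds up to V - E + F.
   The only vertices of positive curvature outside the list are those of type (3,6,a) with a >= 2519,
   and their curvature is at most 1/2519. Each of them sends the charge 1/126 + 1/2519 to the other
   corners of its triangle, where the curvature is negative enough to absorb it; afterwards every
   vertex of a map without listed vertices has curvature at most -1/126, so that
   126 * chi <= - V.

   That V - E + F is the Euler characteristic defined by singular homology follows by adding the open
   edges and then the vertices to the disjoint union of the faces. Whenever a closed set C with open
   neighbourhood N is added to X, the long exact sequences and excision give
   chi (X Un C) = chi X + chi N - chi (N - C). The neighbourhood of an edge is an open strip glued from
   the two pages of faces along the edge, which is open by invariance of domain; this also shows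
   that no third page exists, whereas a single page would embed a disc in a closed half-plane with its
   centre on the boundary line. At a vertex a punctured disc is connected, so that the corners at the
   vertex form a single cycle; this makes the faces across two sides of a triangle distinct corners. *)
theory Submission
  imports Defs
begin

section \<open>The rank of an Abelian group\<close>

text \<open>\<open>group_rank\<close> is a greatest cardinality, meaningful only when independent
  sets are bounded. Finiteness of the homology is not known beforehand, so \<open>has_rank\<close>
  and \<open>has_euler_char\<close> assert that the ranks exist together with their values, and each
  gluing step derives the ranks of the larger space from its pieces, beginning with contractible
  faces. Nor is it given that an edge has two sides or that there are finitely many faces: edges are
  arbitrary arcs without collars, and the only local data are the closed-disc maps of the boundary
  walks, which are cut into pages. The charge \<delta> is exactly what brings a curvature of 1/2519
  down to -1/126. Two corners of one triangle can be heavy, namely when the faces across its sides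
  are two of degree 6 and a large one, or one of degree 6 and two large ones. The third corner then
  lies between two faces of the same kind and has to balance both, which explains the value 2 *
  \<delta> in \<open>transfer\<close>.\<close>

definition int_comb :: "('b, 'c) monoid_scheme \<Rightarrow> ('b \<Rightarrow> int) \<Rightarrow> 'b set \<Rightarrow> 'b" where
  "int_comb A c B = finprod A (\<lambda>b. b [^]\<^bsub>A\<^esub> c b) B"

text \<open>\<open>S\<close> is a mere subset, so that kernels and images are measured inside the
  ambient group without subgroup structures. Only some power of each element has to be a combination
  of \<open>B\<close>: torsion is ignored.\<close>

definition has_rank :: "('b, 'c) monoid_scheme \<Rightarrow> 'b set \<Rightarrow> nat \<Rightarrow> bool" where
  "has_rank A S n \<longleftrightarrow> (\<exists>B. int_independent A B \<and> B \<subseteq> S \<and> card B = n \<and>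
     (\<forall>x\<in>S. \<exists>k c. k \<noteq> 0 \<and> x [^]\<^bsub>A\<^esub> (k::int) = int_comb A c B))"

abbreviation full_rank :: "('b, 'c) monoid_scheme \<Rightarrow> nat \<Rightarrow> bool" where
  "full_rank A n \<equiv> has_rank A (carrier A) n"

lemma int_independent_alt:
  "int_independent A B \<longleftrightarrow> finite B \<and> B \<subseteq> carrier A \<and>
     (\<forall>c. int_comb A c B = \<one>\<^bsub>A\<^esub> \<longrightarrow> (\<forall>b\<in>B. c b = 0))"
  by (simp add: int_independent_def int_comb_def)

context comm_group
begin

lemma int_comb_closed:
  assumes "B \<subseteq> carrier G" shows "int_comb G c B \<in> carrier G"
  unfolding int_comb_def by (rule finprod_closed) (use assms in auto)

lemma int_comb_cong:
  assumes "B \<subseteq> carrier G" "\<And>b. b \<in> B \<Longrightarrow> c b = d b"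
  shows "int_comb G c B = int_comb G d B"
  unfolding int_comb_def using assms by (intro finprod_cong') auto

lemma int_comb_add:
  assumes "B \<subseteq> carrier G"
  shows "int_comb G (\<lambda>b. c b + d b) B = int_comb G c B \<otimes> int_comb G d B"
proof -
  have "int_comb G (\<lambda>b. c b + d b) B = finprod G (\<lambda>b. b [^] c b \<otimes> b [^] d b) B"
    unfolding int_comb_def using assms by (intro finprod_cong') (auto simp: int_pow_mult)
  also have "\<dots> = int_comb G c B \<otimes> int_comb G d B"
    unfolding int_comb_def using assms by (intro finprod_multf) auto
  finally show ?thesis .
qed

lemma int_comb_zero:
  assumes "\<And>b. b \<in> B \<Longrightarrow> c b = 0"
  shows "int_comb G c B = \<one>"
  unfolding int_comb_def by (rule finprod_one_eqI) (use assms in auto)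

lemma int_comb_insert:
  assumes "finite B" "B \<subseteq> carrier G" "x \<in> carrier G" "x \<notin> B"
  shows "int_comb G c (insert x B) = x [^] c x \<otimes> int_comb G c B"
  unfolding int_comb_def using assms by (intro finprod_insert) auto

lemma int_comb_scale:
  assumes "finite B" "B \<subseteq> carrier G"
  shows "int_comb G (\<lambda>b. k * c b) B = int_comb G c B [^] (k::int)"
  using assms
proof (induction B)
  case (insert x B)
  have "int_comb G (\<lambda>b. k * c b) (insert x B) = x [^] (k * c x) \<otimes> int_comb G (\<lambda>b. k * c b) B"
    using insert by (intro int_comb_insert) auto
  also have "\<dots> = (x [^] c x) [^] k \<otimes> int_comb G c B [^] k"
    using insert by (simp add: int_pow_pow mult.commute)
  also have "\<dots> = int_comb G c (insert x B) [^] k"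
    using insert by (simp add: int_comb_insert int_pow_distrib int_comb_closed)
  finally show ?case .
qed (simp add: int_comb_def)

lemma int_comb_uminus:
  assumes "finite B" "B \<subseteq> carrier G"
  shows "int_comb G (\<lambda>b. - c b) B = inv (int_comb G c B)"
  using int_comb_scale[OF assms, of "-1" c] int_comb_closed[OF assms(2)] 
  by (simp add: int_pow_neg)

lemma int_comb_Un:
  assumes "finite B" "finite C" "B \<subseteq> carrier G" "C \<subseteq> carrier G" "B \<inter> C = {}"
  shows "int_comb G c (B \<union> C) = int_comb G c B \<otimes> int_comb G c C"
  unfolding int_comb_def using assms by (intro finprod_Un_disjoint) auto

lemma int_comb_finprod:
  assumes "finite J" "finite B" "B \<subseteq> carrier G"
  shows "finprod G (\<lambda>j. int_comb G (d j) B) J = int_comb G (\<lambda>b. \<Sum>j\<in>J. d j b) B"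
  using assms(1)
proof (induction J)
  case empty
  show ?case by (simp add: int_comb_zero)
next
  case (insert j J)
  then show ?case
    using assms by (simp add: int_comb_closed Pi_iff flip: int_comb_add)
qed

end

section \<open>Independence, exchange and rank-nullity\<close>

lemma int_comb_hom:
  assumes "comm_group A" "comm_group C" "h \<in> hom A C" "finite B" "B \<subseteq> carrier A" "inj_on h B"
    and "\<And>b. b \<in> B \<Longrightarrow> d (h b) = c b"
  shows "h (int_comb A c B) = int_comb C d (h ` B)"
  using assms(4-7)
proof (induction B)
  case empty
  then show ?case using assms(1-3)
    by (simp add: int_comb_def comm_monoid.finprod_empty comm_group.axioms(1) hom_one comm_group.axioms(2))
next
  case (insert x B)
  interpret A: comm_group A by fact
  interpret C: comm_group C by fact
  have hx: "h x \<in> carrier C" "h ` B \<subseteq> carrier C"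
    using insert assms(3) by (auto simp: hom_def)
  have "h (int_comb A c (insert x B)) = h (x [^]\<^bsub>A\<^esub> c x \<otimes>\<^bsub>A\<^esub> int_comb A c B)"
    using insert by (subst A.int_comb_insert) auto
  also have "\<dots> = h x [^]\<^bsub>C\<^esub> c x \<otimes>\<^bsub>C\<^esub> h (int_comb A c B)"
    using insert assms(3) A.int_comb_closed[of B c]
    by (simp add: hom_mult hom_int_pow[OF assms(3)] A.group_axioms C.group_axioms)
  also have "h (int_comb A c B) = int_comb C d (h ` B)"
    using insert by auto
  also have "h x [^]\<^bsub>C\<^esub> c x = h x [^]\<^bsub>C\<^esub> d (h x)"
    using insert by auto
  also have "h x [^]\<^bsub>C\<^esub> d (h x) \<otimes>\<^bsub>C\<^esub> int_comb C d (h ` B) = int_comb C d (insert (h x) (h ` B))"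
    using insert hx by (subst C.int_comb_insert) (auto simp: inj_on_def)
  finally show ?case by simp
qed

text \<open>Fraction-free Gaussian elimination: cross-multiplication with a pivot \<open>p\<close>
  of the equation \<open>b0\<close> keeps all coefficients integral and leaves one equation and one
  unknown fewer.\<close>

lemma homogeneous_int_system:
  fixes c :: "'j \<Rightarrow> 'b \<Rightarrow> int"
  assumes "finite B" "finite J" "card B < card J"
  shows "\<exists>x. (\<exists>j\<in>J. x j \<noteq> 0) \<and> (\<forall>b\<in>B. (\<Sum>j\<in>J. x j * c j b) = 0)"
  using assms
proof (induction B arbitrary: J c)
  case empty
  then obtain j where "j \<in> J" by (auto simp: card_gt_0_iff)
  then show ?case by (intro exI[of _ "\<lambda>_. 1"]) auto
next
  case (insert b0 B)
  show ?case
  proof (cases "\<forall>j\<in>J. c j b0 = 0")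
    case True
    obtain x where "\<exists>j\<in>J. x j \<noteq> 0" "\<forall>b\<in>B. (\<Sum>j\<in>J. x j * c j b) = 0"
      using insert.IH[of J c] insert.prems insert.hyps by fastforce
    with True show ?thesis by (intro exI[of _ x]) auto
  next
    case False
    then obtain p where p: "p \<in> J" "c p b0 \<noteq> 0" by auto
    let ?J = "J - {p}"
    have "card B < card ?J" using insert p by (simp add: card_insert_if)
    then have "\<exists>y. (\<exists>j\<in>?J. y j \<noteq> 0) \<and>
       (\<forall>b\<in>B. (\<Sum>j\<in>?J. y j * (c p b0 * c j b - c j b0 * c p b)) = 0)"
      using insert.prems by (intro insert.IH) auto
    then obtain y where y: "\<exists>j\<in>?J. y j \<noteq> 0"
       "\<forall>b\<in>B. (\<Sum>j\<in>?J. y j * (c p b0 * c j b - c j b0 * c p b)) = 0"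
      by blast
    \<comment> \<open>Scaling the other unknowns by the pivot coefficient makes the solved value of
      the pivot unknown an integer.\<close>
    define x where "x j = (if j = p then - (\<Sum>j\<in>?J. y j * c j b0) else y j * c p b0)" for j
    have split: "(\<Sum>j\<in>J. x j * c j b) = (\<Sum>j\<in>?J. y j * (c p b0 * c j b - c j b0 * c p b))" for b
    proof -
      have "(\<Sum>j\<in>J. x j * c j b) = x p * c p b + (\<Sum>j\<in>?J. x j * c j b)"
        using p insert by (simp add: sum.remove)
      also have "(\<Sum>j\<in>?J. x j * c j b) = (\<Sum>j\<in>?J. y j * c p b0 * c j b)"
        by (intro sum.cong) (auto simp: x_def)
      finally have "(\<Sum>j\<in>J. x j * c j b) = x p * c p b + (\<Sum>j\<in>?J. y j * c p b0 * c j b)" .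
      moreover have "x p * c p b = - (\<Sum>j\<in>?J. y j * (c j b0 * c p b))"
        by (simp add: x_def sum_distrib_right mult.assoc)
      ultimately show ?thesis
        by (simp add: sum_subtractf right_diff_distrib mult.assoc)
    qed
    have "(\<Sum>j\<in>?J. y j * (c p b0 * c j b0 - c j b0 * c p b0)) = 0" by simp
    then have "\<forall>b\<in>insert b0 B. (\<Sum>j\<in>J. x j * c j b) = 0" using y(2) split by auto
    moreover have "\<exists>j\<in>J. x j \<noteq> 0" using y(1) p by (auto simp: x_def)
    ultimately show ?thesis by blast
  qed
qed

text \<open>Powers of the elements of \<open>B'\<close> are combinations of \<open>n\<close>
  elements, so with more than \<open>n\<close> of them the exponents satisfy a nontrivial
  homogeneous system with fewer equations than unknowns.\<close>

lemma (in comm_group) int_independent_card_le: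
  assumes "has_rank G S n" "int_independent G B'" "B' \<subseteq> S"
  shows "card B' \<le> n"
proof (rule ccontr)
  assume "\<not> card B' \<le> n"
  obtain B where B: "finite B" "B \<subseteq> carrier G" "card B = n"
     and ex: "\<And>x. x\<in>S \<Longrightarrow> \<exists>k c. k \<noteq> 0 \<and> x [^] (k::int) = int_comb G c B"
    using assms(1) by (auto simp: has_rank_def int_independent_def)
  have B': "finite B'" "B' \<subseteq> carrier G" using assms(2) by (auto simp: int_independent_def)
  have "\<forall>x\<in>B'. \<exists>k c. k \<noteq> 0 \<and> x [^] (k::int) = int_comb G c B" using ex assms(3) by auto
  then obtain k c where kc: "\<And>x. x \<in> B' \<Longrightarrow> k x \<noteq> 0 \<and> x [^] (k x :: int) = int_comb G (c x) B"
    by metis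
  obtain y where y: "\<exists>j\<in>B'. y j \<noteq> 0" "\<forall>b\<in>B. (\<Sum>j\<in>B'. y j * c j b) = 0"
    using homogeneous_int_system[of B B' c] B B' \<open>\<not> card B' \<le> n\<close> by auto
  have "int_comb G (\<lambda>x. k x * y x) B' = finprod G (\<lambda>x. int_comb G (\<lambda>b. y x * c x b) B) B'"
    unfolding int_comb_def[of G "\<lambda>x. k x * y x"]
  proof (rule finprod_cong')
    fix x assume x: "x \<in> B'"
    then have "x [^] (k x * y x) = (x [^] k x) [^] y x" using B' by (simp add: int_pow_pow subset_iff)
    also have "\<dots> = int_comb G (\<lambda>b. y x * c x b) B"
      using kc[OF x] B by (simp add: int_comb_scale)
    finally show "x [^] (k x * y x) = int_comb G (\<lambda>b. y x * c x b) B" .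
  qed (use B in \<open>auto simp: int_comb_closed\<close>)
  also have "\<dots> = int_comb G (\<lambda>b. \<Sum>x\<in>B'. y x * c x b) B"
    using B B' by (simp add: int_comb_finprod)
  also have "\<dots> = \<one>" using y(2) by (simp add: int_comb_zero)
  finally have "\<forall>x\<in>B'. k x * y x = 0" using assms(2) unfolding int_independent_alt by blast
  with y(1) kc show False by auto
qed

lemma (in comm_group) group_rank_eq:
  assumes "full_rank G n"
  shows "group_rank G = n"
  unfolding group_rank_def
proof (rule Greatest_equality)
  show "\<exists>B. int_independent G B \<and> card B = n" using assms by (auto simp: has_rank_def)
  show "m \<le> n" if "\<exists>B. int_independent G B \<and> card B = m" for m
    using that int_independent_card_le[OF assms] by (auto simp: int_independent_def)
qed

text \<open>The bound provides a largest independent subset of \<open>S\<close>. Any further element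
  enters a relation with it with nonzero exponent, so that a power of it is a combination.\<close>

lemma (in comm_group) has_rank_bounded:
  assumes "S \<subseteq> carrier G" and le: "\<And>B. int_independent G B \<Longrightarrow> B \<subseteq> S \<Longrightarrow> card B \<le> N"
  shows "\<exists>m\<le>N. has_rank G S m"
proof -
  let ?P = "\<lambda>m. \<exists>B. int_independent G B \<and> B \<subseteq> S \<and> card B = m"
  have "?P 0" by (intro exI[of _ "{}"]) (auto simp: int_independent_def)
  then obtain m where m: "?P m" "\<And>k. ?P k \<Longrightarrow> k \<le> m"
    using le GreatestI_nat[of ?P 0 N] Greatest_le_nat[of ?P _ N] by blast
  then obtain B where B: "int_independent G B" "B \<subseteq> S" "card B = m" by blast
  have fB: "finite B" "B \<subseteq> carrier G" using B(1) by (auto simp: int_independent_def)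
  have "\<exists>k c. k \<noteq> 0 \<and> x [^] (k::int) = int_comb G c B" if x: "x \<in> S" for x
  proof (cases "x \<in> B")
    case True
    define c where "c b = (if b = x then 1 else 0::int)" for b
    have xc: "x \<in> carrier G" using x assms(1) by auto
    have "int_comb G c B = int_comb G c (insert x (B - {x}))"
      using True by (simp add: insert_absorb)
    also have "\<dots> = x [^] c x \<otimes> int_comb G c (B - {x})"
      using fB xc by (intro int_comb_insert) auto
    also have "\<dots> = x" using int_comb_zero[of "B - {x}" c] xc by (simp add: c_def)
    finally show ?thesis using xc by (intro exI[of _ 1] exI[of _ c]) auto
  next
    case False
    have xc: "x \<in> carrier G" using x assms(1) by auto
    have "\<not> int_independent G (insert x B)"
      using m(2)[of "Suc m"] B False x fB by (metis card_insert_disjoint insert_subset not_less_eq_eq order_refl)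
    then obtain c where c: "int_comb G c (insert x B) = \<one>" "\<exists>b\<in>insert x B. c b \<noteq> 0"
      using fB xc by (auto simp: int_independent_alt)
    have eq: "x [^] c x \<otimes> int_comb G c B = \<one>"
      using c(1) fB xc False by (simp add: int_comb_insert)
    have "c x \<noteq> 0"
    proof
      assume "c x = 0"
      then have "int_comb G c B = \<one>" using eq fB by (simp add: int_comb_closed)
      then show False using B(1) c(2) \<open>c x = 0\<close> unfolding int_independent_alt by auto
    qed
    moreover have "x [^] c x = int_comb G (\<lambda>b. - c b) B"
      using eq fB xc by (simp add: int_comb_uminus int_comb_closed inv_equality[symmetric] inv_solve_right)
    ultimately show ?thesis by blast
  qed
  then have "has_rank G S m" using B unfolding has_rank_def by blast
  moreover have "m \<le> N" using le B by blast
  ultimately show ?thesis by blast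
qed

lemma (in comm_group) has_rank_subset:
  assumes "has_rank G T n" "S \<subseteq> T" "T \<subseteq> carrier G"
  shows "\<exists>m. has_rank G S m"
proof -
  have "\<exists>m\<le>n. has_rank G S m"
  proof (rule has_rank_bounded)
    show "S \<subseteq> carrier G" using assms by blast
    show "card B \<le> n" if "int_independent G B" "B \<subseteq> S" for B
      using int_independent_card_le[OF assms(1)] that assms(2) by blast
  qed
  then show ?thesis by blast
qed

lemma (in comm_group) has_rank_unique:
  assumes "has_rank G S m" "has_rank G S n" shows "m = n"
proof (rule antisym)
  show "m \<le> n" using int_independent_card_le[OF assms(2)] assms(1) by (auto simp: has_rank_def)
  show "n \<le> m" using int_independent_card_le[OF assms(1)] assms(2) by (auto simp: has_rank_def)
qed

text \<open>Take a basis up to torsion of the kernel and preimages of one of the image. A power of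
  \<open>h x\<close> is matched by a combination of the preimages; the quotient lies in the kernel
  and needs a second exponent, whence the product \<open>n * q\<close>.\<close>

lemma has_rank_kernel_image:
  assumes A: "comm_group A" and C: "comm_group C" and h: "h \<in> hom A C"
    and k: "has_rank A (kernel A C h) k" and m: "has_rank C (h ` carrier A) m"
  shows "full_rank A (k + m)"
proof -
  interpret A: comm_group A by fact
  interpret C: comm_group C by fact
  interpret group_hom A C h by unfold_locales (fact h)
  obtain K where K: "int_independent A K" "K \<subseteq> kernel A C h" "card K = k"
    and Ks: "\<And>x. x \<in> kernel A C h \<Longrightarrow> \<exists>k c. k \<noteq> 0 \<and> x [^]\<^bsub>A\<^esub> (k::int) = int_comb A c K"
    using k by (auto simp: has_rank_def)
  obtain D where D: "int_independent C D" "D \<subseteq> h ` carrier A" "card D = m"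
    and Ds: "\<And>x. x \<in> h ` carrier A \<Longrightarrow> \<exists>k c. k \<noteq> 0 \<and> x [^]\<^bsub>C\<^esub> (k::int) = int_comb C c D"
    using m unfolding has_rank_def by metis
  obtain L where L: "L \<subseteq> carrier A" "inj_on h L" "h ` L = D"
    using D(2) by (metis subset_image_inj)
  have fin: "finite K" "K \<subseteq> carrier A" "finite D" "D \<subseteq> carrier C" "finite L"
    using K D L by (auto simp: int_independent_def intro: finite_imageD)
  have hL: "h (int_comb A c L) = int_comb C (\<lambda>d. c (inv_into L h d)) D" for c
    using int_comb_hom[OF A C h fin(5) L(1,2), of "\<lambda>d. c (inv_into L h d)" c] L by auto
  have hK: "h x = \<one>\<^bsub>C\<^esub>" if "x \<in> kernel A C h" for x using that by (auto simp: kernel_def)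
  have kerc: "int_comb A c K \<in> kernel A C h" for c
    using fin K(2)
  proof (induction K)
    case empty
    then show ?case using h by (simp add: int_comb_def kernel_def hom_one A.group_axioms C.group_axioms)
  next
    case (insert x K)
    then have "h (x [^]\<^bsub>A\<^esub> c x) = \<one>\<^bsub>C\<^esub>"
      using Group.hom_int_pow[OF h, of x "c x"] hK[of x] by (auto simp: A.group_axioms C.group_axioms)
    then show ?case using insert h
      by (simp add: A.int_comb_insert A.int_comb_closed kernel_def hom_mult)
  qed
  \<comment> \<open>A common element would be mapped to the identity, which no independent set
    contains.\<close>
  have disj: "K \<inter> L = {}"
  proof (rule ccontr)
    assume "K \<inter> L \<noteq> {}"
    then obtain x where x: "x \<in> K" "x \<in> L" by auto
    then have "\<one>\<^bsub>C\<^esub> \<in> D" using hK K(2) L(3) by (metis image_eqI subsetD)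
    moreover have "int_comb C (\<lambda>d. if d = \<one>\<^bsub>C\<^esub> then 1 else 0) D = \<one>\<^bsub>C\<^esub>"
      unfolding int_comb_def by (rule C.finprod_one_eqI) auto
    ultimately show False using D(1) unfolding int_independent_alt by fastforce
  qed
  have "int_independent A (K \<union> L)"
    unfolding int_independent_alt
  proof (intro conjI allI impI)
    fix c assume c: "int_comb A c (K \<union> L) = \<one>\<^bsub>A\<^esub>"
    have eq: "int_comb A c K \<otimes>\<^bsub>A\<^esub> int_comb A c L = \<one>\<^bsub>A\<^esub>"
      using c fin L disj by (simp add: A.int_comb_Un)
    then have "h (int_comb A c K) \<otimes>\<^bsub>C\<^esub> h (int_comb A c L) = \<one>\<^bsub>C\<^esub>"
      using h fin L by (metis A.group_axioms A.int_comb_closed C.group_axioms hom_mult hom_one)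
    then have "int_comb C (\<lambda>d. c (inv_into L h d)) D = \<one>\<^bsub>C\<^esub>"
      using hK[OF kerc[of c]] fin by (simp add: hL C.int_comb_closed)
    then have "\<forall>d\<in>D. c (inv_into L h d) = 0" using D(1) unfolding int_independent_alt by blast
    then have cL: "\<forall>b\<in>L. c b = 0" using L by auto
    then have "int_comb A c L = \<one>\<^bsub>A\<^esub>" by (simp add: A.int_comb_zero)
    then have "int_comb A c K = \<one>\<^bsub>A\<^esub>" using eq fin by (simp add: A.int_comb_closed)
    then show "\<forall>b\<in>K \<union> L. c b = 0" using K(1) cL unfolding int_independent_alt by blast
  qed (use fin L in auto)
  moreover have "card (K \<union> L) = k + m"
    using fin disj K(3) D(3) L card_image[of h L] by (simp add: card_Un_disjoint)
  moreover have "\<exists>k c. k \<noteq> 0 \<and> x [^]\<^bsub>A\<^esub> (k::int) = int_comb A c (K \<union> L)" if x: "x \<in> carrier A" for x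
  proof -
    obtain n c where n: "n \<noteq> 0" "h x [^]\<^bsub>C\<^esub> (n::int) = int_comb C c D" using Ds x by blast
    define y where "y = int_comb A (\<lambda>l. c (h l)) L"
    have yc: "y \<in> carrier A" using L by (simp add: y_def A.int_comb_closed)
    have "h y = int_comb C c D"
      unfolding y_def using int_comb_hom[OF A C h fin(5) L(1,2), of c] L(3) by simp
    then have "h (x [^]\<^bsub>A\<^esub> n) = h y" using Group.hom_int_pow[OF h x] n by (simp add: A.group_axioms C.group_axioms)
    then have z: "x [^]\<^bsub>A\<^esub> n \<otimes>\<^bsub>A\<^esub> inv\<^bsub>A\<^esub> y \<in> kernel A C h"
      using x yc by (simp add: kernel_def)
    then obtain q d where q: "q \<noteq> 0" "(x [^]\<^bsub>A\<^esub> n \<otimes>\<^bsub>A\<^esub> inv\<^bsub>A\<^esub> y) [^]\<^bsub>A\<^esub> (q::int) = int_comb A d K"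
      using Ks by blast
    define e where "e b = (if b \<in> K then d b else q * c (h b))" for b
    have "int_comb A e K = int_comb A d K" using fin by (intro A.int_comb_cong) (auto simp: e_def)
    moreover have "int_comb A e L = y [^]\<^bsub>A\<^esub> q"
      unfolding y_def using fin L disj
      by (subst A.int_comb_scale[symmetric]) (auto simp: e_def intro!: A.int_comb_cong)
    ultimately have "int_comb A e (K \<union> L) = (x [^]\<^bsub>A\<^esub> n \<otimes>\<^bsub>A\<^esub> inv\<^bsub>A\<^esub> y) [^]\<^bsub>A\<^esub> q \<otimes>\<^bsub>A\<^esub> y [^]\<^bsub>A\<^esub> q"
      using fin L disj q by (simp add: A.int_comb_Un)
    also have "\<dots> = (x [^]\<^bsub>A\<^esub> n \<otimes>\<^bsub>A\<^esub> inv\<^bsub>A\<^esub> y \<otimes>\<^bsub>A\<^esub> y) [^]\<^bsub>A\<^esub> q"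
      using x yc by (simp add: A.int_pow_distrib)
    also have "\<dots> = x [^]\<^bsub>A\<^esub> (n * q)"
      using x yc by (simp add: A.m_assoc A.int_pow_pow)
    finally show ?thesis using n q by (intro exI[of _ "n * q"] exI[of _ e]) auto
  qed
  moreover have "K \<union> L \<subseteq> carrier A" using fin L by auto
  ultimately show ?thesis unfolding has_rank_def by blast
qed

text \<open>Only the rank of the domain is given. The image has a rank because its independent sets
  lift to independent sets of \<open>A\<close>, which bounds their size.\<close>

lemma rank_nullity:
  assumes A: "comm_group A" and C: "comm_group C" and h: "h \<in> hom A C"
    and n: "full_rank A n"
  obtains k m where "has_rank A (kernel A C h) k" "has_rank C (h ` carrier A) m" "n = k + m"
proof -
  interpret A: comm_group A by fact
  interpret C: comm_group C by fact
  obtain k where k: "has_rank A (kernel A C h) k"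
    using A.has_rank_subset[OF n, of "kernel A C h"] by (auto simp: kernel_def)
  have "\<exists>m\<le>n. has_rank C (h ` carrier A) m"
  proof (rule C.has_rank_bounded)
    show "h ` carrier A \<subseteq> carrier C" using h by (auto simp: hom_def)
    fix D assume D: "int_independent C D" "D \<subseteq> h ` carrier A"
    obtain L where L: "L \<subseteq> carrier A" "inj_on h L" "h ` L = D"
      using D(2) by (metis subset_image_inj)
    have fin: "finite L" using D L by (auto simp: int_independent_def intro: finite_imageD)
    have "int_independent A L"
      unfolding int_independent_alt
    proof (intro conjI allI impI)
      fix c assume "int_comb A c L = \<one>\<^bsub>A\<^esub>"
      then have "int_comb C (\<lambda>d. c (inv_into L h d)) D = \<one>\<^bsub>C\<^esub>"
        using int_comb_hom[OF A C h fin L(1,2), of "\<lambda>d. c (inv_into L h d)" c] L h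
        by (simp add: hom_one A.group_axioms C.group_axioms)
      then have "\<forall>d\<in>D. c (inv_into L h d) = 0" using D(1) unfolding int_independent_alt by blast
      then show "\<forall>b\<in>L. c b = 0" using L by auto
    qed (use fin L in auto)
    then have "card L \<le> n" using A.int_independent_card_le[OF n] L by blast
    then show "card D \<le> n" using card_image[OF L(2)] L(3) by simp
  qed
  then obtain m where m: "has_rank C (h ` carrier A) m" by blast
  show ?thesis
    using that[OF k m] A.has_rank_unique[OF n has_rank_kernel_image[OF A C h k m]] by blast
qed

lemma has_rank_trivial:
  assumes "comm_group A" "S \<subseteq> {\<one>\<^bsub>A\<^esub>}"
  shows "has_rank A S 0"
proof -
  interpret comm_group A by fact
  show ?thesis unfolding has_rank_def
    using assms(2) by (intro exI[of _ "{}"]) (auto simp: int_independent_def int_comb_def intro!: exI[of _ 1])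
qed

lemma has_rank_iso:
  assumes A: "comm_group A" and C: "comm_group C" and h: "h \<in> iso A C"
    and n: "full_rank A n"
  shows "full_rank C n"
proof -
  interpret A: comm_group A by fact
  interpret C: comm_group C by fact
  have hom: "h \<in> hom A C" and bij: "bij_betw h (carrier A) (carrier C)"
    using h by (auto simp: iso_def)
  obtain k m where km: "has_rank A (kernel A C h) k" "has_rank C (h ` carrier A) m" "n = k + m"
    using rank_nullity[OF A C hom n] .
  have "kernel A C h \<subseteq> {\<one>\<^bsub>A\<^esub>}"
  proof
    fix x assume "x \<in> kernel A C h"
    then have "x \<in> carrier A" "h x = h \<one>\<^bsub>A\<^esub>"
      using hom_one[OF hom A.group_axioms C.group_axioms] by (auto simp: kernel_def)
    then show "x \<in> {\<one>\<^bsub>A\<^esub>}"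
      using bij A.one_closed unfolding bij_betw_def inj_on_def by blast
  qed
  then have "k = 0" using has_rank_trivial[OF A] A.has_rank_unique km(1) by blast
  then show ?thesis using km bij by (simp add: bij_betw_def)
qed


section \<open>Euler characteristics of spaces\<close>

text \<open>The parameter \<open>d\<close> bounds the degrees of the nonzero Betti numbers; for \<open>d = -1\<close> all of them
  vanish and \<open>c = 0\<close>.\<close>

definition has_euler_char :: "int \<Rightarrow> 'a topology \<Rightarrow> int \<Rightarrow> bool" where
  "has_euler_char d X c \<longleftrightarrow> (\<exists>b. (\<forall>p. full_rank (homology_group p X) (b p)) \<and>
     (\<forall>p. p < 0 \<or> d < p \<longrightarrow> b p = 0) \<and> c = (\<Sum>p\<le>nat d. (-1) ^ p * int (b (int p))))"

lemma alternating_sum_extend: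
  fixes b :: "int \<Rightarrow> nat"
  assumes "\<And>p. p > d \<Longrightarrow> b p = 0" "d \<le> int m"
  shows "(\<Sum>p\<le>nat d. (-1) ^ p * int (b (int p))) = (\<Sum>p\<le>m. (-1) ^ p * int (b (int p)))"
proof (intro sum.mono_neutral_left ballI)
  fix i assume "i \<in> {..m} - {..nat d}"
  then have "d < int i" using nat_le_iff[of d i] by auto
  then show "(-1) ^ i * int (b (int i)) = 0" using assms(1) by simp
qed (use assms(2) in auto)

lemma has_euler_char_mono:
  assumes "has_euler_char d X c" "d \<le> d'"
  shows "has_euler_char d' X c"
proof -
  obtain b where b: "\<And>p. full_rank (homology_group p X) (b p)"
    "\<And>p. p < 0 \<or> d < p \<Longrightarrow> b p = 0" "c = (\<Sum>p\<le>nat d. (-1) ^ p * int (b (int p)))"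
    using assms(1) by (auto simp: has_euler_char_def)
  have "c = (\<Sum>p\<le>nat d'. (-1) ^ p * int (b (int p)))"
    unfolding b(3) by (rule alternating_sum_extend) (use b(2) assms(2) in auto)
  moreover have "\<And>p. p < 0 \<or> d' < p \<Longrightarrow> b p = 0" using b(2) assms(2) by force
  ultimately show ?thesis using b(1) unfolding has_euler_char_def by blast
qed

lemma has_euler_char_homotopy:
  assumes "has_euler_char d X c" "X homotopy_equivalent_space Y"
  shows "has_euler_char d Y c"
proof -
  have "full_rank (homology_group p Y) n"
    if "full_rank (homology_group p X) n" for p n
  proof -
    obtain h where "h \<in> iso (homology_group p X) (homology_group p Y)"
      using homotopy_equivalent_space_imp_isomorphic_homology_groups[OF assms(2), of p]
      by (auto simp: is_iso_def)
    then show ?thesis using has_rank_iso[OF abelian_homology_group abelian_homology_group _ that] by blast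
  qed
  then show ?thesis using assms(1) unfolding has_euler_char_def by blast
qed

lemma has_euler_char_homeomorphic:
  assumes "X homeomorphic_space Y" "has_euler_char d Y c"
  shows "has_euler_char d X c"
  using assms has_euler_char_homotopy homeomorphic_imp_homotopy_equivalent_space homeomorphic_space_sym
  by blast

lemma has_euler_char_empty:
  assumes "topspace X = {}" shows "has_euler_char (- 1) X 0"
proof -
  have "full_rank (homology_group p X) 0" for p
    using trivial_homology_group_empty[OF assms, of p] 
    by (intro has_rank_trivial) (auto simp: trivial_group_def)
  then show ?thesis unfolding has_euler_char_def by (intro exI[of _ "\<lambda>_. 0"]) auto
qed

lemma has_rank_integer_group: "has_rank integer_group UNIV 1"
proof -
  interpret comm_group integer_group by (rule abelian_integer_group)
  have comb: "int_comb integer_group c {1} = c 1" for c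
    using int_comb_insert[of "{}" "1::int" c] int_comb_zero[of "{}" c] by simp
  have "int_independent integer_group {1}"
    unfolding int_independent_alt by (simp add: comb)
  moreover have "\<exists>k c. k \<noteq> 0 \<and> x [^]\<^bsub>integer_group\<^esub> (k::int) = int_comb integer_group c {1}" for x
    by (intro exI[of _ 1] exI[of _ "\<lambda>_. x"]) (simp add: comb)
  ultimately show ?thesis unfolding has_rank_def by (intro exI[of _ "{1}"]) auto
qed

lemma has_euler_char_singleton:
  assumes "topspace X = {a}" shows "has_euler_char 0 X 1"
proof -
  define b where "b p = (if p = 0 then 1 else 0::nat)" for p :: int
  have "full_rank (homology_group p X) (b p)" for p
  proof (cases "p = 0")
    case True
    have "path_connected_space X"
      using assms contractible_imp_path_connected_space contractible_space_subset_singleton[of X a]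
      by (metis subset_refl)
    then have "integer_group \<cong> homology_group 0 X"
      using assms isomorphic_integer_zeroth_homology_group group.iso_sym by fastforce
    then obtain h where "h \<in> iso integer_group (homology_group 0 X)" by (auto simp: is_iso_def)
    then have "full_rank (homology_group 0 X) 1"
      by (rule has_rank_iso[OF abelian_integer_group abelian_homology_group])
         (use has_rank_integer_group in simp)
    then show ?thesis using True by (simp add: b_def)
  next
    case False
    then show ?thesis using homology_dimension_axiom[OF assms, of p]
      by (simp add: b_def) (intro has_rank_trivial, auto simp: trivial_group_def)
  qed
  then show ?thesis unfolding has_euler_char_def by (intro exI[of _ b]) (auto simp: b_def)
qed

lemma has_euler_char_contractible:
  assumes "contractible_space X" "topspace X \<noteq> {}" shows "has_euler_char 0 X 1"
proof -
  obtain a where a: "a \<in> topspace X" "X homotopy_equivalent_space (subtopology X {a})"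
    using assms contractible_eq_homotopy_equivalent_singleton_subtopology[of X] by auto
  have "has_euler_char 0 (subtopology X {a}) 1" using a(1) by (intro has_euler_char_singleton[of _ a]) auto
  then show ?thesis using a(2) has_euler_char_homotopy homotopy_equivalent_space_sym by blast
qed

lemma euler_characteristic_eq:
  assumes "has_euler_char 2 X c" shows "euler_characteristic X = c"
proof -
  obtain b where b: "\<And>p. full_rank (homology_group p X) (b p)"
    "c = (\<Sum>p\<le>nat 2. (-1) ^ p * int (b (int p)))"
    using assms by (auto simp: has_euler_char_def)
  have "group_rank (homology_group p X) = b p" for p
    by (rule comm_group.group_rank_eq) (use b(1) in simp_all)
  then show ?thesis by (simp add: euler_characteristic_def b(2))
qed

section \<open>Long exact sequence, excision and additivity\<close>

lemma les_ranks:
  fixes X :: "'a topology" and S :: "'a set" and p :: int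
  defines "HX \<equiv> (\<lambda>p. homology_group p X)" and "HS \<equiv> (\<lambda>p. homology_group p (subtopology X S))"
    and "HR \<equiv> (\<lambda>p. relative_homology_group p X S)"
    and "f \<equiv> (\<lambda>p. hom_induced p (subtopology X S) {} X {} id)"
    and "g \<equiv> (\<lambda>p. hom_induced p X {} X S id)" and "bd \<equiv> (\<lambda>p. hom_boundary p X S)"
  shows "f p ` carrier (HS p) = kernel (HX p) (HR p) (g p)"
    and "g p ` carrier (HX p) = kernel (HR p) (HS (p-1)) (bd p)"
    and "bd p ` carrier (HR p) = kernel (HS (p-1)) (HX (p-1)) (f (p-1))"
    and "f p \<in> hom (HS p) (HX p)" "g p \<in> hom (HX p) (HR p)" "bd p \<in> hom (HR p) (HS (p-1))"
  unfolding assms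
  using homology_exactness_axiom_3[of p X S] homology_exactness_axiom_1[of p X S]
    homology_exactness_axiom_2[of p X S]
  by (auto simp: hom_induced_hom hom_boundary_hom)

text \<open>\<open>k p\<close> is the rank of the image of the boundary map that leaves relative
  degree \<open>p\<close>. Splitting every group of the sequence into kernel and image yields the
  terms \<open>k p + k (p + 1)\<close>, which telescope in an alternating sum.\<close>

lemma les_betti_space:
  assumes a: "\<And>p. full_rank (homology_group p (subtopology X S)) (a p)"
    and r: "\<And>p. full_rank (relative_homology_group p X S) (r p)"
  obtains b k where "\<And>p. full_rank (homology_group p X) (b p)"
    "\<And>p. a p + r p = b p + k p + k (p+1)" "\<And>p. k p \<le> r p" "\<And>p. k (p + 1) \<le> a p"
proof -
  note les = les_ranks[where X=X and S=S]
  let ?HS = "\<lambda>p. homology_group p (subtopology X S)" and ?HR = "\<lambda>p. relative_homology_group p X S"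
  let ?I = "\<lambda>p. kernel (homology_group p X) (?HR p) (hom_induced p X {} X S id)"
    and ?J = "\<lambda>p. hom_induced p X {} X S id ` carrier (homology_group p X)"
    and ?K = "\<lambda>p. hom_boundary p X S ` carrier (?HR p)"
  have "\<exists>k i. has_rank (?HS (p-1)) (?K p) k \<and> has_rank (homology_group (p-1) X) (?I (p-1)) i \<and> a (p-1) = k + i" for p
    using rank_nullity[OF _ _ les(4)[of "p-1"] a[of "p-1"]] les(1)[of "p-1"] les(3)[of p]
    by (metis abelian_homology_group abelian_relative_homology_group)
  then obtain k i0 where ki: "\<And>p. has_rank (?HS (p-1)) (?K p) (k p)"
     "\<And>p. has_rank (homology_group (p-1) X) (?I (p-1)) (i0 p)" "\<And>p. a (p-1) = k p + i0 p"
    by metis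
  define i where "i p = i0 (p + 1)" for p
  have i: "has_rank (homology_group p X) (?I p) (i p)" "a p = k (p + 1) + i p" for p
    using ki(2,3)[of "p+1"] by (simp_all add: i_def)
  have "\<exists>j. has_rank (?HR p) (?J p) j \<and> r p = j + k p" for p
  proof -
    obtain j k' where jk: "has_rank (?HR p) (kernel (?HR p) (?HS (p-1)) (hom_boundary p X S)) j"
      "has_rank (?HS (p-1)) (?K p) k'" "r p = j + k'"
      using rank_nullity[OF _ _ les(6)[of p] r[of p]] by (metis abelian_homology_group abelian_relative_homology_group)
    have "k' = k p"
      using comm_group.has_rank_unique[OF abelian_homology_group jk(2) ki(1)] .
    then show ?thesis using jk les(2)[of p] by auto
  qed
  then obtain j where j: "\<And>p. has_rank (?HR p) (?J p) (j p)" "\<And>p. r p = j p + k p"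
    by metis
  have "full_rank (homology_group p X) (i p + j p)" for p
    by (rule has_rank_kernel_image[OF _ _ les(5)[of p] i(1) j(1)]) simp_all
  moreover have "a p + r p = i p + j p + k p + k (p+1)" "k p \<le> r p" "k (p + 1) \<le> a p" for p
    using i(2)[of p] j(2)[of p] by simp_all
  ultimately show ?thesis using that[of "\<lambda>p. i p + j p" k] by blast
qed

text \<open>Here the relative ranks are merely shown to exist and to vanish where their neighbours
  do. Their alternating sum is found later by applying \<open>has_euler_char_pair\<close> to the
  same pair.\<close>

lemma les_betti_relative:
  assumes a: "\<And>p. full_rank (homology_group p (subtopology X S)) (a p)"
    and b: "\<And>p. full_rank (homology_group p X) (b p)"
  obtains r where "\<And>p. full_rank (relative_homology_group p X S) (r p)"
    "\<And>p. r p \<le> b p + a (p - 1)"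
proof -
  note les = les_ranks[where X=X and S=S]
  have "\<exists>r. full_rank (relative_homology_group p X S) r \<and>
    r \<le> b p + a (p - 1)" for p
  proof -
    obtain j i where j: "has_rank (relative_homology_group p X S) (hom_induced p X {} X S id ` carrier (homology_group p X)) j" "b p = i + j"
      using rank_nullity[OF _ _ les(5)[of p] b[of p]] by (metis abelian_homology_group abelian_relative_homology_group)
    obtain k i' where k: "has_rank (homology_group (p-1) (subtopology X S)) (kernel (homology_group (p-1) (subtopology X S)) (homology_group (p-1) X) (hom_induced (p-1) (subtopology X S) {} X {} id)) k" "a (p-1) = k + i'"
      using rank_nullity[OF _ _ les(4)[of "p-1"] a[of "p-1"]] by (metis abelian_homology_group)
    have "full_rank (relative_homology_group p X S) (j + k)"
      by (rule has_rank_kernel_image[OF _ _ les(6)[of p]])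
         (use j k les(2)[of p] les(3)[of p] in simp_all)
    then show ?thesis using j k by (intro exI[of _ "j + k"]) auto
  qed
  then show ?thesis using that by metis
qed

lemma alternating_sum_telescope:
  fixes k :: "int \<Rightarrow> nat"
  shows "(\<Sum>p\<le>m. (-1) ^ p * (int (k (int p)) + int (k (int p + 1)))) = int (k 0) + (-1) ^ m * int (k (int m + 1))"
  by (induction m) (auto simp: algebra_simps)

lemma has_euler_char_pair:
  assumes a: "\<And>p. full_rank (homology_group p (subtopology X S)) (a p)"
    and r: "\<And>p. full_rank (relative_homology_group p X S) (r p)"
    and a0: "\<And>p. p < 0 \<or> d < p \<Longrightarrow> a p = 0" and r0: "\<And>p. p < 0 \<or> d < p \<Longrightarrow> r p = 0"
  shows "has_euler_char d X ((\<Sum>p\<le>nat d. (-1) ^ p * int (a (int p))) + (\<Sum>p\<le>nat d. (-1) ^ p * int (r (int p))))"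
proof -
  obtain b k where b: "\<And>p. full_rank (homology_group p X) (b p)"
    and k: "\<And>p. a p + r p = b p + k p + k (p+1)" "\<And>p. k p \<le> r p" "\<And>p. k (p + 1) \<le> a p"
    using les_betti_space[OF a r] by metis
  have k0: "k 0 = 0" using k(3)[of "-1"] a0[of "-1"] by simp
  have "r (int (nat d) + 1) = 0" by (rule r0) linarith
  then have km: "k (int (nat d) + 1) = 0" by (metis k(2) le_zero_eq)
  have kk: "int (a p) + int (r p) = int (b p) + (int (k p) + int (k (p+1)))" for p
    using k(1)[of p] by linarith
  have "(\<Sum>p\<le>nat d. (-1) ^ p * int (a (int p))) + (\<Sum>p\<le>nat d. (-1) ^ p * int (r (int p)))
      = (\<Sum>p\<le>nat d. (-1) ^ p * (int (a (int p)) + int (r (int p))))"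
    by (simp add: sum.distrib distrib_left)
  also have "\<dots> = (\<Sum>p\<le>nat d. (-1) ^ p * int (b (int p))) +
      (\<Sum>p\<le>nat d. (-1) ^ p * (int (k (int p)) + int (k (int p + 1))))"
    unfolding kk by (simp add: sum.distrib distrib_left)
  also have "\<dots> = (\<Sum>p\<le>nat d. (-1) ^ p * int (b (int p)))"
    unfolding alternating_sum_telescope by (simp only: k0 km)
  finally have "(\<Sum>p\<le>nat d. (-1) ^ p * int (a (int p))) + (\<Sum>p\<le>nat d. (-1) ^ p * int (r (int p))) = \<dots>" .
  moreover have "b p = 0" if "p < 0 \<or> d < p" for p
    using k(1)[of p] a0[OF that] r0[OF that] by simp
  ultimately show ?thesis
    unfolding has_euler_char_def by (intro exI[of _ b] conjI allI impI b) auto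
qed

text \<open>Excising the complement of \<open>N\<close> replaces the pair of \<open>X\<close> and
  \<open>X - C\<close> by that of \<open>N\<close> and \<open>N - C\<close>, whose relative ranks
  have alternating sum \<open>c2 - c3\<close>. The degree bound for \<open>N - C\<close> is one
  lower because its degree \<open>p\<close> contributes to relative degree
  \<open>p + 1\<close>.\<close>

lemma has_euler_char_step:
  assumes C: "closedin X C" and N: "openin X N" and CN: "C \<subseteq> N"
    and X': "has_euler_char (d + 1) (subtopology X (topspace X - C)) c1"
    and N1: "has_euler_char (d + 1) (subtopology X N) c2"
    and N2: "has_euler_char d (subtopology X (N - C)) c3"
  shows "has_euler_char (d + 1) X (c1 + c2 - c3)"
proof -
  define Y where "Y = subtopology X N"
  have Nt: "N \<subseteq> topspace X" using N openin_subset by blast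
  have YN: "subtopology Y (N - C) = subtopology X (N - C)"
    unfolding Y_def by (simp add: subtopology_subtopology Int_absorb1)
  obtain a where a: "\<And>p. full_rank (homology_group p (subtopology X (topspace X - C))) (a p)"
    "\<And>p. p < 0 \<or> d + 1 < p \<Longrightarrow> a p = 0" "c1 = (\<Sum>p\<le>nat (d + 1). (-1) ^ p * int (a (int p)))"
    using X' by (auto simp: has_euler_char_def)
  obtain b where b: "\<And>p. full_rank (homology_group p Y) (b p)"
    "\<And>p. p < 0 \<or> d + 1 < p \<Longrightarrow> b p = 0" "c2 = (\<Sum>p\<le>nat (d + 1). (-1) ^ p * int (b (int p)))"
    using N1 unfolding Y_def by (auto simp: has_euler_char_def)
  obtain e where e: "\<And>p. full_rank (homology_group p (subtopology Y (N - C))) (e p)"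
    "\<And>p. p < 0 \<or> d < p \<Longrightarrow> e p = 0" "c3 = (\<Sum>p\<le>nat d. (-1) ^ p * int (e (int p)))"
    using N2 unfolding YN[symmetric] by (auto simp: has_euler_char_def)
  have e': "c3 = (\<Sum>p\<le>nat (d + 1). (-1) ^ p * int (e (int p)))" "\<And>p. p < 0 \<or> d + 1 < p \<Longrightarrow> e p = 0"
    unfolding e(3) by (rule alternating_sum_extend; use e(2) in auto) (use e(2) in auto)
  obtain r where r: "\<And>p. full_rank (relative_homology_group p Y (N - C)) (r p)"
    "\<And>p. r p \<le> b p + e (p - 1)"
    using les_betti_relative[OF e(1) b(1)] by metis
  have r0: "r p = 0" if "p < 0 \<or> d + 1 < p" for p
  proof -
    have "b p = 0" "e (p - 1) = 0" using that b(2)[of p] e(2)[of "p - 1"] by auto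
    then show ?thesis using r(2)[of p] by simp
  qed
  \<comment> \<open>A second computation of the ranks of \<open>Y\<close>, now through the pair.
    Uniqueness of ranks equates it with \<open>b\<close> and thereby determines the alternating sum
    of \<open>r\<close>.\<close>
  have "has_euler_char (d + 1) Y (c3 + (\<Sum>p\<le>nat (d + 1). (-1) ^ p * int (r (int p))))"
    unfolding e'(1) by (rule has_euler_char_pair[OF e(1) r(1) e'(2) r0])
  then obtain b' where b': "\<And>p. full_rank (homology_group p Y) (b' p)"
    "c3 + (\<Sum>p\<le>nat (d + 1). (-1) ^ p * int (r (int p))) = (\<Sum>p\<le>nat (d + 1). (-1) ^ p * int (b' (int p)))"
    by (auto simp: has_euler_char_def)
  have "b' p = b p" for p
    by (rule comm_group.has_rank_unique[OF abelian_homology_group b'(1) b(1)])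
  then have sum_r: "(\<Sum>p\<le>nat (d + 1). (-1) ^ p * int (r (int p))) = c2 - c3"
    using b'(2) b(3) by simp
  have excise: "full_rank (relative_homology_group p X (topspace X - C)) (r p)" for p
  proof -
    have cl: "X closure_of (topspace X - N) \<subseteq> X interior_of (topspace X - C)"
    proof -
      have "closedin X (topspace X - N)" "openin X (topspace X - C)" using C N by auto
      then show ?thesis using CN by (auto simp: closure_of_closedin interior_of_openin)
    qed
    have eqs: "topspace X - (topspace X - N) = N" "topspace X - C - (topspace X - N) = N - C"
      using Nt by auto
    have "hom_induced p Y (N - C) X (topspace X - C) id
       \<in> iso (relative_homology_group p Y (N - C)) (relative_homology_group p X (topspace X - C))"
      using homology_excision_axiom[OF cl, of "topspace X" p] unfolding eqs Y_def by simp
    then show ?thesis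
      using has_rank_iso[OF abelian_relative_homology_group abelian_relative_homology_group _ r(1)] by blast
  qed
  have "has_euler_char (d + 1) X (c1 + (\<Sum>p\<le>nat (d + 1). (-1) ^ p * int (r (int p))))"
    unfolding a(3) by (rule has_euler_char_pair[OF a(1) excise a(2) r0])
  then show ?thesis unfolding sum_r by (simp add: algebra_simps)
qed

text \<open>The open set \<open>B\<close> is added with itself as neighbourhood, so the overlap is
  empty. For \<open>d = 0\<close> this needs the degree bound -1.\<close>

lemma has_euler_char_disjoint_Un:
  assumes "openin X A" "openin X B" "A \<inter> B = {}" "A \<union> B = topspace X" "d \<ge> 0"
    and "has_euler_char d (subtopology X A) a" "has_euler_char d (subtopology X B) b"
  shows "has_euler_char d X (a + b)"
proof -
  have A: "topspace X - B = A" and B: "topspace X - A = B" using assms by auto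
  have "closedin X B" using assms(1) B by (metis closedin_diff closedin_topspace openin_closedin_eq openin_diff openin_topspace)
  moreover have "has_euler_char (d - 1) (subtopology X (B - B)) 0"
    by (intro has_euler_char_mono[OF has_euler_char_empty]) (use assms(5) in auto)
  ultimately show ?thesis
    using has_euler_char_step[of X B B "d - 1" a b 0] assms A by simp
qed


section \<open>Invariance of domain on a surface\<close>

text \<open>A chart at \<open>f x\<close> turns the claim near \<open>x\<close> into invariance of
  domain in the plane.\<close>

lemma surface_invariance_of_domain:
  fixes f :: "complex \<Rightarrow> 'a"
  assumes M: "closed_surface M" and S: "open S"
    and f: "continuous_map (top_of_set S) M f" and inj: "inj_on f S"
  shows "openin M (f ` S)"
proof (subst openin_subopen, intro ballI)
  fix y assume "y \<in> f ` S"
  then obtain x where x: "x \<in> S" "y = f x" by blast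
  have "y \<in> topspace M" using x continuous_map_image_subset_topspace[OF f] by auto
  then obtain U where U: "openin M U" "y \<in> U" "subtopology M U homeomorphic_space open_disc"
    using M by (auto simp: closed_surface_def)
  have Ut: "topspace (subtopology M U) = U" using openin_subset[OF U(1)] by auto
  obtain h where h: "homeomorphic_map (subtopology M U) open_disc h"
    using U(3) unfolding homeomorphic_space by blast
  have hc: "continuous_map (subtopology M U) open_disc h" using h homeomorphic_imp_continuous_map by blast
  have hinj: "inj_on h U" using homeomorphic_imp_injective_map[OF h] Ut by simp
  define S' where "S' = {z \<in> S. f z \<in> U}"
  have "openin (top_of_set S) S'"
    using openin_continuous_map_preimage[OF f U(1)] by (simp add: S'_def)
  then have S': "open S'" "S' \<subseteq> S" using S openin_open_eq by (auto simp: S'_def)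
  have "continuous_map (top_of_set S') (subtopology M U) f"
    using continuous_map_from_subtopology_mono[OF f S'(2)]
    by (auto simp: continuous_map_in_subtopology S'_def)
  then have "continuous_map (top_of_set S') open_disc (h \<circ> f)" using hc continuous_map_compose by blast
  then have "continuous_on S' (h \<circ> f)"
    unfolding open_disc_def by (simp add: continuous_map_in_subtopology)
  moreover have "inj_on (h \<circ> f) S'"
    using hinj inj by (auto simp: S'_def inj_on_def)
  ultimately have op: "open ((h \<circ> f) ` S')" using invariance_of_domain S'(1) by blast
  have "openin (subtopology M U) {p \<in> U. h p \<in> (h \<circ> f) ` S'}"
  proof -
    have "openin open_disc (ball 0 1 \<inter> (h \<circ> f) ` S')"
      unfolding open_disc_def using op by (simp add: openin_open_Int)
    then have "openin (subtopology M U) {p \<in> U. h p \<in> ball 0 1 \<inter> (h \<circ> f) ` S'}"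
      using openin_continuous_map_preimage[OF hc] unfolding Ut by blast
    moreover have "h p \<in> ball 0 1" if "p \<in> U" for p
      using continuous_map_image_subset_topspace[OF hc] that Ut by (auto simp: open_disc_def)
    then have "{p \<in> U. h p \<in> ball 0 1 \<inter> (h \<circ> f) ` S'} = {p \<in> U. h p \<in> (h \<circ> f) ` S'}" by blast
    ultimately show ?thesis by simp
  qed
  then have T: "openin M {p \<in> U. h p \<in> (h \<circ> f) ` S'}" using U(1) openin_open_subtopology by blast
  moreover have "y \<in> {p \<in> U. h p \<in> (h \<circ> f) ` S'}" using x U(2) by (auto simp: S'_def)
  moreover have "{p \<in> U. h p \<in> (h \<circ> f) ` S'} \<subseteq> f ` S"
  proof
    fix p assume "p \<in> {p \<in> U. h p \<in> (h \<circ> f) ` S'}"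
    then obtain z where z: "p \<in> U" "z \<in> S'" "h p = h (f z)" by auto
    then have "p = f z" using hinj by (auto simp: S'_def inj_on_def)
    then show "p \<in> f ` S" using z(2) S'(2) by blast
  qed
  ultimately show "\<exists>T. openin M T \<and> y \<in> T \<and> T \<subseteq> f ` S" by blast
qed

text \<open>\<open>T\<close> may be a proper subset so that slit strips and punctured discs inherit
  their Euler characteristics from the plane.\<close>

lemma surface_open_embedding:
  fixes f :: "complex \<Rightarrow> 'a"
  assumes M: "closed_surface M" and S: "open S"
    and f: "continuous_map (top_of_set S) M f" and inj: "inj_on f S" and T: "T \<subseteq> S"
  shows "subtopology M (f ` T) homeomorphic_space top_of_set T"
proof -
  have "open_map (top_of_set S) M f"
    unfolding open_map_def
  proof (intro allI impI)
    fix U assume "openin (top_of_set S) U"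
    then have U: "open U" "U \<subseteq> S" using S by (auto simp: openin_open_eq)
    show "openin M (f ` U)"
      by (rule surface_invariance_of_domain[OF M U(1)])
         (use continuous_map_from_subtopology_mono[OF f U(2)] inj U(2) inj_on_subset in blast)+
  qed
  then have "embedding_map (top_of_set S) M f"
    using f inj by (intro injective_open_imp_embedding_map) auto
  then have h: "homeomorphic_map (top_of_set S) (subtopology M (f ` S)) f"
    by (simp add: embedding_map_def)
  have fS: "f ` S \<subseteq> topspace M" using continuous_map_image_subset_topspace[OF f] by simp
  have "homeomorphic_map (subtopology (top_of_set S) T) (subtopology (subtopology M (f ` S)) (f ` T)) f"
    by (rule homeomorphic_map_subtopologies[OF h]) (use T fS in auto)
  then have "homeomorphic_map (top_of_set T) (subtopology M (f ` T)) f"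
    using T by (simp add: subtopology_subtopology Int_absorb1 image_mono)
  then show ?thesis using homeomorphic_map_imp_homeomorphic_space homeomorphic_space_sym by blast
qed

lemma surface_disc_chart:
  assumes M: "closed_surface M" and W: "openin M W" "x \<in> W"
  obtains \<psi> :: "complex \<Rightarrow> 'a" where "continuous_map (top_of_set (ball 0 1)) M \<psi>" "inj_on \<psi> (ball 0 1)"
    "\<psi> 0 = x" "\<psi> ` ball 0 1 \<subseteq> W"
proof -
  have "x \<in> topspace M" using W openin_subset by blast
  then obtain U where U: "openin M U" "x \<in> U" "subtopology M U homeomorphic_space open_disc"
    using M by (auto simp: closed_surface_def)
  then obtain k where k: "homeomorphic_map open_disc (subtopology M U) k"
    unfolding homeomorphic_space by (metis homeomorphic_space homeomorphic_space_sym)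
  have Ut: "topspace (subtopology M U) = U" using openin_subset[OF U(1)] by auto
  have kim: "k ` ball 0 1 = U"
    using homeomorphic_imp_surjective_map[OF k] Ut by (simp add: open_disc_def)
  have kinj: "inj_on k (ball 0 1)" using homeomorphic_imp_injective_map[OF k] by (simp add: open_disc_def)
  have kc: "continuous_map (top_of_set (ball 0 1)) M k"
    using homeomorphic_imp_continuous_map[OF k] continuous_map_in_subtopology
    by (auto simp: open_disc_def)
  obtain a where a: "a \<in> ball 0 1" "k a = x" using kim U(2) by blast
  define B where "B = {z \<in> ball 0 1. k z \<in> W}"
  have "openin (top_of_set (ball 0 1)) B"
    using openin_continuous_map_preimage[OF kc W(1)] by (simp add: B_def)
  then have "open B" using openin_open_eq open_ball by blast
  moreover have "a \<in> B" using a W(2) by (simp add: B_def)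
  ultimately obtain r where r: "r > 0" "ball a r \<subseteq> B" using open_contains_ball_eq by metis
  define \<psi> where "\<psi> = k \<circ> (\<lambda>z. a + of_real r * z)"
  have sub: "a + of_real r * z \<in> ball a r" if "z \<in> ball 0 1" for z
    using that r(1) by (simp add: dist_norm norm_mult)
  then have sub': "a + of_real r * z \<in> ball 0 1" "k (a + of_real r * z) \<in> W" if "z \<in> ball 0 1" for z
    using sub[OF that] subsetD[OF r(2)] by (auto simp: B_def)
  show ?thesis
  proof
    show "continuous_map (top_of_set (ball 0 1)) M \<psi>"
      unfolding \<psi>_def
    proof (rule continuous_map_compose[OF _ kc])
      show "continuous_map (top_of_set (ball 0 1)) (top_of_set (ball 0 1)) (\<lambda>z. a + of_real r * z)"
        using sub' by (auto simp: continuous_map_in_subtopology intro!: continuous_intros)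
    qed
    show "inj_on \<psi> (ball 0 1)"
    proof (rule inj_onI)
      fix z w assume zw: "z \<in> ball 0 1" "w \<in> ball 0 1" "\<psi> z = \<psi> w"
      then have "a + of_real r * z = a + of_real r * w"
        using kinj sub' unfolding \<psi>_def inj_on_def by (metis comp_apply)
      then show "z = w" using r(1) by simp
    qed
    show "\<psi> 0 = x" by (simp add: \<psi>_def a)
    show "\<psi> ` ball 0 1 \<subseteq> W" using sub' by (auto simp: \<psi>_def)
  qed
qed

text \<open>Compactness makes \<open>Q\<close> an embedding, so a disc chart inside \<open>D\<close>
  followed by the inverse of \<open>Q\<close> is a planar injection, whose image is open. This rules
  out an open set of the surface that is covered by a half-plane region and contains the image of a
  point of the boundary line.\<close>

lemma surface_compact_preimage_open:
  fixes Q :: "complex \<Rightarrow> 'a"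
  assumes M: "closed_surface M" and K: "compact K" and Q: "continuous_map (top_of_set K) M Q"
    and inj: "inj_on Q K" and D: "openin M D" "D \<subseteq> Q ` K"
  shows "open {z \<in> K. Q z \<in> D}"
proof (subst open_subopen, intro ballI)
  fix z assume "z \<in> {z \<in> K. Q z \<in> D}"
  then have z: "z \<in> K" "Q z \<in> D" by auto
  have haus: "Hausdorff_space M" using M by (simp add: closed_surface_def)
  have "embedding_map (top_of_set K) M Q"
    by (rule continuous_imp_embedding_map[OF Q]) (use K haus inj in \<open>auto simp: compact_space_subtopology\<close>)
  then have "homeomorphic_map (top_of_set K) (subtopology M (Q ` K)) Q"
    by (simp add: embedding_map_def)
  then obtain g where g: "homeomorphic_maps (top_of_set K) (subtopology M (Q ` K)) Q g"
    using homeomorphic_map_maps by blast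
  have gc: "continuous_map (subtopology M (Q ` K)) (top_of_set K) g"
    and gQ: "\<And>w. w \<in> K \<Longrightarrow> g (Q w) = w"
    using g by (auto simp: homeomorphic_maps_def)
  obtain \<psi> :: "complex \<Rightarrow> 'a" where \<psi>: "continuous_map (top_of_set (ball 0 1)) M \<psi>" "inj_on \<psi> (ball 0 1)"
    "\<psi> 0 = Q z" "\<psi> ` ball 0 1 \<subseteq> D"
    using surface_disc_chart[OF M D(1) z(2)] by blast
  have "continuous_map (top_of_set (ball 0 1)) (subtopology M (Q ` K)) \<psi>"
    using \<psi> D(2) by (auto simp: continuous_map_in_subtopology)
  then have "continuous_map (top_of_set (ball 0 1)) (top_of_set K) (g \<circ> \<psi>)"
    using gc continuous_map_compose by blast
  then have c: "continuous_on (ball 0 1) (g \<circ> \<psi>)" by (simp add: continuous_map_in_subtopology)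
  have sub: "g (\<psi> w) \<in> K \<and> Q (g (\<psi> w)) = \<psi> w" if "w \<in> ball 0 1" for w
  proof -
    have "\<psi> w \<in> Q ` K" using \<psi>(4) D(2) that by (meson image_subset_iff subsetD)
    then obtain y where "y \<in> K" "\<psi> w = Q y" by (rule imageE) 
    then show ?thesis using gQ by simp
  qed
  have "inj_on (g \<circ> \<psi>) (ball 0 1)"
    using sub \<psi>(2) unfolding inj_on_def by (metis comp_apply)
  then have "open ((g \<circ> \<psi>) ` ball 0 1)" using invariance_of_domain[OF c] by blast
  moreover have "z \<in> (g \<circ> \<psi>) ` ball 0 1"
  proof
    show "z = (g \<circ> \<psi>) 0" using \<psi>(3) gQ z(1) by simp
  qed simp
  moreover have "(g \<circ> \<psi>) ` ball 0 1 \<subseteq> {z \<in> K. Q z \<in> D}"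
    using sub \<psi>(4) by auto
  ultimately show "\<exists>T. open T \<and> z \<in> T \<and> T \<subseteq> {z \<in> K. Q z \<in> D}" by blast
qed

section \<open>Euler characteristics of plane regions\<close>

lemma has_euler_char_convex:
  fixes S :: "complex set"
  assumes "convex S" "S \<noteq> {}" shows "has_euler_char 0 (top_of_set S) 1"
  using has_euler_char_contractible[of "top_of_set S"] convex_imp_contractible[OF assms(1)] assms(2) by simp

lemma has_euler_char_two_convex:
  fixes A B :: "complex set"
  assumes "open A" "open B" "convex A" "convex B" "A \<noteq> {}" "B \<noteq> {}" "A \<inter> B = {}"
  shows "has_euler_char 0 (top_of_set (A \<union> B)) 2"
proof -
  have "has_euler_char 0 (top_of_set (A \<union> B)) (1 + 1)"
  proof (rule has_euler_char_disjoint_Un)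
    show "openin (top_of_set (A \<union> B)) A" "openin (top_of_set (A \<union> B)) B"
      using assms by (auto simp: openin_open_eq open_Un)
    show "has_euler_char 0 (subtopology (top_of_set (A \<union> B)) A) 1"
      "has_euler_char 0 (subtopology (top_of_set (A \<union> B)) B) 1"
      using has_euler_char_convex assms by (auto simp: subtopology_subtopology Int_absorb1 Int_absorb2)
  qed (use assms in auto)
  then show ?thesis by simp
qed

text \<open>Cutting along the positive real axis leaves a starlike set. In the right half-disc the
  cut separates two convex pieces, so the count is 1 + 1 - 2.\<close>

lemma has_euler_char_punctured_disc: "has_euler_char 1 (top_of_set (ball (0::complex) 1 - {0})) 0"
proof -
  let ?X = "top_of_set (ball (0::complex) 1 - {0})"
  define C where "C = {z \<in> ball (0::complex) 1 - {0}. Im z = 0 \<and> Re z \<ge> 0}"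
  define N where "N = ball (0::complex) 1 \<inter> {z. Re z > 0}"
  have "has_euler_char (0 + 1) ?X (1 + 1 - 2)"
  proof (rule has_euler_char_step)
    have "closed ({z. Im z = 0} \<inter> {z. Re z \<ge> 0})"
      by (intro closed_Int closed_Collect_eq closed_Collect_le continuous_intros)
    moreover have "C = (ball (0::complex) 1 - {0}) \<inter> ({z. Im z = 0} \<inter> {z. Re z \<ge> 0})"
      by (auto simp: C_def)
    ultimately show "closedin ?X C" by (simp add: closedin_closed_Int)
    have opN: "open N" unfolding N_def by (intro open_Int open_ball open_Collect_less continuous_intros)
    have NX: "N \<subseteq> ball 0 1 - {0}" by (auto simp: N_def)
    show "openin ?X N" by (rule open_subset[OF NX opN])
    show "C \<subseteq> N" by (auto simp: C_def N_def complex_eq_iff less_le)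
    have "starlike (ball 0 1 - {0} - C)"
      unfolding starlike_def
    proof (intro bexI ballI)
      show a: "- 1/2 \<in> ball 0 1 - {0} - C" by (simp add: C_def)
      fix z assume z: "z \<in> ball 0 1 - {0} - C"
      show "closed_segment (- 1/2) z \<subseteq> ball 0 1 - {0} - C"
      proof
        fix w assume w: "w \<in> closed_segment (- 1/2) z"
        have "w \<in> ball 0 1"
          using w a z closed_segment_subset[of "-1/2" "ball 0 1" z] by (auto simp del: mem_ball)
        moreover obtain u where u: "0 \<le> u" "u \<le> 1" "w = (1 - u) *\<^sub>R (- 1/2) + u *\<^sub>R z"
          using w by (auto simp: closed_segment_def)
        have "Re w < 0" if "Im w = 0"
        proof (cases "u = 0")
          case True then show ?thesis using u by simp
        next
          case False
          then have "Im z = 0" using u that by simp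
          then have "Re z < 0" using z by (auto simp: C_def complex_eq_iff)
          then have "u * Re z < 0" using False u(1) by (simp add: mult_pos_neg)
          then show ?thesis using u by simp
        qed
        ultimately show "w \<in> ball 0 1 - {0} - C" by (auto simp: C_def)
      qed
    qed
    then have "has_euler_char 0 (top_of_set (ball 0 1 - {0} - C)) 1"
      by (intro has_euler_char_contractible)
         (auto simp: starlike_imp_contractible starlike_def)
    then show "has_euler_char (0 + 1) (subtopology ?X (topspace ?X - C)) 1"
      using has_euler_char_mono by (force simp: subtopology_subtopology Int_absorb1)
    have "convex N" unfolding N_def by (intro convex_Int convex_ball convex_halfspace_Re_gt)
    moreover have "1/2 \<in> N" by (simp add: N_def)
    ultimately have "has_euler_char 0 (top_of_set N) 1" using has_euler_char_convex by blast
    then show "has_euler_char (0 + 1) (subtopology ?X N) 1"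
      using has_euler_char_mono NX by (force simp: subtopology_subtopology Int_absorb1)
    have NC: "N - C = (N \<inter> {z. Im z > 0}) \<union> (N \<inter> {z. Im z < 0})"
      by (auto simp: N_def C_def)
    have "has_euler_char 0 (top_of_set (N - C)) 2"
      unfolding NC
    proof (rule has_euler_char_two_convex)
      have "Complex (1/2) (1/2) \<in> N \<inter> {z. Im z > 0}" "Complex (1/2) (-1/2) \<in> N \<inter> {z. Im z < 0}"
        by (auto simp: N_def cmod_def power2_eq_square real_sqrt_lt_1_iff)
      then show "N \<inter> {z. Im z > 0} \<noteq> {}" "N \<inter> {z. Im z < 0} \<noteq> {}" by blast+
    qed (use opN \<open>convex N\<close> in \<open>auto intro!: open_Int convex_Int open_Collect_less continuous_intros open_Collect_less continuous_intros
          convex_halfspace_Im_gt convex_halfspace_Im_lt\<close>)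
    moreover have "N - C \<subseteq> ball 0 1 - {0}" using NX by blast
    ultimately show "has_euler_char 0 (subtopology ?X (N - C)) 2"
      by (simp add: subtopology_subtopology Int_absorb1)
  qed
  then show ?thesis by simp
qed

text \<open>The model of a neighbourhood of an open edge: the real segment stands for the edge, the
  two halves for its sides.\<close>

definition strip :: "complex set" where
  "strip = {z. 0 < Re z \<and> Re z < 1 \<and> - 1 < Im z \<and> Im z < 1}"

lemma strip_eq: "strip = {z. Re z > 0} \<inter> {z. Re z < 1} \<inter> {z. Im z > -1} \<inter> {z. Im z < 1}"
  by (auto simp: strip_def)

lemma open_strip: "open strip"
  unfolding strip_eq by (intro open_Int open_Collect_less continuous_intros open_Collect_less continuous_intros open_Collect_less continuous_intros open_Collect_less continuous_intros)

lemma convex_strip: "convex strip"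
  unfolding strip_eq by (intro convex_Int convex_halfspace_Re_gt convex_halfspace_Re_lt convex_halfspace_Im_gt convex_halfspace_Im_lt)

lemma has_euler_char_strip: "has_euler_char 0 (top_of_set strip) 1"
proof (rule has_euler_char_convex[OF convex_strip])
  have "Complex (1/2) 0 \<in> strip" by (simp add: strip_def)
  then show "strip \<noteq> {}" by blast
qed

lemma has_euler_char_slit_strip: "has_euler_char 0 (top_of_set (strip - {z. Im z = 0})) 2"
proof -
  have eq: "strip - {z. Im z = 0} = (strip \<inter> {z. Im z > 0}) \<union> (strip \<inter> {z. Im z < 0})" by auto
  have "Complex (1/2) (1/2) \<in> strip \<inter> {z. Im z > 0}" "Complex (1/2) (-1/2) \<in> strip \<inter> {z. Im z < 0}"
    by (auto simp: strip_def)
  then show ?thesis unfolding eq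
    by (intro has_euler_char_two_convex open_Int convex_Int open_strip convex_strip
       open_Collect_less continuous_intros open_Collect_less continuous_intros convex_halfspace_Im_gt convex_halfspace_Im_lt) auto
qed

section \<open>Polar coordinates with respect to a subdivided circle\<close>

text \<open>The real part runs along the unit circle, divided into \<open>n\<close> arcs of length 1; the imaginary
  part is the distance from the circle.\<close>

definition polar :: "nat \<Rightarrow> complex \<Rightarrow> complex" where
  "polar n z = of_real (1 - Im z) * cis (2 * pi * Re z / real n)"

lemma continuous_on_polar: "continuous_on S (polar n)"
  unfolding polar_def by (cases "n = 0") (auto intro!: continuous_intros simp: cis_conv_exp)

lemma norm_polar: "norm (polar n z) = \<bar>1 - Im z\<bar>"
  unfolding polar_def norm_mult norm_cis norm_of_real by simp

lemma polar_of_real: "polar n (of_real t) = cis (2 * pi * t / real n)"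
  by (simp add: polar_def)

text \<open>Imaginary parts below 1 keep away from the centre of the disc, where the angle is
  lost.\<close>

lemma polar_eqD:
  assumes "polar n z = polar n w" "n > 0" "Im z < 1" "Im w < 1"
  shows "Im z = Im w" "\<exists>k::int. Re z - Re w = of_int k * real n"
proof -
  have "\<bar>1 - Im z\<bar> = \<bar>1 - Im w\<bar>" using norm_polar assms(1) by metis
  then show im: "Im z = Im w" using assms by linarith
  have "cis (2 * pi * Re z / real n) = cis (2 * pi * Re w / real n)"
    using assms im by (simp add: polar_def)
  then have "cis (2 * pi * Re z / real n - 2 * pi * Re w / real n) = 1"
    by (metis cis_divide cis_neq_zero divide_self)
  then have "cos (2 * pi * Re z / real n - 2 * pi * Re w / real n) = 1"
    by (simp add: complex_eq_iff)
  then obtain k :: int where "2 * pi * Re z / real n - 2 * pi * Re w / real n = of_int k * 2 * pi"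
    using cos_one_2pi_int by blast
  then have "2 * pi * (Re z - Re w) = 2 * pi * (of_int k * real n)"
    using assms(2) by (simp add: field_simps)
  then have "Re z - Re w = of_int k * real n" by simp
  then show "\<exists>k::int. Re z - Re w = of_int k * real n" by blast
qed

lemma polar_periodic:
  assumes "n > 0" "Re z = Re w + of_int k * real n" "Im z = Im w"
  shows "polar n z = polar n w"
proof -
  have "2 * pi * Re z / real n = 2 * pi * Re w / real n + 2 * pi * of_int k"
    using assms by (simp add: field_simps)
  then have "cis (2 * pi * Re z / real n) = cis (2 * pi * Re w / real n)"
    by (simp flip: cis_mult)
  then show ?thesis using assms by (simp add: polar_def)
qed

text \<open>The window of one period may start at any real \<open>a\<close>, so a sector straddling
  the start of the walk needs no special treatment.\<close>

lemma polar_surj: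
  assumes "norm z \<le> 1" "n > 0"
  obtains w where "a \<le> Re w" "Re w < a + real n" "Im w = 1 - norm z" "0 \<le> Im w" "Im w \<le> 1" "polar n w = z"
proof -
  obtain r t where z: "z = rcis r t" "r = norm z" by (metis rcis_cmod_Arg)
  define s where "s = t * real n / (2 * pi)"
  define k where "k = \<lfloor>(s - a) / real n\<rfloor>"
  define w where "w = Complex (s - of_int k * real n) (1 - norm z)"
  have "of_int k \<le> (s - a) / real n" "(s - a) / real n < of_int k + 1"
    unfolding k_def by linarith+
  then have "of_int k * real n \<le> s - a" "s - a < (of_int k + 1) * real n"
    using assms(2) by (simp_all add: field_simps)
  moreover have "polar n w = polar n (Complex s (1 - norm z))"
    by (rule polar_periodic[OF assms(2), of _ _ "-k"]) (simp_all add: w_def)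
  moreover have "polar n (Complex s (1 - norm z)) = z"
    using assms(2) z by (simp add: polar_def s_def rcis_def)
  ultimately show ?thesis
    using assms(1) by (intro that[of w]) (auto simp: w_def algebra_simps)
qed


section \<open>Darts and pages of a map\<close>

locale surface_map =
  fixes M :: "'a topology" and G :: "'a pair_pre_digraph" and \<gamma> :: "'a \<times> 'a \<Rightarrow> 'a set"
  assumes surface: "closed_surface M" and is_map: "is_map M G \<gamma>"
begin

abbreviation FS :: "'a set set" where "FS \<equiv> faces M G \<gamma>"
abbreviation GP :: "'a set" where "GP \<equiv> graph_points G \<gamma>"
abbreviation walk :: "'a set \<Rightarrow> ('a \<times> 'a) list" where "walk \<equiv> facial_walk M G \<gamma>"
abbreviation fdeg :: "'a set \<Rightarrow> nat" where "fdeg \<equiv> face_degree M G \<gamma>"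

definition edges :: "'a set set" where "edges = \<gamma> ` parcs G"

text \<open>\<open>facial_walk\<close> fixes only the walk; a disc map that realises it is chosen
  here once and for all.\<close>

definition face_map :: "'a set \<Rightarrow> complex \<Rightarrow> 'a" where
  "face_map F = (SOME \<phi>. continuous_map (top_of_set (cball (0::complex) 1)) M \<phi> \<and>
          homeomorphic_map open_disc (subtopology M F) \<phi> \<and>
          (\<forall>i<length (walk F).
             let s = (\<lambda>t. \<phi> (cis (2 * pi * (real i + t) / real (length (walk F)))))
             in inj_on s {0..1} \<and> s ` {0..1} = \<gamma> (walk F ! i) \<and>
                s 0 = fst (walk F ! i) \<and> s 1 = snd (walk F ! i)))"

text \<open>A dart is a step of a facial walk, that is, a side of an edge. The page of a dart is the part
  of its face that lies along this side; its point at \<open>t + i r\<close> approaches the edge as \<open>r\<close> tends to 0.\<close>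

definition darts :: "('a set \<times> nat) set" where
  "darts = {(F, i). F \<in> FS \<and> i < fdeg F}"

definition dart_edge :: "'a set \<times> nat \<Rightarrow> 'a set" where
  "dart_edge d = \<gamma> (walk (fst d) ! snd d)"

definition page :: "'a set \<times> nat \<Rightarrow> complex \<Rightarrow> 'a" where
  "page d z = face_map (fst d) (polar (fdeg (fst d)) (of_nat (snd d) + z))"

lemma hausdorff: "Hausdorff_space M"
  using surface by (simp add: closed_surface_def)

lemma pair_graph: "pair_graph G" and embedding: "graph_embedding M G \<gamma>"
  and degree_ge_3: "\<And>v. v \<in> pverts G \<Longrightarrow> vertex_degree G v \<ge> 3"
  and ex_walk: "\<And>F. F \<in> FS \<Longrightarrow> \<exists>p. boundary_walk M G \<gamma> F p"
  using is_map by (auto simp: is_map_def two_cell_embedding_def)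

lemma arcs_wf: "a \<in> parcs G \<Longrightarrow> fst a \<in> pverts G \<and> snd a \<in> pverts G"
  using pair_graph by (cases a) (auto simp: pair_graph_def pair_digraph_def pair_fin_digraph_def pair_wf_digraph_def)

lemma arcs_neq: "a \<in> parcs G \<Longrightarrow> fst a \<noteq> snd a"
  using pair_graph by (simp add: pair_graph_def pair_digraph_def pair_loopfree_digraph_def pair_loopfree_digraph_axioms_def)

lemma arcs_sym: "(u, v) \<in> parcs G \<Longrightarrow> (v, u) \<in> parcs G"
proof -
  have "symmetric (with_proj G)"
    using pair_graph by (simp add: pair_graph_def pair_pseudo_graph_def pair_sym_digraph_def pair_sym_digraph_axioms_def)
  then show "(u, v) \<in> parcs G \<Longrightarrow> (v, u) \<in> parcs G"
    by (auto simp: symmetric_def elim: symE)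
qed

lemma finite_arcs: "finite (parcs G)" and finite_verts: "finite (pverts G)"
  using pair_graph by (auto simp: pair_graph_def pair_digraph_def pair_fin_digraph_def pair_fin_digraph_axioms_def)

lemma finite_edges: "finite edges"
  using finite_arcs by (simp add: edges_def)

lemma verts_sub: "pverts G \<subseteq> topspace M"
  using embedding by (auto simp: graph_embedding_def)

lemma edge_param:
  assumes "a \<in> parcs G"
  obtains g where "embedding_map (top_of_set {0..1::real}) M g" "g 0 = fst a" "g 1 = snd a" "g ` {0..1} = \<gamma> a"
  using embedding assms unfolding graph_embedding_def by (cases a) fastforce

lemma edge_verts: "a \<in> parcs G \<Longrightarrow> \<gamma> a \<inter> pverts G = {fst a, snd a}"
  using embedding unfolding graph_embedding_def by (cases a) fastforce

lemma edge_rev: "(u, v) \<in> parcs G \<Longrightarrow> \<gamma> (v, u) = \<gamma> (u, v)"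
  using embedding unfolding graph_embedding_def by fastforce

lemma edge_eq_iff:
  assumes "a \<in> parcs G" "b \<in> parcs G"
  shows "\<gamma> a = \<gamma> b \<longleftrightarrow> {fst a, snd a} = {fst b, snd b}"
proof
  assume "\<gamma> a = \<gamma> b"
  then show "{fst a, snd a} = {fst b, snd b}" using edge_verts assms by metis
next
  assume eq: "{fst a, snd a} = {fst b, snd b}"
  then have "b = a \<or> b = (snd a, fst a)" by (cases a; cases b) (auto simp: doubleton_eq_iff)
  then show "\<gamma> a = \<gamma> b" using edge_rev[of "fst a" "snd a"] assms(1) by auto
qed

lemma edges_Int:
  assumes "e \<in> edges" "e' \<in> edges" "e \<noteq> e'" shows "e \<inter> e' \<subseteq> pverts G"
proof -
  obtain a b where ab: "a \<in> parcs G" "b \<in> parcs G" "e = \<gamma> a" "e' = \<gamma> b"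
    using assms by (auto simp: edges_def)
  then have "{fst a, snd a} \<noteq> {fst b, snd b}" using edge_eq_iff assms(3) by blast
  moreover have "\<gamma> (u, v) \<inter> \<gamma> (u', v') \<subseteq> pverts G"
    if "(u, v) \<in> parcs G" "(u', v') \<in> parcs G" "{u, v} \<noteq> {u', v'}" for u v u' v'
    using embedding that unfolding graph_embedding_def by blast
  ultimately show ?thesis using ab by (metis prod.collapse)
qed

lemma edge_closed: "e \<in> edges \<Longrightarrow> closedin M e"
proof -
  assume "e \<in> edges"
  then obtain a where a: "a \<in> parcs G" "e = \<gamma> a" by (auto simp: edges_def)
  obtain g where g: "embedding_map (top_of_set {0..1::real}) M g" "g ` {0..1} = \<gamma> a"
    using edge_param[OF a(1)] by metis
  have "continuous_map (top_of_set {0..1::real}) M g"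
    using g(1) homeomorphic_imp_continuous_map continuous_map_into_fulltopology
    unfolding embedding_map_def by blast
  then have "compactin M (g ` {0..1})"
    by (intro image_compactin[of "top_of_set {0..1::real}"]) (auto simp: compactin_subtopology)
  then show "closedin M e" using compactin_imp_closedin[OF hausdorff] g(2) a(2) by simp
qed

lemma edge_interior_nonempty: "e \<in> edges \<Longrightarrow> e - pverts G \<noteq> {}"
proof -
  assume "e \<in> edges"
  then obtain a where a: "a \<in> parcs G" "e = \<gamma> a" by (auto simp: edges_def)
  obtain g where g: "embedding_map (top_of_set {0..1::real}) M g" "g 0 = fst a" "g 1 = snd a" "g ` {0..1} = \<gamma> a"
    using edge_param[OF a(1)] by metis
  have "inj_on g {0..1}"
    using g(1) by (simp add: embedding_map_def homeomorphic_map_def)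
  then have "g (1/2) \<noteq> g 0" "g (1/2) \<noteq> g 1"
    using inj_onD[of g "{0..1}" "1/2" 0] inj_onD[of g "{0..1}" "1/2" 1] by auto
  moreover have "g (1/2) \<in> \<gamma> a" using g(4) by force
  ultimately have "g (1/2) \<in> e - pverts G" using edge_verts[OF a(1)] unfolding a(2) g(2,3) by blast
  then show "e - pverts G \<noteq> {}" by blast
qed

lemma vertex_on_edge:
  assumes "v \<in> pverts G" obtains a where "a \<in> parcs G" "fst a = v"
proof -
  have "out_arcs (with_proj G) v \<noteq> {}"
    using degree_ge_3[OF assms] by (auto simp: out_degree_def)
  then show ?thesis using that by (auto simp: out_arcs_def)
qed

text \<open>There are no isolated vertices, so the edges already cover the vertex set.\<close>

lemma GP_eq: "GP = \<Union>edges"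
proof -
  have "v \<in> \<Union>edges" if "v \<in> pverts G" for v
  proof -
    obtain a where a: "a \<in> parcs G" "fst a = v" by (rule vertex_on_edge[OF \<open>v \<in> pverts G\<close>])
    then have "v \<in> \<gamma> a" using edge_verts[OF a(1)] by auto
    then show ?thesis using a(1) by (auto simp: edges_def)
  qed
  then show ?thesis by (auto simp: graph_points_def edges_def)
qed

lemma verts_GP: "pverts G \<subseteq> GP" by (simp add: graph_points_def)

lemma GP_sub: "GP \<subseteq> topspace M"
  using GP_eq edge_closed closedin_subset by blast

lemma Union_faces: "\<Union>FS = topspace M - GP"
  unfolding faces_def using Union_connected_components_of[of "subtopology M (topspace M - GP)"] by auto

lemma face_sub: "F \<in> FS \<Longrightarrow> F \<subseteq> topspace M" and face_GP: "F \<in> FS \<Longrightarrow> F \<inter> GP = {}"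
  using Union_faces by blast+

lemma faces_disjoint: "F \<in> FS \<Longrightarrow> F' \<in> FS \<Longrightarrow> x \<in> F \<Longrightarrow> x \<in> F' \<Longrightarrow> F = F'"
  using pairwiseD[OF pairwise_disjoint_connected_components_of, of F _ F'] by (auto simp: faces_def disjnt_iff)

lemma face_map:
  assumes "F \<in> FS"
  shows "walk F \<noteq> []" "set (walk F) \<subseteq> parcs G"
    and "continuous_map (top_of_set (cball 0 1)) M (face_map F)"
    and "homeomorphic_map open_disc (subtopology M F) (face_map F)"
    and "\<And>i. i < fdeg F \<Longrightarrow> inj_on (\<lambda>t. page (F, i) (of_real t)) {0..1}"
    and "\<And>i. i < fdeg F \<Longrightarrow> (\<lambda>t. page (F, i) (of_real t)) ` {0..1} = \<gamma> (walk F ! i)"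
    and "\<And>i. i < fdeg F \<Longrightarrow> page (F, i) 0 = fst (walk F ! i)"
    and "\<And>i. i < fdeg F \<Longrightarrow> page (F, i) 1 = snd (walk F ! i)"
proof -
  have bw: "boundary_walk M G \<gamma> F (walk F)"
    unfolding facial_walk_def using ex_walk[OF assms] arg_min_natI[of "boundary_walk M G \<gamma> F"] by blast
  then show "walk F \<noteq> []" by (simp add: boundary_walk_def)
  show "set (walk F) \<subseteq> parcs G"
    using bw by (auto simp: boundary_walk_def pre_digraph.awalk_def)
  let ?P = "\<lambda>\<phi>. continuous_map (top_of_set (cball (0::complex) 1)) M \<phi> \<and>
          homeomorphic_map open_disc (subtopology M F) \<phi> \<and>
          (\<forall>i<length (walk F).
             let s = (\<lambda>t. \<phi> (cis (2 * pi * (real i + t) / real (length (walk F)))))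
             in inj_on s {0..1} \<and> s ` {0..1} = \<gamma> (walk F ! i) \<and>
                s 0 = fst (walk F ! i) \<and> s 1 = snd (walk F ! i))"
  have "\<exists>\<phi>. ?P \<phi>" using bw unfolding boundary_walk_def by blast
  then have P: "?P (face_map F)" unfolding face_map_def by (rule someI_ex)
  have pg: "page (F, i) (of_real t) = face_map F (cis (2 * pi * (real i + t) / real (length (walk F))))" for i t
    using polar_of_real[of "fdeg F" "real i + t"] by (simp add: page_def face_degree_def)
  show "continuous_map (top_of_set (cball 0 1)) M (face_map F)"
    "homeomorphic_map open_disc (subtopology M F) (face_map F)" using P by auto
  have pg01: "page (F, i) 0 = face_map F (cis (2 * pi * (real i + 0) / real (length (walk F))))"
    "page (F, i) 1 = face_map F (cis (2 * pi * (real i + 1) / real (length (walk F))))" for i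
    using pg[of i 0] pg[of i 1] by simp_all
  show "inj_on (\<lambda>t. page (F, i) (of_real t)) {0..1}"
    "(\<lambda>t. page (F, i) (of_real t)) ` {0..1} = \<gamma> (walk F ! i)"
    "page (F, i) 0 = fst (walk F ! i)" "page (F, i) 1 = snd (walk F ! i)" if "i < fdeg F" for i
    unfolding pg pg01 using P that unfolding Let_def face_degree_def by blast+
qed

lemma fdeg_pos: "F \<in> FS \<Longrightarrow> fdeg F > 0"
  using face_map(1) by (simp add: face_degree_def)

lemma dart_arc: "(F, i) \<in> darts \<Longrightarrow> walk F ! i \<in> parcs G"
  using face_map(2)[of F] nth_mem[of i "walk F"] by (auto simp: darts_def face_degree_def)

lemma dart_edge_in: "d \<in> darts \<Longrightarrow> dart_edge d \<in> edges"
  using dart_arc by (cases d) (auto simp: dart_edge_def edges_def)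

lemma page_edge:
  assumes "d \<in> darts"
  shows "inj_on (\<lambda>t. page d (of_real t)) {0..1}" "(\<lambda>t. page d (of_real t)) ` {0..1} = dart_edge d"
    "page d 0 = fst (walk (fst d) ! snd d)" "page d 1 = snd (walk (fst d) ! snd d)"
proof -
  have "fst d \<in> FS" "snd d < fdeg (fst d)" using assms by (auto simp: darts_def)
  from face_map(5-8)[OF this] 
  show "inj_on (\<lambda>t. page d (of_real t)) {0..1}" "(\<lambda>t. page d (of_real t)) ` {0..1} = dart_edge d"
    "page d 0 = fst (walk (fst d) ! snd d)" "page d 1 = snd (walk (fst d) ! snd d)"
    by (simp_all add: dart_edge_def)
qed

lemma page_in_edge: "d \<in> darts \<Longrightarrow> 0 \<le> t \<Longrightarrow> t \<le> 1 \<Longrightarrow> page d (of_real t) \<in> dart_edge d"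
  using page_edge(2) by (metis atLeastAtMost_iff image_eqI)

lemma page_vertex_iff:
  assumes d: "d \<in> darts" and t: "0 \<le> t" "t \<le> 1"
  shows "page d (of_real t) \<in> pverts G \<longleftrightarrow> t = 0 \<or> t = 1"
proof -
  obtain F i where Fi: "d = (F, i)" by (cases d)
  have a: "walk F ! i \<in> parcs G" using d Fi dart_arc by blast
  have "page d (of_real t) \<in> dart_edge d" using page_in_edge[OF d] t by auto
  then have "page d (of_real t) \<in> pverts G \<longleftrightarrow> page d (of_real t) = page d (of_real 0) \<or> page d (of_real t) = page d (of_real 1)"
    using edge_verts[OF a] page_edge(3,4)[OF d] by (auto simp: Fi dart_edge_def)
  also have "\<dots> \<longleftrightarrow> t = 0 \<or> t = 1"
    using inj_on_eq_iff[OF page_edge(1)[OF d], of t 0] inj_on_eq_iff[OF page_edge(1)[OF d], of t 1] t by auto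
  finally show ?thesis .
qed

lemma face_map_ball:
  assumes "F \<in> FS" shows "face_map F ` ball 0 1 = F" "inj_on (face_map F) (ball 0 1)"
  using homeomorphic_imp_surjective_map[OF face_map(4)[OF assms]]
    homeomorphic_imp_injective_map[OF face_map(4)[OF assms]] face_sub[OF assms]
  by (auto simp: open_disc_def)

lemma face_map_sphere:
  assumes F: "F \<in> FS" and w: "norm w = 1"
  obtains i t where "i < fdeg F" "0 \<le> t" "t < 1" "w = polar (fdeg F) (of_nat i + of_real t)"
    "face_map F w = page (F, i) (of_real t)"
proof -
  obtain z where z: "0 \<le> Re z" "Re z < 0 + real (fdeg F)" "Im z = 0" "polar (fdeg F) z = w"
    using polar_surj[of w "fdeg F" 0] fdeg_pos[OF F] w by auto
  define i where "i = nat \<lfloor>Re z\<rfloor>"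
  have "real i = of_int \<lfloor>Re z\<rfloor>" using z(1) by (simp add: i_def)
  then have i: "real i \<le> Re z" "Re z < real i + 1" by linarith+
  have "z = of_nat i + of_real (Re z - real i)" using z(3) by (simp add: complex_eq_iff)
  then show ?thesis
    using that[of i "Re z - real i"] i z by (auto simp: page_def)
qed

text \<open>A point of the graph comes from the circle. Off the vertices it comes from inside an
  arc, and since distinct edges meet only in vertices, this arc runs along \<open>e\<close>.\<close>

lemma face_map_edge_point:
  assumes F: "F \<in> FS" and w: "norm w \<le> 1" and x: "face_map F w = x" "x \<in> e" "x \<notin> pverts G" and e: "e \<in> edges"
  obtains i t where "i < fdeg F" "0 < t" "t < 1" "w = polar (fdeg F) (of_nat i + of_real t)" "dart_edge (F, i) = e"
proof -
  have "x \<notin> F" using face_GP[OF F] x(2) e GP_eq by blast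
  then have "w \<notin> ball 0 1" using face_map_ball(1)[OF F] x(1) by blast
  then have "norm w = 1" using w by simp
  then obtain i t where it: "i < fdeg F" "0 \<le> t" "t < 1" "w = polar (fdeg F) (of_nat i + of_real t)"
    "face_map F w = page (F, i) (of_real t)" using face_map_sphere[OF F] by metis
  have d: "(F, i) \<in> darts" using F it by (simp add: darts_def)
  have "x \<in> dart_edge (F, i)" using page_in_edge[OF d it(2)] it(3,5) x(1) by simp
  then have "dart_edge (F, i) = e" using edges_Int[OF dart_edge_in[OF d] e] x by blast
  moreover have "t \<noteq> 0" using page_vertex_iff[OF d, of t] it x by auto
  ultimately show ?thesis using that it by force
qed

text \<open>On a circle with a single arc the parameters 0 and 1 are the same point, so the edge
  would be a loop.\<close>

lemma fdeg_ge_2: "F \<in> FS \<Longrightarrow> fdeg F \<ge> 2"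
proof (rule ccontr)
  assume F: "F \<in> FS" and "\<not> fdeg F \<ge> 2"
  then have n: "fdeg F = 1" using fdeg_pos[of F] by linarith
  have d: "(F, 0) \<in> darts" using F n by (simp add: darts_def)
  have "polar 1 (0 :: complex) = polar 1 1" by (rule polar_periodic[of _ _ _ "-1"]) simp_all
  then have "page (F, 0) 0 = page (F, 0) 1" by (simp add: page_def n)
  then show False using page_edge(3,4)[OF d] arcs_neq[OF dart_arc[OF d]] by simp
qed

lemma page_continuous:
  assumes "d \<in> darts" shows "continuous_map (top_of_set {z. 0 \<le> Im z \<and> Im z \<le> 1}) M (page d)"
proof -
  have F: "fst d \<in> FS" using assms by (auto simp: darts_def)
  have "continuous_map (top_of_set {z. 0 \<le> Im z \<and> Im z \<le> 1}) (top_of_set (cball 0 1)) (\<lambda>z. polar (fdeg (fst d)) (of_nat (snd d) + z))"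
    unfolding continuous_map_in_subtopology
    by (auto simp: norm_polar intro!: continuous_on_compose2[OF continuous_on_polar[of UNIV]] continuous_intros)
  then have "continuous_map (top_of_set {z. 0 \<le> Im z \<and> Im z \<le> 1}) M (face_map (fst d) \<circ> (\<lambda>z. polar (fdeg (fst d)) (of_nat (snd d) + z)))"
    using continuous_map_compose face_map(3)[OF F] by blast
  moreover have "page d = face_map (fst d) \<circ> (\<lambda>z. polar (fdeg (fst d)) (of_nat (snd d) + z))"
    by (simp add: fun_eq_iff page_def)
  ultimately show ?thesis by metis
qed

lemma page_face:
  assumes "d \<in> darts" "0 < Im z" "Im z \<le> 1" shows "page d z \<in> fst d"
proof -
  have F: "fst d \<in> FS" using assms by (auto simp: darts_def)
  have "polar (fdeg (fst d)) (of_nat (snd d) + z) \<in> ball 0 1" using assms by (simp add: norm_polar)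
  then show ?thesis using face_map_ball(1)[OF F] unfolding page_def by blast
qed

text \<open>Within one face, two positions in open arcs of the walk differ by less than a full
  period, which forces the winding number \<open>k\<close> to be 0.\<close>

lemma page_inj:
  assumes d: "d \<in> darts" "d' \<in> darts" and eq: "page d z = page d' w"
    and z: "0 < Re z" "Re z < 1" "0 < Im z" "Im z < 1" and w: "0 < Re w" "Re w < 1" "0 < Im w" "Im w < 1"
  shows "d = d' \<and> z = w"
proof -
  have F: "fst d \<in> FS" "fst d' \<in> FS" using d by (auto simp: darts_def)
  have same: "fst d' = fst d"
    using faces_disjoint[OF F] page_face[OF d(1), of z] page_face[OF d(2), of w] eq z w by auto
  let ?n = "fdeg (fst d)"
  have "polar ?n (of_nat (snd d) + z) \<in> ball 0 1" "polar ?n (of_nat (snd d') + w) \<in> ball 0 1"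
    using z w by (auto simp: norm_polar)
  then have eq2: "polar ?n (of_nat (snd d) + z) = polar ?n (of_nat (snd d') + w)"
    using face_map_ball(2)[OF F(1)] eq same unfolding page_def inj_on_def by auto
  have im: "Im z = Im w" using polar_eqD(1)[OF eq2] fdeg_pos[OF F(1)] z w by simp
  obtain k :: int where k: "(real (snd d) + Re z) - (real (snd d') + Re w) = of_int k * real ?n"
    using polar_eqD(2)[OF eq2] fdeg_pos[OF F(1)] z w by auto
  have lt: "snd d < ?n" "snd d' < ?n" using d same by (auto simp: darts_def)
  have "\<bar>(real (snd d) + Re z) - (real (snd d') + Re w)\<bar> < real ?n"
    using lt z w by linarith
  then have "\<bar>of_int k * real ?n\<bar> < 1 * real ?n" using k by simp
  then have "k = 0" using fdeg_pos[OF F(1)] by (simp add: abs_mult)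
  then have "real (snd d) + Re z = real (snd d') + Re w" using k by simp
  moreover from this have "snd d = snd d'" using z w by linarith
  ultimately have "snd d = snd d'" "Re z = Re w" by simp_all
  then show ?thesis using same im by (auto simp: prod_eq_iff complex_eq_iff)
qed

text \<open>The ends of the arc may be included because a face has at least two arcs. Height 1/2
  stays clear of the centre, where all angles meet.\<close>

lemma page_inj_half:
  assumes d: "d \<in> darts"
  shows "inj_on (page d) {z. 0 \<le> Re z \<and> Re z \<le> 1 \<and> 0 \<le> Im z \<and> Im z \<le> 1/2}"
proof (rule inj_onI)
  fix z w assume zw: "z \<in> {z. 0 \<le> Re z \<and> Re z \<le> 1 \<and> 0 \<le> Im z \<and> Im z \<le> 1/2}"
     "w \<in> {z. 0 \<le> Re z \<and> Re z \<le> 1 \<and> 0 \<le> Im z \<and> Im z \<le> 1/2}" and eq: "page d z = page d w"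
  have F: "fst d \<in> FS" using d by (auto simp: darts_def)
  have on_edge: "page d z \<in> GP" if "Im z = 0" "0 \<le> Re z" "Re z \<le> 1" for z
  proof -
    have "z = of_real (Re z)" using that by (simp add: complex_eq_iff)
    then have "page d z \<in> dart_edge d" using page_edge(2)[OF d] that by (metis atLeastAtMost_iff image_eqI)
    then show ?thesis using GP_eq dart_edge_in[OF d] by blast
  qed
  have off: "page d z \<notin> GP" if "0 < Im z" "Im z \<le> 1/2" for z
    using page_face[OF d, of z] face_GP[OF F] that by auto
  consider "Im z = 0" "Im w = 0" | "Im z > 0" "Im w > 0"
    using on_edge[of z] on_edge[of w] off[of z] off[of w] zw eq by force
  then show "z = w"
  proof cases
    case 1
    then have "z = of_real (Re z)" "w = of_real (Re w)" by (auto simp: complex_eq_iff)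
    then have "Re z = Re w" using page_edge(1)[OF d] zw eq unfolding inj_on_def by (metis (no_types, lifting) atLeastAtMost_iff mem_Collect_eq)
    with 1 show ?thesis by (simp add: complex_eq_iff)
  next
    case 2
    let ?n = "fdeg (fst d)"
    have "polar ?n (of_nat (snd d) + z) \<in> ball 0 1" "polar ?n (of_nat (snd d) + w) \<in> ball 0 1"
      using 2 zw by (auto simp: norm_polar)
    then have eq2: "polar ?n (of_nat (snd d) + z) = polar ?n (of_nat (snd d) + w)"
      using face_map_ball(2)[OF F] eq unfolding page_def inj_on_def by auto
    have im: "Im z = Im w" using polar_eqD(1)[OF eq2] fdeg_pos[OF F] zw by simp
    obtain k :: int where k: "Re z - Re w = of_int k * real ?n"
      using polar_eqD(2)[OF eq2] fdeg_pos[OF F] zw by auto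
    have "\<bar>Re z - Re w\<bar> < real ?n" using zw fdeg_ge_2[OF F] by auto
    then have "\<bar>of_int k * real ?n\<bar> < 1 * real ?n" using k by simp
    then have "k = 0" using fdeg_pos[OF F] by (simp add: abs_mult)
    then have "Re z = Re w" using k by simp
    then show ?thesis using im by (simp add: complex_eq_iff)
  qed
qed

end


section \<open>Every edge has exactly two sides\<close>

lemma card_le_2I:
  assumes "\<And>x y z. x \<in> A \<Longrightarrow> y \<in> A \<Longrightarrow> z \<in> A \<Longrightarrow> x \<noteq> y \<Longrightarrow> x \<noteq> z \<Longrightarrow> y \<noteq> z \<Longrightarrow> False"
  shows "finite A \<and> card A \<le> 2"
proof (rule ccontr)
  assume "\<not> (finite A \<and> card A \<le> 2)"
  then have "\<exists>B\<subseteq>A. card B = 3"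
    using infinite_arbitrarily_large[of A 3] obtain_subset_with_card_n[of 3 A] by (metis not_less_eq_eq numeral_2_eq_2 numeral_3_eq_3)
  then obtain B where "B \<subseteq> A" "card B = 3" by blast
  then obtain x y z where "B = {x, y, z}" "x \<noteq> y" "y \<noteq> z" "x \<noteq> z" by (auto simp: card_3_iff)
  then show False using assms \<open>B \<subseteq> A\<close> by (meson insert_subset)
qed

context surface_map
begin

lemma page_edge_interior:
  assumes "d \<in> darts"
  shows "(\<lambda>t. page d (of_real t)) ` {0<..<1} = dart_edge d - pverts G"
proof
  show "(\<lambda>t. page d (of_real t)) ` {0<..<1} \<subseteq> dart_edge d - pverts G"
    using page_in_edge[OF assms] page_vertex_iff[OF assms] by fastforce
  show "dart_edge d - pverts G \<subseteq> (\<lambda>t. page d (of_real t)) ` {0<..<1}"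
  proof
    fix x assume x: "x \<in> dart_edge d - pverts G"
    then have "x \<in> (\<lambda>t. page d (of_real t)) ` {0..1}" using page_edge(2)[OF assms] by simp
    then obtain t where t: "0 \<le> t" "t \<le> 1" "x = page d (of_real t)" by auto
    then have "t \<noteq> 0 \<and> t \<noteq> 1" using x page_vertex_iff[OF assms t(1,2)] by auto
    then show "x \<in> (\<lambda>t. page d (of_real t)) ` {0<..<1}" using t by force
  qed
qed

lemma edge_homeomorphic:
  assumes "d \<in> darts"
  shows "homeomorphic_map (top_of_set {0..1::real}) (subtopology M (dart_edge d)) (\<lambda>t. page d (of_real t))"
proof -
  have "continuous_map (top_of_set {0..1::real}) (top_of_set {z. 0 \<le> Im z \<and> Im z \<le> 1}) of_real"
    by (auto simp: continuous_map_in_subtopology intro!: continuous_intros)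
  then have c: "continuous_map (top_of_set {0..1::real}) M (\<lambda>t. page d (of_real t))"
    using continuous_map_compose[OF _ page_continuous[OF assms]] unfolding o_def by blast
  show ?thesis
  proof (rule continuous_imp_homeomorphic_map)
    show "continuous_map (top_of_set {0..1::real}) (subtopology M (dart_edge d)) (\<lambda>t. page d (of_real t))"
      using c page_in_edge[OF assms] by (auto simp: continuous_map_in_subtopology)
    show "Hausdorff_space (subtopology M (dart_edge d))" using hausdorff Hausdorff_space_subtopology by blast
    have "dart_edge d \<subseteq> topspace M" using edge_closed[OF dart_edge_in[OF assms]] closedin_subset by blast
    then show "(\<lambda>t. page d (of_real t)) ` topspace (top_of_set {0..1}) = topspace (subtopology M (dart_edge d))"
      using page_edge(2)[OF assms] by auto
    show "inj_on (\<lambda>t. page d (of_real t)) (topspace (top_of_set {0..1}))"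
      using page_edge(1)[OF assms] by simp
  qed (auto simp: compact_space_subtopology)
qed

text \<open>Two pages along the same edge are glued to an embedded strip, the second one after a
  reparametrization \<open>h\<close> of the edge that makes the two pages agree on it.\<close>

lemma tube_exists:
  assumes d: "d1 \<in> darts" "d2 \<in> darts" and ne: "d1 \<noteq> d2" and e: "dart_edge d1 = e" "dart_edge d2 = e"
  obtains \<Psi> where "continuous_map (top_of_set strip) M \<Psi>" "inj_on \<Psi> strip"
    "\<Psi> ` (strip \<inter> {z. Im z = 0}) = e - pverts G"
    "\<And>z. z \<in> strip \<Longrightarrow> Im z \<noteq> 0 \<Longrightarrow> \<exists>w. 0 < Re w \<and> Re w < 1 \<and> 0 < Im w \<and> Im w < 1 \<and>
        (\<Psi> z = page d1 w \<or> \<Psi> z = page d2 w)"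
proof -
  obtain g2 where g2: "homeomorphic_maps (top_of_set {0..1::real}) (subtopology M e) (\<lambda>t. page d2 (of_real t)) g2"
    using edge_homeomorphic[OF d(2)] homeomorphic_map_maps e(2) by blast
  define h where "h t = g2 (page d1 (of_real t))" for t
  have "continuous_map (top_of_set {0..1::real}) (top_of_set {0..1::real}) (g2 \<circ> (\<lambda>t. page d1 (of_real t)))"
    using continuous_map_compose homeomorphic_imp_continuous_map[OF edge_homeomorphic[OF d(1)]] g2 e(1)
    unfolding homeomorphic_maps_def by blast
  then have hc: "continuous_on {0..1} h" and h01: "\<And>t. t \<in> {0..1} \<Longrightarrow> h t \<in> {0..1}"
    by (auto simp: continuous_map_in_subtopology h_def o_def Pi_iff image_subset_iff)
  have ph: "page d2 (of_real (h t)) = page d1 (of_real t)" if "t \<in> {0..1}" for t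
  proof -
    have "page d1 (of_real t) \<in> topspace (subtopology M e)"
      using page_in_edge[OF d(1)] that e(1) edge_closed[OF dart_edge_in[OF d(1)]] closedin_subset by fastforce
    then show ?thesis using g2 unfolding homeomorphic_maps_def h_def by blast
  qed
  have h_int: "0 < h t \<and> h t < 1" if "0 < t" "t < 1" for t
  proof -
    have "page d2 (of_real (h t)) \<notin> pverts G"
      using ph[of t] page_vertex_iff[OF d(1), of t] that by simp
    then show ?thesis using page_vertex_iff[OF d(2), of "h t"] h01[of t] that by fastforce
  qed
  have h_inj: "t = t'" if "0 < t" "t < 1" "0 < t'" "t' < 1" "h t = h t'" for t t'
    using ph[of t] ph[of t'] inj_onD[OF page_edge(1)[OF d(1)], of t t'] that by simp
  define p2 where "p2 z = page d2 (Complex (h (Re z)) (- Im z))" for z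
  define \<Psi> where "\<Psi> z = (if 0 \<le> Im z then page d1 z else p2 z)" for z
  have cont: "continuous_map (top_of_set strip) M \<Psi>"
    unfolding \<Psi>_def
  proof (rule continuous_map_cases_le)
    show "continuous_map (top_of_set strip) euclideanreal (\<lambda>z. 0)" by simp
    show "continuous_map (top_of_set strip) euclideanreal Im" by (auto intro!: continuous_intros)
    show "continuous_map (subtopology (top_of_set strip) {z \<in> topspace (top_of_set strip). 0 \<le> Im z}) M (page d1)"
      unfolding subtopology_subtopology
      by (rule continuous_map_from_subtopology_mono[OF page_continuous[OF d(1)]]) (auto simp: strip_def)
    have "continuous_on (strip \<inter> {z \<in> topspace (top_of_set strip). Im z \<le> 0}) (\<lambda>z. Complex (h (Re z)) (- Im z))"
      unfolding Complex_eq
      by (intro continuous_intros continuous_on_compose2[OF hc]) (auto simp: strip_def)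
    moreover have "Complex (h (Re z)) (- Im z) \<in> {z. 0 \<le> Im z \<and> Im z \<le> 1}" if "z \<in> strip" "Im z \<le> 0" for z
      using that by (auto simp: strip_def)
    ultimately have "continuous_map (top_of_set (strip \<inter> {z \<in> topspace (top_of_set strip). Im z \<le> 0})) (top_of_set {z. 0 \<le> Im z \<and> Im z \<le> 1})
       (\<lambda>z. Complex (h (Re z)) (- Im z))"
      by (auto simp: continuous_map_in_subtopology)
    then show "continuous_map (subtopology (top_of_set strip) {z \<in> topspace (top_of_set strip). Im z \<le> 0}) M p2"
      using continuous_map_compose[OF _ page_continuous[OF d(2)]] unfolding subtopology_subtopology p2_def o_def by blast
    fix z assume z: "z \<in> topspace (top_of_set strip)" "0 = Im z"
    then have "z = of_real (Re z)" "Complex (h (Re z)) (- Im z) = of_real (h (Re z))" by (auto simp: complex_eq_iff)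
    then show "page d1 z = p2 z" using ph[of "Re z"] z(1) unfolding p2_def by (auto simp: strip_def)
  qed
  have pos: "0 < Re z \<and> Re z < 1 \<and> 0 < Im z \<and> Im z < 1" if "z \<in> strip" "Im z > 0" for z
    using that by (auto simp: strip_def)
  have neg: "0 < Re w \<and> Re w < 1 \<and> 0 < Im w \<and> Im w < 1" if "z \<in> strip" "Im z < 0" "w = Complex (h (Re z)) (- Im z)" for z w
    using that h_int by (auto simp: strip_def)
  have real: "\<Psi> z = page d1 (of_real (Re z))" if "Im z = 0" for z
  proof -
    have "z = of_real (Re z)" using that by (simp add: complex_eq_iff)
    then show ?thesis using that by (simp add: \<Psi>_def)
  qed
  have img: "\<Psi> ` (strip \<inter> {z. Im z = 0}) = e - pverts G"
  proof -
    have "strip \<inter> {z. Im z = 0} = of_real ` {0<..<1}"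
      by (auto simp: strip_def image_iff complex_eq_iff)
    then have "\<Psi> ` (strip \<inter> {z. Im z = 0}) = (\<lambda>t. page d1 (of_real t)) ` {0<..<1}"
      using real by (auto simp: image_image)
    then show ?thesis using page_edge_interior[OF d(1)] e(1) by simp
  qed
  have off: "\<exists>w. 0 < Re w \<and> Re w < 1 \<and> 0 < Im w \<and> Im w < 1 \<and> (\<Psi> z = page d1 w \<or> \<Psi> z = page d2 w)"
    if "z \<in> strip" "Im z \<noteq> 0" for z
  proof (cases "Im z > 0")
    case True
    then show ?thesis using pos[OF that(1)] by (intro exI[of _ z]) (auto simp: \<Psi>_def)
  next
    case False
    then show ?thesis using neg[OF that(1)] that(2)
      by (intro exI[of _ "Complex (h (Re z)) (- Im z)"]) (auto simp: \<Psi>_def p2_def)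
  qed
  have off_graph: "\<Psi> z \<notin> GP" if z: "z \<in> strip" "Im z \<noteq> 0" for z
  proof -
    obtain w where w: "0 < Im w" "Im w < 1" "\<Psi> z = page d1 w \<or> \<Psi> z = page d2 w" using off[OF z] by blast
    have "\<Psi> z \<in> fst d1 \<or> \<Psi> z \<in> fst d2" using w page_face[OF d(1), of w] page_face[OF d(2), of w] by auto
    then show ?thesis using face_GP[of "fst d1"] face_GP[of "fst d2"] d by (auto simp: darts_def)
  qed
  have on_graph: "\<Psi> z \<in> GP" if "z \<in> strip" "Im z = 0" for z
    using img that GP_eq dart_edge_in[OF d(1)] e(1) by blast
  have "inj_on \<Psi> strip"
  proof (rule inj_onI)
    fix z w assume zw: "z \<in> strip" "w \<in> strip" "\<Psi> z = \<Psi> w"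
    \<comment> \<open>Height 0 is equivalent to lying on the graph, which excludes the cases where
      only one of the heights is 0.\<close>
    consider "Im z = 0" "Im w = 0" | "Im z > 0" "Im w > 0" | "Im z < 0" "Im w < 0"
      | "Im z > 0" "Im w < 0" | "Im z < 0" "Im w > 0"
      using on_graph[of z] on_graph[of w] off_graph[of z] off_graph[of w] zw
      by (cases "Im z" "0::real" rule: linorder_cases; cases "Im w" "0::real" rule: linorder_cases) auto
    then show "z = w"
    proof cases
      case 1
      then have "page d1 (of_real (Re z)) = page d1 (of_real (Re w))" using zw real by simp
      then have "Re z = Re w" using inj_onD[OF page_edge(1)[OF d(1)], of "Re z" "Re w"] zw by (auto simp: strip_def)
      then show ?thesis using 1 by (simp add: complex_eq_iff)
    next
      case 2
      then have "page d1 z = page d1 w" using zw by (simp add: \<Psi>_def)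
      then show ?thesis using page_inj[OF d(1) d(1), of z w] pos[OF zw(1)] pos[OF zw(2)] 2 by simp
    next
      case 3
      then have "page d2 (Complex (h (Re z)) (- Im z)) = page d2 (Complex (h (Re w)) (- Im w))"
        using zw by (simp add: \<Psi>_def p2_def)
      then have "Complex (h (Re z)) (- Im z) = Complex (h (Re w)) (- Im w)"
        using page_inj[OF d(2) d(2), of "Complex (h (Re z)) (- Im z)" "Complex (h (Re w)) (- Im w)"]
          neg[OF zw(1) _ refl] neg[OF zw(2) _ refl] 3 by simp
      then have "h (Re z) = h (Re w)" "Im z = Im w" by auto
      then show ?thesis using h_inj[of "Re z" "Re w"] zw by (auto simp: strip_def complex_eq_iff)
    next
      case 4
      then have "page d1 z = page d2 (Complex (h (Re w)) (- Im w))" using zw by (simp add: \<Psi>_def p2_def)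
      then show ?thesis
        using page_inj[OF d(1) d(2), of z "Complex (h (Re w)) (- Im w)"] pos[OF zw(1)] neg[OF zw(2) _ refl] 4 ne by simp
    next
      case 5
      then have "page d1 w = page d2 (Complex (h (Re z)) (- Im z))" using zw by (simp add: \<Psi>_def p2_def)
      then show ?thesis
        using page_inj[OF d(1) d(2), of w "Complex (h (Re z)) (- Im z)"] pos[OF zw(2)] neg[OF zw(1) _ refl] 5 ne by simp
    qed
  qed
  then show ?thesis using that cont img off by blast
qed

text \<open>The tube of the first two darts is open, hence contains points of the third page close
  to the edge. Such a point would lie on the edge or on one of the first two pages, which are
  disjoint from the third.\<close>

lemma no_three_darts:
  assumes "d1 \<in> darts" "d2 \<in> darts" "d3 \<in> darts" "d1 \<noteq> d2" "d1 \<noteq> d3" "d2 \<noteq> d3"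
    and "dart_edge d1 = e" "dart_edge d2 = e" "dart_edge d3 = e"
  shows False
proof -
  obtain \<Psi> where \<Psi>: "continuous_map (top_of_set strip) M \<Psi>" "inj_on \<Psi> strip"
    "\<Psi> ` (strip \<inter> {z. Im z = 0}) = e - pverts G"
    "\<And>z. z \<in> strip \<Longrightarrow> Im z \<noteq> 0 \<Longrightarrow> \<exists>w. 0 < Re w \<and> Re w < 1 \<and> 0 < Im w \<and> Im w < 1 \<and>
        (\<Psi> z = page d1 w \<or> \<Psi> z = page d2 w)"
    using tube_exists[OF assms(1,2,4,7,8)] by metis
  have op: "openin M (\<Psi> ` strip)" by (rule surface_invariance_of_domain[OF surface open_strip \<Psi>(1,2)])
  define x0 :: complex where "x0 = of_real (1/2)"
  have "page d3 x0 \<in> (\<lambda>t. page d3 (of_real t)) ` {0<..<1}"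
    unfolding x0_def by (rule image_eqI[of _ _ "1/2"]) simp_all
  then have x: "page d3 x0 \<in> \<Psi> ` strip"
    using \<Psi>(3) unfolding page_edge_interior[OF assms(3)] assms(9) by blast
  define S where "S = {z. 0 \<le> Im z \<and> Im z \<le> 1}"
  have "openin (top_of_set S) {z \<in> S. page d3 z \<in> \<Psi> ` strip}"
    using openin_continuous_map_preimage[OF page_continuous[OF assms(3)] op] by (simp add: S_def)
  then obtain T where T: "open T" "{z \<in> S. page d3 z \<in> \<Psi> ` strip} = S \<inter> T" by (auto simp: openin_open)
  have "x0 \<in> {z \<in> S. page d3 z \<in> \<Psi> ` strip}" using x by (simp add: S_def x0_def)
  then have "x0 \<in> T" unfolding T(2) by blast
  then obtain r where r: "r > 0" "ball x0 r \<subseteq> T" using T(1) open_contains_ball_eq by metis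
  \<comment> \<open>Straight above the middle of the edge, within the ball and below the centre of
    the face.\<close>
  define z where "z = Complex (1/2) (min (r/2) (1/2))"
  have zb: "0 < Re z" "Re z < 1" "0 < Im z" "Im z < 1" using r(1) by (auto simp: z_def)
  have "z - x0 = \<i> * of_real (min (r/2) (1/2))" by (simp add: z_def x0_def complex_eq_iff)
  then have "norm (z - x0) = \<bar>min (r/2) (1/2)\<bar>" by (metis norm_mult norm_ii norm_of_real mult_1)
  then have "norm (z - x0) < r" using r(1) by linarith
  then have "z \<in> ball x0 r" by (simp add: dist_norm norm_minus_commute)
  then have "z \<in> S \<inter> T" using r(2) zb by (auto simp: S_def)
  then have "page d3 z \<in> \<Psi> ` strip" unfolding T(2)[symmetric] by simp
  then obtain y where y: "y \<in> strip" "\<Psi> y = page d3 z" by (metis imageE)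
  have F: "page d3 z \<in> fst d3" "fst d3 \<in> FS" using page_face[OF assms(3), of z] zb assms(3) by (auto simp: darts_def)
  show False
  proof (cases "Im y = 0")
    case True
    then have "\<Psi> y \<in> e" using \<Psi>(3) y(1) by blast
    then have "\<Psi> y \<in> GP" using GP_eq dart_edge_in[OF assms(1)] assms(7) by blast
    then show False using F face_GP y by auto
  next
    case False
    then obtain w where w: "0 < Re w" "Re w < 1" "0 < Im w" "Im w < 1" "page d3 z = page d1 w \<or> page d3 z = page d2 w"
      using \<Psi>(4)[OF y(1)] y(2) by auto
    then show False
      using page_inj[OF assms(3,1), of z w] page_inj[OF assms(3,2), of z w] zb assms(5,6) by blast
  qed
qed

definition darts_on :: "'a set \<Rightarrow> ('a set \<times> nat) set" where
  "darts_on e = {d \<in> darts. dart_edge d = e}"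

lemma darts_on_le_2: "finite (darts_on e) \<and> card (darts_on e) \<le> 2"
proof (rule card_le_2I)
  fix x y z assume "x \<in> darts_on e" "y \<in> darts_on e" "z \<in> darts_on e" "x \<noteq> y" "x \<noteq> z" "y \<noteq> z"
  then show False using no_three_darts[of x y z e] unfolding darts_on_def by blast
qed

lemma finite_darts: "finite darts"
proof -
  have "darts = (\<Union>e\<in>edges. darts_on e)" using dart_edge_in by (auto simp: darts_on_def)
  then show ?thesis using finite_edges darts_on_le_2 by auto
qed

lemma finite_faces: "finite FS"
proof -
  have "FS \<subseteq> fst ` darts"
  proof
    fix F assume "F \<in> FS"
    then have "(F, 0) \<in> darts" using fdeg_pos by (simp add: darts_def)
    then show "F \<in> fst ` darts" by force
  qed
  then show ?thesis using finite_darts finite_surj by blast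
qed

end


section \<open>Open pieces of the surface\<close>

lemma has_euler_char_union_step:
  assumes X: "openin M X" and N: "openin M N" and eq: "X \<union> N = X \<union> C" "C \<subseteq> N" "C \<inter> X = {}"
    and "has_euler_char (d + 1) (subtopology M X) c1" "has_euler_char (d + 1) (subtopology M N) c2"
    and "has_euler_char d (subtopology M (N - C)) c3"
  shows "has_euler_char (d + 1) (subtopology M (X \<union> N)) (c1 + c2 - c3)"
proof (rule has_euler_char_step)
  let ?Y = "subtopology M (X \<union> N)"
  have op: "openin M (X \<union> N)" using X N by (rule openin_Un)
  have sub: "X \<subseteq> topspace M" "N \<subseteq> topspace M" using X N openin_subset by auto
  then have top: "topspace ?Y = X \<union> N" by auto
  have diff: "topspace ?Y - C = X" using eq unfolding top by blast
  show "closedin ?Y C"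
    unfolding closedin_def diff using X eq openin_open_subtopology[OF op] unfolding top by blast
  show "openin ?Y N" using N openin_open_subtopology[OF op] by blast
  have ss: "subtopology ?Y S = subtopology M S" if "S \<subseteq> X \<union> N" for S
    using that by (simp add: subtopology_subtopology Int_absorb1)
  show "has_euler_char (d + 1) (subtopology ?Y (topspace ?Y - C)) c1"
    unfolding diff ss[OF Un_upper1] by fact
  show "has_euler_char (d + 1) (subtopology ?Y N) c2" unfolding ss[OF Un_upper2] by fact
  have "N - C \<subseteq> X \<union> N" by blast
  from ss[OF this] show "has_euler_char d (subtopology ?Y (N - C)) c3" using assms(8) by simp
qed (use eq in auto)

lemma compact_rectangle: "compact {z. a \<le> Re z \<and> Re z \<le> b \<and> c \<le> Im z \<and> Im z \<le> d}"
proof -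
  have "{z. a \<le> Re z \<and> Re z \<le> b \<and> c \<le> Im z \<and> Im z \<le> d} = cbox (Complex a c) (Complex b d)"
    by (auto simp: in_cbox_complex_iff)
  then show ?thesis by simp
qed

context surface_map
begin

text \<open>A closed set that covers the part of the closed disc outside the sector with angles from
  \<alpha> to \<beta> and depth \<eta>. Neighbourhoods in the surface are then complements of images
  of compact sets.\<close>

definition off_sector :: "'a set \<Rightarrow> real \<Rightarrow> real \<Rightarrow> real \<Rightarrow> complex set" where
  "off_sector F \<alpha> \<beta> \<eta> = cball 0 (1 - \<eta>) \<union>
     polar (fdeg F) ` {z. \<beta> \<le> Re z \<and> Re z \<le> \<alpha> + real (fdeg F) \<and> 0 \<le> Im z \<and> Im z \<le> \<eta>}"

lemma closed_off_sector: "closed (off_sector F \<alpha> \<beta> \<eta>)"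
  unfolding off_sector_def
  by (intro closed_Un closed_cball compact_imp_closed compact_continuous_image continuous_on_polar compact_rectangle)

lemma off_sectorE:
  assumes "F \<in> FS" "norm w \<le> 1" "w \<notin> off_sector F \<alpha> \<beta> \<eta>"
  obtains z where "polar (fdeg F) z = w" "\<alpha> \<le> Re z" "Re z < \<beta>" "0 \<le> Im z" "Im z < \<eta>"
proof -
  obtain z where z: "\<alpha> \<le> Re z" "Re z < \<alpha> + real (fdeg F)" "Im z = 1 - norm w" "0 \<le> Im z" "polar (fdeg F) z = w"
    using polar_surj[OF assms(2) fdeg_pos[OF assms(1)], of \<alpha>] by metis
  have "norm w > 1 - \<eta>" using assms(3) by (auto simp: off_sector_def)
  then have "Im z < \<eta>" using z by simp
  moreover have "Re z < \<beta>"
  proof (rule ccontr)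
    assume "\<not> Re z < \<beta>"
    then have "z \<in> {z. \<beta> \<le> Re z \<and> Re z \<le> \<alpha> + real (fdeg F) \<and> 0 \<le> Im z \<and> Im z \<le> \<eta>}"
      using z \<open>Im z < \<eta>\<close> by auto
    then show False using assms(3) z(5) unfolding off_sector_def by blast
  qed
  ultimately show ?thesis using that z by blast
qed

text \<open>Another representative of the point in the removed window would differ from
  \<open>Re z\<close> by an amount strictly between minus one period and 0.\<close>

lemma off_sectorI:
  assumes "F \<in> FS" "Im z = 0" "\<alpha> < Re z" "Re z < \<beta>" "0 < \<eta>" "\<eta> < 1"
  shows "polar (fdeg F) z \<notin> off_sector F \<alpha> \<beta> \<eta>"
proof
  assume "polar (fdeg F) z \<in> off_sector F \<alpha> \<beta> \<eta>"
  moreover have "polar (fdeg F) z \<notin> cball 0 (1 - \<eta>)" using assms by (simp add: norm_polar)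
  ultimately obtain y where y: "polar (fdeg F) z = polar (fdeg F) y" "\<beta> \<le> Re y" "Re y \<le> \<alpha> + real (fdeg F)" "Im y \<le> \<eta>"
    unfolding off_sector_def by blast
  obtain k :: int where k: "Re z - Re y = of_int k * real (fdeg F)"
    using polar_eqD(2)[OF y(1)] fdeg_pos[OF assms(1)] assms y by auto
  have "(- 1) * real (fdeg F) < of_int k * real (fdeg F)" "of_int k * real (fdeg F) < 0 * real (fdeg F)"
    using k y assms by linarith+
  then have "- 1 < (of_int k :: real)" "(of_int k :: real) < 0"
    using fdeg_pos[OF assms(1)] by (simp_all only: mult_less_cancel_right_pos of_nat_0_less_iff)
  moreover from this have "k \<le> - 1" by simp
  then have "(of_int k :: real) \<le> of_int (- 1)" by (simp only: of_int_le_iff)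
  ultimately show False by simp
qed

text \<open>The removed set is a finite union of compact images. With \<open>off_sector\<close> for
  \<open>L\<close>, a remaining point can be the image only of points in the prescribed
  sectors.\<close>

lemma openin_avoiding:
  assumes "\<And>F. F \<in> FS \<Longrightarrow> closed (L F)"
  shows "openin M (topspace M - (\<Union>F\<in>FS. face_map F ` (cball 0 1 \<inter> L F)))"
proof -
  have "closedin M (face_map F ` (cball 0 1 \<inter> L F))" if "F \<in> FS" for F
  proof -
    have "compactin (top_of_set (cball 0 1)) (cball 0 1 \<inter> L F)"
      using assms[OF that] by (simp add: compactin_subtopology compact_Int_closed)
    then show ?thesis
      using image_compactin[OF _ face_map(3)[OF that]] compactin_imp_closedin[OF hausdorff] by blast
  qed
  then have "closedin M (\<Union>F\<in>FS. face_map F ` (cball 0 1 \<inter> L F))"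
    using finite_faces by (intro closedin_Union) auto
  then show ?thesis by (rule openin_diff[OF openin_topspace])
qed

text \<open>A common form for edges with no side and with one side, for the contradiction in
  \<open>card_darts_on\<close>. Without a dart, \<open>K\<close> is a segment parametrizing the
  edge; with one dart it is the outer half of the page.\<close>

lemma one_sided_edge_param:
  assumes e: "e \<in> edges" and le: "card (darts_on e) \<le> 1"
  obtains K Q z where "compact K" "continuous_map (top_of_set K) M Q" "inj_on Q K" "\<And>z. z \<in> K \<Longrightarrow> 0 \<le> Im z"
    "z \<in> K" "Im z = 0" "Q z \<in> e - pverts G" "e \<subseteq> Q ` K"
    "\<And>d z. d \<in> darts_on e \<Longrightarrow> 0 \<le> Re z \<Longrightarrow> Re z \<le> 1 \<Longrightarrow> 0 \<le> Im z \<Longrightarrow> Im z \<le> 1/2 \<Longrightarrow> page d z \<in> Q ` K"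
proof (cases "darts_on e = {}")
  case True
  obtain a where a: "a \<in> parcs G" "e = \<gamma> a" using e by (auto simp: edges_def)
  obtain g where g: "embedding_map (top_of_set {0..1::real}) M g" "g ` {0..1} = e"
    using edge_param[OF a(1)] a(2) by metis
  have gc: "continuous_map (top_of_set {0..1::real}) M g" "inj_on g {0..1}"
    using g(1) homeomorphic_imp_continuous_map continuous_map_into_fulltopology homeomorphic_imp_injective_map
    unfolding embedding_map_def by fastforce+
  define K :: "complex set" where "K = of_real ` {0..1}"
  have Re_K: "Re ` K = {0..1}" by (simp add: K_def image_image)
  have Q: "continuous_map (top_of_set K) M (g \<circ> Re)"
    by (rule continuous_map_compose[OF _ gc(1)])
       (use Re_K in \<open>auto simp: continuous_map_in_subtopology intro!: continuous_intros\<close>)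
  have im: "(g \<circ> Re) ` K = e" using g(2) Re_K by (metis image_comp)
  obtain x where x: "x \<in> e - pverts G" using edge_interior_nonempty[OF e] by blast
  then obtain z where z: "z \<in> K" "x = (g \<circ> Re) z" using im by (metis DiffD1 imageE)
  show ?thesis
  proof (rule that[of K "g \<circ> Re" z])
    show "compact K" unfolding K_def by (intro compact_continuous_image continuous_intros) auto
    show "inj_on (g \<circ> Re) K" using gc(2) Re_K by (intro comp_inj_on) (auto simp: K_def inj_on_def)
  qed (use Q im z x True in \<open>auto simp: K_def\<close>)
next
  case False
  then have "card (darts_on e) > 0" using darts_on_le_2[of e] by (simp add: card_gt_0_iff)
  then have "card (darts_on e) = 1" using le by linarith
  then obtain d where d: "darts_on e = {d}" by (rule card_1_singletonE)
  then have dd: "d \<in> darts" "dart_edge d = e" by (auto simp: darts_on_def)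
  define K where "K = {z. 0 \<le> Re z \<and> Re z \<le> 1 \<and> 0 \<le> Im z \<and> Im z \<le> 1/2}"
  have Q: "continuous_map (top_of_set K) M (page d)"
    by (rule continuous_map_from_subtopology_mono[OF page_continuous[OF dd(1)]]) (auto simp: K_def)
  have eK: "\<exists>z\<in>K. Im z = 0 \<and> page d z = x" if "x \<in> e" for x
  proof -
    have "x \<in> (\<lambda>t. page d (of_real t)) ` {0..1}" using page_edge(2)[OF dd(1)] dd(2) that by simp
    then obtain t where "x = page d (of_real t)" "t \<in> {0..1}" by (rule imageE)
    then show ?thesis by (intro bexI[of _ "of_real t"]) (auto simp: K_def)
  qed
  obtain x where x: "x \<in> e - pverts G" using edge_interior_nonempty[OF e] by blast
  then obtain z where z: "z \<in> K" "Im z = 0" "page d z = x" using eK by blast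
  show ?thesis
  proof (rule that[of K "page d" z])
    show "compact K" unfolding K_def by (rule compact_rectangle)
    show "inj_on (page d) K" unfolding K_def by (rule page_inj_half[OF dd(1)])
    show "e \<subseteq> page d ` K" using eK by blast
    show "page d z \<in> e - pverts G" using z x by simp
  qed (use Q z d in \<open>auto simp: K_def\<close>)
qed

text \<open>With fewer than two sides, some open neighbourhood \<open>D\<close> of an interior point
  of the edge lies in the image of \<open>K\<close>. Its preimage would be open in the plane
  although \<open>K\<close> stops at the real axis.\<close>

lemma card_darts_on:
  assumes e: "e \<in> edges" shows "card (darts_on e) = 2"
proof (rule ccontr)
  assume "card (darts_on e) \<noteq> 2"
  then have "card (darts_on e) \<le> 1" using darts_on_le_2[of e] by linarith
  then obtain K Q z where K: "compact K" "continuous_map (top_of_set K) M Q" "inj_on Q K" "\<And>z. z \<in> K \<Longrightarrow> 0 \<le> Im z"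
    and z: "z \<in> K" "Im z = 0" "Q z \<in> e - pverts G" and eK: "e \<subseteq> Q ` K"
    and pg: "\<And>d z. d \<in> darts_on e \<Longrightarrow> 0 \<le> Re z \<Longrightarrow> Re z \<le> 1 \<Longrightarrow> 0 \<le> Im z \<Longrightarrow> Im z \<le> 1/2 \<Longrightarrow> page d z \<in> Q ` K"
    using one_sided_edge_param[OF e] by metis
  define L where "L F = (\<Inter>i\<in>{i. i < fdeg F \<and> dart_edge (F, i) = e}. off_sector F (real i) (real i + 1) (1/2))" for F
  \<comment> \<open>The points of \<open>D\<close> on the graph belong to \<open>e\<close>, and
    those in faces to the sectors along darts of \<open>e\<close>; both kinds are covered by
    \<open>Q\<close>.\<close>
  define D where "D = topspace M - (\<Union>F\<in>FS. face_map F ` (cball 0 1 \<inter> L F)) - \<Union>(edges - {e})"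
  have "closedin M (\<Union>(edges - {e}))" using finite_edges edge_closed by (intro closedin_Union) auto
  moreover have "openin M (topspace M - (\<Union>F\<in>FS. face_map F ` (cball 0 1 \<inter> L F)))"
    by (rule openin_avoiding) (auto simp: L_def intro!: closed_INT closed_off_sector)
  ultimately have opD: "openin M D" unfolding D_def by (rule openin_diff[rotated])
  have DK: "D \<subseteq> Q ` K"
  proof
    fix y assume y: "y \<in> D"
    show "y \<in> Q ` K"
    proof (cases "y \<in> GP")
      case True
      then show ?thesis using y eK GP_eq by (auto simp: D_def)
    next
      case False
      then have "y \<in> \<Union>FS" unfolding Union_faces using y by (simp add: D_def)
      then obtain F where F: "F \<in> FS" "y \<in> F" by blast
      then obtain w where w: "w \<in> ball 0 1" "y = face_map F w" using face_map_ball(1) by blast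
      then have "w \<notin> L F" using y F(1) unfolding D_def by force
      then obtain i where i: "i < fdeg F" "dart_edge (F, i) = e" "w \<notin> off_sector F (real i) (real i + 1) (1/2)"
        unfolding L_def by blast
      obtain v where v: "polar (fdeg F) v = w" "real i \<le> Re v" "Re v < real i + 1" "0 \<le> Im v" "Im v < 1/2"
        using off_sectorE[OF F(1) _ i(3)] w(1) by auto
      have "y = page (F, i) (v - of_nat i)" using v(1) w(2) by (simp add: page_def)
      moreover have "(F, i) \<in> darts_on e" using F(1) i by (simp add: darts_on_def darts_def)
      ultimately show ?thesis using pg[of "(F, i)" "v - of_nat i"] v by simp
    qed
  qed
  have "Q z \<in> D"
  proof -
    have "Q z \<notin> \<Union>(edges - {e})" using edges_Int[OF e] z(3) by blast
    moreover have "Q z \<notin> face_map F ` (cball 0 1 \<inter> L F)" if F: "F \<in> FS" for F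
    proof
      assume "Q z \<in> face_map F ` (cball 0 1 \<inter> L F)"
      then obtain w where w: "norm w \<le> 1" "w \<in> L F" "face_map F w = Q z" by auto
      obtain i t where it: "i < fdeg F" "0 < t" "t < 1" "w = polar (fdeg F) (of_nat i + of_real t)" "dart_edge (F, i) = e"
        using face_map_edge_point[OF F w(1,3) _ _ e] z(3) by blast
      have "w \<notin> off_sector F (real i) (real i + 1) (1/2)"
        unfolding it(4) by (rule off_sectorI[OF F]) (use it in auto)
      then show False using w(2) it unfolding L_def by blast
    qed
    moreover have "Q z \<in> topspace M" using z(3) e GP_eq GP_sub by blast
    ultimately show ?thesis unfolding D_def by blast
  qed
  have "open {z \<in> K. Q z \<in> D}" by (rule surface_compact_preimage_open[OF surface K(1-3) opD DK])
  then obtain r where r: "r > 0" "ball z r \<subseteq> {z \<in> K. Q z \<in> D}"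
    using z(1) \<open>Q z \<in> D\<close> by (metis (mono_tags, lifting) mem_Collect_eq open_contains_ball_eq)
  \<comment> \<open>Directly below \<open>z\<close>: still in the open preimage, but outside the
    half-plane that contains \<open>K\<close>.\<close>
  have "z - \<i> * of_real (r/2) \<in> ball z r" using r(1) by (simp add: dist_norm norm_mult)
  then have "0 \<le> Im (z - \<i> * of_real (r/2))" using r(2) K(4) by blast
  then show False using r(1) z(2) by simp
qed

section \<open>The Euler formula\<close>

lemma openin_face: "F \<in> FS \<Longrightarrow> openin M F"
  using surface_invariance_of_domain[OF surface open_ball[of 0 1], of "face_map F"] face_map_ball[of F]
    continuous_map_from_subtopology_mono[OF face_map(3)[of F] ball_subset_cball] by simp

lemma euler_char_faces:
  assumes "finite A" "A \<subseteq> FS" shows "has_euler_char 0 (subtopology M (\<Union>A)) (int (card A))"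
  using assms
proof (induction A)
  case empty
  show ?case using has_euler_char_mono[OF has_euler_char_empty, of "subtopology M {}" 0] by simp
next
  case (insert F A)
  have F: "F \<in> FS" "\<Union>A \<subseteq> topspace M" "F \<subseteq> topspace M" using insert face_sub by auto
  have "has_euler_char 0 (top_of_set (ball (0::complex) 1)) 1" by (intro has_euler_char_convex) auto
  then have cF: "has_euler_char 0 (subtopology M F) 1"
    using has_euler_char_homeomorphic face_map(4)[OF F(1)] homeomorphic_map_imp_homeomorphic_space homeomorphic_space_sym
    unfolding open_disc_def by blast
  have "F \<inter> \<Union>A = {}" using faces_disjoint[OF F(1)] insert by blast
  moreover have "openin M (\<Union>A)" using openin_face insert by blast
  ultimately have "has_euler_char 0 (subtopology M (F \<union> \<Union>A)) (1 + int (card A))"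
    using has_euler_char_disjoint_Un[of "subtopology M (F \<union> \<Union>A)" F "\<Union>A" 0 1 "int (card A)"]
      insert cF F openin_face[OF F(1)]
    by (simp add: openin_open_subtopology openin_Un subtopology_subtopology Int_absorb1 Int_absorb2)
  then show ?case using insert by (simp add: add.commute)
qed

lemma tube_neighbourhood:
  assumes e: "e \<in> edges"
  obtains N where "openin M N" "e - pverts G \<subseteq> N" "N \<subseteq> (e - pverts G) \<union> \<Union>FS"
    "has_euler_char 0 (subtopology M N) 1" "has_euler_char 0 (subtopology M (N - (e - pverts G))) 2"
proof -
  obtain d1 d2 where "darts_on e = {d1, d2}" and ne: "d1 \<noteq> d2" using card_darts_on[OF e] card_2_iff by metis
  then have d: "d1 \<in> darts" "d2 \<in> darts" "dart_edge d1 = e" "dart_edge d2 = e" by (auto simp: darts_on_def)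
  obtain \<Psi> where \<Psi>: "continuous_map (top_of_set strip) M \<Psi>" "inj_on \<Psi> strip"
    "\<Psi> ` (strip \<inter> {z. Im z = 0}) = e - pverts G"
    "\<And>z. z \<in> strip \<Longrightarrow> Im z \<noteq> 0 \<Longrightarrow> \<exists>w. 0 < Re w \<and> Re w < 1 \<and> 0 < Im w \<and> Im w < 1 \<and>
        (\<Psi> z = page d1 w \<or> \<Psi> z = page d2 w)"
    using tube_exists[OF d(1,2) ne d(3,4)] by metis
  have off: "\<Psi> z \<in> \<Union>FS" if "z \<in> strip" "Im z \<noteq> 0" for z
  proof -
    obtain w where w: "0 < Im w" "Im w < 1" "\<Psi> z = page d1 w \<or> \<Psi> z = page d2 w" using \<Psi>(4)[OF \<open>z \<in> strip\<close> \<open>Im z \<noteq> 0\<close>] by blast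
    then have "\<Psi> z \<in> fst d1 \<or> \<Psi> z \<in> fst d2" using page_face d(1,2) by (metis less_imp_le)
    then show ?thesis using d(1,2) by (auto simp: darts_def)
  qed
  have slit: "\<Psi> ` strip - (e - pverts G) = \<Psi> ` (strip - {z. Im z = 0})"
    using \<Psi>(2) unfolding \<Psi>(3)[symmetric] by (auto simp: inj_on_def)
  show ?thesis
  proof
    show "openin M (\<Psi> ` strip)" by (rule surface_invariance_of_domain[OF surface open_strip \<Psi>(1,2)])
    show "e - pverts G \<subseteq> \<Psi> ` strip" unfolding \<Psi>(3)[symmetric] by blast
    show "\<Psi> ` strip \<subseteq> (e - pverts G) \<union> \<Union>FS" using off unfolding \<Psi>(3)[symmetric] by blast
    show "has_euler_char 0 (subtopology M (\<Psi> ` strip)) 1"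
      using has_euler_char_homeomorphic surface_open_embedding[OF surface open_strip \<Psi>(1,2)] has_euler_char_strip by blast
    show "has_euler_char 0 (subtopology M (\<Psi> ` strip - (e - pverts G))) 2"
      unfolding slit
      using has_euler_char_homeomorphic surface_open_embedding[OF surface open_strip \<Psi>(1,2)] has_euler_char_slit_strip by blast
  qed
qed

text \<open>Each open edge contributes 1 for its strip and -2 for the two halves already present.
  Openness is part of the induction because the next gluing step needs it.\<close>

lemma euler_char_edges:
  assumes "finite A" "A \<subseteq> edges"
  shows "openin M (\<Union>FS \<union> (\<Union>e\<in>A. e - pverts G)) \<and>
    has_euler_char 1 (subtopology M (\<Union>FS \<union> (\<Union>e\<in>A. e - pverts G))) (int (card FS) - int (card A))"
  using assms
proof (induction A)
  case empty
  have "has_euler_char 1 (subtopology M (\<Union>FS)) (int (card FS))"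
    using euler_char_faces[OF finite_faces] has_euler_char_mono by fastforce
  then show ?case using openin_face by auto
next
  case (insert e A)
  let ?X = "\<Union>FS \<union> (\<Union>e\<in>A. e - pverts G)"
  have e: "e \<in> edges" and X: "openin M ?X" "has_euler_char (0 + 1) (subtopology M ?X) (int (card FS) - int (card A))"
    using insert by auto
  obtain N where N: "openin M N" "e - pverts G \<subseteq> N" "N \<subseteq> (e - pverts G) \<union> \<Union>FS"
    "has_euler_char 0 (subtopology M N) 1" "has_euler_char 0 (subtopology M (N - (e - pverts G))) 2"
    using tube_neighbourhood[OF e] by metis
  have "e' \<inter> e \<subseteq> pverts G" if "e' \<in> A" for e'
    using edges_Int[of e' e] e insert that by blast
  moreover have "e \<inter> F = {}" if "F \<in> FS" for F using face_GP[OF that] GP_eq e by blast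
  ultimately have disj: "(e - pverts G) \<inter> ?X = {}" by blast
  have eq: "?X \<union> N = ?X \<union> (e - pverts G)" using N by blast
  have "has_euler_char (0 + 1) (subtopology M (?X \<union> N)) (int (card FS) - int (card A) + 1 - 2)"
    by (rule has_euler_char_union_step[OF X(1) N(1) eq N(2) disj X(2) _ N(5)]) (rule has_euler_char_mono[OF N(4)], simp)
  moreover have "?X \<union> N = \<Union>FS \<union> (\<Union>e\<in>insert e A. e - pverts G)" unfolding eq by blast
  moreover have "openin M (?X \<union> N)" using X(1) N(1) by (rule openin_Un)
  ultimately show ?case using insert by (simp add: diff_diff_eq add.commute)
qed

text \<open>The start is the surface without its vertices, which is the union of faces and open
  edges. Each vertex then contributes 1 for a disc and 0 for the punctured disc.\<close>

lemma euler_char_verts: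
  assumes "finite A" "A \<subseteq> pverts G"
  shows "has_euler_char 2 (subtopology M (topspace M - (pverts G - A))) (int (card FS) - int (card edges) + int (card A))"
  using assms
proof (induction A)
  case empty
  have "\<Union>FS \<union> (\<Union>e\<in>edges. e - pverts G) = topspace M - pverts G"
    unfolding Union_faces using GP_eq GP_sub verts_GP by blast
  then have "has_euler_char 1 (subtopology M (topspace M - pverts G)) (int (card FS) - int (card edges))"
    using euler_char_edges[OF finite_edges] by simp
  then show ?case using has_euler_char_mono by fastforce
next
  case (insert v A)
  let ?X = "topspace M - (pverts G - A)"
  have fin: "openin M (topspace M - B)" if "B \<subseteq> pverts G" for B
  proof -
    have "closedin M B"
      using that finite_verts verts_sub hausdorff
      by (meson closedin_Hausdorff_finite finite_subset subset_trans)
    then show ?thesis by (rule openin_diff[OF openin_topspace])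
  qed
  have v: "v \<in> pverts G" "v \<in> topspace M - (pverts G - {v})" using insert verts_sub by auto
  obtain \<psi> :: "complex \<Rightarrow> 'a" where \<psi>: "continuous_map (top_of_set (ball 0 1)) M \<psi>" "inj_on \<psi> (ball 0 1)"
    "\<psi> 0 = v" "\<psi> ` ball 0 1 \<subseteq> topspace M - (pverts G - {v})"
    using surface_disc_chart[OF surface fin v(2)] by blast
  let ?N = "\<psi> ` ball 0 1"
  have N: "openin M ?N" by (rule surface_invariance_of_domain[OF surface open_ball \<psi>(1,2)])
  have vN: "{v} \<subseteq> ?N" using \<psi>(3) by (metis centre_in_ball empty_subsetI image_eqI insert_subset zero_less_one)
  have Nv: "?N - {v} = \<psi> ` (ball 0 1 - {0})" using \<psi>(2,3) by (auto simp: inj_on_def)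
  have "has_euler_char 0 (top_of_set (ball (0::complex) 1)) 1" by (intro has_euler_char_convex) auto
  then have "has_euler_char 2 (top_of_set (ball (0::complex) 1)) 1" using has_euler_char_mono by fastforce
  then have N1: "has_euler_char 2 (subtopology M ?N) 1"
    using has_euler_char_homeomorphic surface_open_embedding[OF surface open_ball \<psi>(1,2)] by blast
  have N2: "has_euler_char 1 (subtopology M (?N - {v})) 0"
    unfolding Nv using has_euler_char_homeomorphic surface_open_embedding[OF surface open_ball \<psi>(1,2)]
      has_euler_char_punctured_disc by blast
  have eq: "?X \<union> ?N = ?X \<union> {v}" "?X \<union> {v} = topspace M - (pverts G - insert v A)" "{v} \<inter> ?X = {}"
    using \<psi>(4) vN v insert by auto
  have "has_euler_char (1 + 1) (subtopology M (?X \<union> ?N)) (int (card FS) - int (card edges) + int (card A) + 1 - 0)"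
    by (rule has_euler_char_union_step[OF _ N eq(1) vN eq(3)]) (use insert fin N1 N2 in auto)
  then show ?case using insert unfolding eq by (simp add: algebra_simps)
qed

theorem euler_formula:
  "euler_characteristic M = int (card (pverts G)) - int (card edges) + int (card FS)"
  using euler_characteristic_eq[of M] euler_char_verts[OF finite_verts subset_refl] by simp

end


section \<open>Corners\<close>

lemma image_mset_as_sum: "finite A \<Longrightarrow> image_mset f (mset_set A) = (\<Sum>a\<in>A. {#f a#})"
  by (induction A rule: finite_induct) auto

lemma sum_singleton_mset: "finite A \<Longrightarrow> (\<Sum>a\<in>A. {#k#}) = replicate_mset (card A) k"
  by (induction A rule: finite_induct) auto

context surface_map
begin

text \<open>A dart also stands for the corner of its face at the start of the dart, which lies between the
  dart and its predecessor on the facial walk.\<close>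

definition prev_dart :: "'a set \<times> nat \<Rightarrow> 'a set \<times> nat" where
  "prev_dart d = (fst d, if snd d = 0 then fdeg (fst d) - 1 else snd d - 1)"

definition dart_start :: "'a set \<times> nat \<Rightarrow> 'a" where "dart_start d = fst (walk (fst d) ! snd d)"
definition dart_end :: "'a set \<times> nat \<Rightarrow> 'a" where "dart_end d = snd (walk (fst d) ! snd d)"

definition corners :: "'a \<Rightarrow> ('a set \<times> nat) set" where
  "corners v = {d \<in> darts. dart_start d = v}"

definition corner_edges :: "'a set \<times> nat \<Rightarrow> 'a set set" where
  "corner_edges d = {dart_edge d, dart_edge (prev_dart d)}"

lemma prev_dart_in: "d \<in> darts \<Longrightarrow> prev_dart d \<in> darts"
  by (auto simp: darts_def prev_dart_def)

lemma fst_prev_dart [simp]: "fst (prev_dart d) = fst d"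
  by (simp add: prev_dart_def)

lemma page_prev:
  assumes "d \<in> darts" shows "page (prev_dart d) z = page d (z - 1)"
proof -
  have n: "snd d < fdeg (fst d)" using assms by (auto simp: darts_def)
  show ?thesis
  proof (cases "snd d = 0")
    case True
    then have "polar (fdeg (fst d)) (of_nat (fdeg (fst d) - 1) + z) = polar (fdeg (fst d)) (of_nat (snd d) + (z - 1))"
      using n by (intro polar_periodic[of _ _ _ 1]) (auto simp: of_nat_diff)
    then show ?thesis using True by (simp add: page_def prev_dart_def)
  next
    case False
    then show ?thesis using n by (simp add: page_def prev_dart_def of_nat_diff algebra_simps)
  qed
qed

lemma dart_end_prev: "d \<in> darts \<Longrightarrow> dart_end (prev_dart d) = dart_start d"
  using page_prev[of d 1] page_edge(4)[OF prev_dart_in] page_edge(3)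
  by (simp add: dart_end_def dart_start_def)

lemma page_start: "d \<in> darts \<Longrightarrow> page d 0 = dart_start d"
  using page_edge(3) by (simp add: dart_start_def)

lemma dart_start_neq_end: "d \<in> darts \<Longrightarrow> dart_start d \<noteq> dart_end d"
  using arcs_neq dart_arc by (cases d) (auto simp: dart_start_def dart_end_def)

lemma dart_ends_in: "d \<in> darts \<Longrightarrow> dart_start d \<in> pverts G \<and> dart_end d \<in> pverts G"
  using arcs_wf dart_arc by (cases d) (auto simp: dart_start_def dart_end_def)

lemma dart_edge_verts: "d \<in> darts \<Longrightarrow> dart_edge d \<inter> pverts G = {dart_start d, dart_end d}"
  using edge_verts dart_arc by (cases d) (auto simp: dart_start_def dart_end_def dart_edge_def)

lemma dart_edge_eq_iff:
  assumes "d \<in> darts" "d' \<in> darts"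
  shows "dart_edge d = dart_edge d' \<longleftrightarrow> {dart_start d, dart_end d} = {dart_start d', dart_end d'}"
  using edge_eq_iff[OF dart_arc dart_arc, of "fst d" "snd d" "fst d'" "snd d'"] assms
  by (simp add: dart_start_def dart_end_def dart_edge_def)

lemma inj_on_prev_dart: "inj_on prev_dart darts"
proof (rule inj_onI)
  fix c d assume c: "c \<in> darts" "d \<in> darts" "prev_dart c = prev_dart d"
  then have f: "fst c = fst d" and s: "(if snd c = 0 then fdeg (fst d) - 1 else snd c - 1) = (if snd d = 0 then fdeg (fst d) - 1 else snd d - 1)"
    by (auto simp: prev_dart_def)
  have "snd c < fdeg (fst d)" "snd d < fdeg (fst d)" using c f by (auto simp: darts_def)
  then have "snd c = snd d" using s by (auto split: if_splits)
  then show "c = d" using f by (simp add: prod_eq_iff)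
qed

lemma prev_dart_image: "prev_dart ` darts = darts"
  using endo_inj_surj[OF finite_darts _ inj_on_prev_dart] prev_dart_in by blast

text \<open>At a fixed vertex a dart cannot be both outgoing and incoming, since there are no loops;
  in either role it determines its corner.\<close>

lemma corner_unique:
  assumes "b \<in> corners x" "c \<in> corners x" "d \<in> {b, prev_dart b}" "d \<in> {c, prev_dart c}"
  shows "b = c"
proof -
  have *: "b \<in> darts" "c \<in> darts" "dart_start b = x" "dart_start c = x" using assms by (auto simp: corners_def)
  have "b \<noteq> prev_dart c" if "b \<in> darts" "c \<in> darts" "dart_start b = x" "dart_start c = x" for b c
    using dart_end_prev[OF that(2)] dart_start_neq_end[OF prev_dart_in[OF that(2)]] that by auto
  then have "b \<noteq> prev_dart c" "c \<noteq> prev_dart b" using * by auto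
  then show ?thesis using assms(3,4) inj_onD[OF inj_on_prev_dart, of b c] * by auto
qed

section \<open>The surface near a vertex\<close>

lemma point_of_face:
  assumes "y \<in> topspace M" obtains F w where "F \<in> FS" "norm w \<le> 1" "y = face_map F w"
proof (cases "y \<in> GP")
  case True
  then obtain e where e: "e \<in> edges" "y \<in> e" using GP_eq by blast
  then have "darts_on e \<noteq> {}" using card_darts_on by force
  then obtain d where d: "d \<in> darts" "dart_edge d = e" by (auto simp: darts_on_def)
  have "y \<in> (\<lambda>t. page d (of_real t)) ` {0..1}" using page_edge(2)[OF d(1)] e d by simp
  then obtain t where "y = page d (of_real t)" by blast
  moreover have "norm (polar (fdeg (fst d)) (of_nat (snd d) + of_real t)) \<le> 1" by (simp add: norm_polar)
  moreover have "fst d \<in> FS" using d by (auto simp: darts_def)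
  ultimately show ?thesis using that unfolding page_def by blast
next
  case False
  then obtain F where F: "F \<in> FS" "y \<in> F" using assms Union_faces by blast
  then have "y \<in> face_map F ` ball 0 1" using face_map_ball(1) by simp
  then obtain w where "w \<in> ball 0 1" "y = face_map F w" by blast
  then show ?thesis using that[OF F(1), of w] by auto
qed

lemma page_approach:
  assumes d: "d \<in> darts" and N: "openin M N" "page d 0 \<in> N"
  obtains r where "0 < r" "r \<le> 1/3" "page d (\<i> * of_real r) \<in> N"
proof -
  define S where "S = {z. 0 \<le> Im z \<and> Im z \<le> 1}"
  have "openin (top_of_set S) {z \<in> S. page d z \<in> N}"
    using openin_continuous_map_preimage[OF page_continuous[OF d] N(1)] by (simp add: S_def)
  then obtain T where T: "open T" "{z \<in> S. page d z \<in> N} = S \<inter> T" by (auto simp: openin_open)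
  have "0 \<in> {z \<in> S. page d z \<in> N}" using N(2) by (simp add: S_def)
  then have "0 \<in> T" unfolding T(2) by blast
  then obtain r where r: "r > 0" "ball 0 r \<subseteq> T" using T(1) open_contains_ball_eq by metis
  define q where "q = min (r/2) (1/3)"
  have q: "0 < q" "q \<le> 1/3" "q < r" using r(1) by (auto simp: q_def)
  then have "\<i> * of_real q \<in> ball 0 r" by (simp add: norm_mult)
  then have "\<i> * of_real q \<in> S \<inter> T" using r(2) q by (auto simp: S_def)
  then have "page d (\<i> * of_real q) \<in> N" unfolding T(2)[symmetric] by simp
  then show ?thesis using that q by blast
qed

text \<open>Negative real parts reach back along the previous dart, so the rectangle touches both
  edges of the corner. The half-width 1/3 keeps positions in two patches less than 1 apart once the
  integer indices are removed, which separates different corners of one face.\<close>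

definition patch_domain :: "complex set" where
  "patch_domain = {z. - 1/3 \<le> Re z \<and> Re z \<le> 1/3 \<and> 0 \<le> Im z \<and> Im z \<le> 1/3}"

lemma patch_edge:
  assumes d: "d \<in> darts" and z: "z \<in> patch_domain" "Im z = 0"
  obtains e where "e \<in> corner_edges d" "page d z \<in> e" "page d z \<in> pverts G \<longrightarrow> z = 0"
proof (cases "Re z \<ge> 0")
  case True
  have eq: "z = of_real (Re z)" using z by (simp add: complex_eq_iff)
  have "page d z \<in> dart_edge d" using page_in_edge[OF d True] z eq by (simp add: patch_domain_def)
  moreover have "page d z \<in> pverts G \<longrightarrow> z = 0"
    using page_vertex_iff[OF d True] z eq by (auto simp: patch_domain_def complex_eq_iff)
  ultimately show ?thesis using that[of "dart_edge d"] by (simp add: corner_edges_def)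
next
  case False
  define t where "t = 1 + Re z"
  have t: "0 < t" "t < 1" using False z by (auto simp: t_def patch_domain_def)
  have "z = of_real t - 1" using z by (simp add: complex_eq_iff t_def)
  then have eq: "page d z = page (prev_dart d) (of_real t)" using page_prev[OF d] by simp
  have "page d z \<in> dart_edge (prev_dart d)" unfolding eq using page_in_edge[OF prev_dart_in[OF d]] t by simp
  moreover have "page d z \<notin> pverts G" unfolding eq using page_vertex_iff[OF prev_dart_in[OF d], of t] t by simp
  ultimately show ?thesis using that[of "dart_edge (prev_dart d)"] by (simp add: corner_edges_def)
qed

lemma corner_edges_sub: "d \<in> darts \<Longrightarrow> corner_edges d \<subseteq> edges"
  using dart_edge_in prev_dart_in by (auto simp: corner_edges_def)

text \<open>On the graph, different edges meet only in vertices, and the only vertex in a patch is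
  its centre. Off the graph both points lie in one face, and their darts would have the same
  index.\<close>

lemma patch_Int:
  assumes d: "d \<in> corners v" "d' \<in> corners v" "d \<noteq> d'" and disj: "corner_edges d \<inter> corner_edges d' = {}"
    and z: "z \<in> patch_domain" "w \<in> patch_domain" and eq: "page d z = page d' w"
  shows "page d z = v"
proof -
  have dd: "d \<in> darts" "d' \<in> darts" "page d 0 = v" using d page_start by (auto simp: corners_def)
  have F: "fst d \<in> FS" "fst d' \<in> FS" using dd by (auto simp: darts_def)
  have zb: "0 \<le> Im z" "Im z \<le> 1" "0 \<le> Im w" "Im w \<le> 1" using z by (auto simp: patch_domain_def)
  have on: "page d z \<in> GP" if pz: "d \<in> darts" "z \<in> patch_domain" "Im z = 0" for d z
  proof -
    obtain e where "e \<in> corner_edges d" "page d z \<in> e" using patch_edge[OF pz] by metis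
    then show ?thesis using GP_eq corner_edges_sub[OF pz(1)] by blast
  qed
  have off: "page d z \<in> fst d" "page d z \<notin> GP" if "d \<in> darts" "0 < Im z" "Im z \<le> 1" for d z
  proof -
    have "fst d \<in> FS" using that by (auto simp: darts_def)
    then show "page d z \<in> fst d" "page d z \<notin> GP" using page_face[OF that] face_GP by auto
  qed
  consider "Im z = 0" "Im w = 0" | "0 < Im z" "0 < Im w"
    using on[OF dd(1) z(1)] on[OF dd(2) z(2)] off(2)[OF dd(1), of z] off(2)[OF dd(2), of w] eq zb by fastforce
  then show ?thesis
  proof cases
    case 1
    obtain e where e: "e \<in> corner_edges d" "page d z \<in> e" "page d z \<in> pverts G \<longrightarrow> z = 0"
      using patch_edge[OF dd(1) z(1) 1(1)] by metis
    obtain e' where e': "e' \<in> corner_edges d'" "page d' w \<in> e'"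
      using patch_edge[OF dd(2) z(2) 1(2)] by metis
    have "e \<noteq> e'" using e e' disj by blast
    then have "page d z \<in> pverts G"
      using edges_Int[of e e'] e e' eq corner_edges_sub dd by (metis IntI subsetD)
    then show ?thesis using e(3) dd(3) by simp
  next
    case 2
    have same: "fst d' = fst d"
      using faces_disjoint[OF F(2,1)] off(1)[OF dd(1) 2(1) zb(2)] off(1)[OF dd(2) 2(2) zb(4)] eq by simp
    let ?n = "fdeg (fst d)"
    have "polar ?n (of_nat (snd d) + z) \<in> ball 0 1" "polar ?n (of_nat (snd d') + w) \<in> ball 0 1"
      using 2 zb by (auto simp: norm_polar)
    then have eq2: "polar ?n (of_nat (snd d) + z) = polar ?n (of_nat (snd d') + w)"
      using face_map_ball(2)[OF F(1)] eq same unfolding page_def inj_on_def by auto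
    obtain k :: int where k: "(real (snd d) + Re z) - (real (snd d') + Re w) = of_int k * real ?n"
      using polar_eqD(2)[OF eq2] fdeg_pos[OF F(1)] z by (auto simp: patch_domain_def)
    have "\<bar>Re z - Re w\<bar> < 1" using z by (auto simp: patch_domain_def)
    moreover have "Re z - Re w = of_int (k * int ?n + int (snd d') - int (snd d))" using k by simp
    ultimately have "k * int ?n + int (snd d') - int (snd d) = 0" by linarith
    then have k': "int (snd d) - int (snd d') = k * int ?n" by simp
    have lt: "snd d < ?n" "snd d' < ?n" using dd same by (auto simp: darts_def)
    then have "\<bar>k * int ?n\<bar> < 1 * int ?n" using k' by linarith
    then have "\<bar>k\<bar> * int ?n < 1 * int ?n" by (simp add: abs_mult)
    then have "\<bar>k\<bar> < 1" using fdeg_pos[OF F(1)] by (simp only: mult_less_cancel_right_pos of_nat_0_less_iff)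
    then have "snd d = snd d'" using k' by simp
    then show ?thesis using same d(3) by (simp add: prod_eq_iff)
  qed
qed

text \<open>The same construction as for \<open>D\<close> in \<open>card_darts_on\<close>, with
  sectors centred at the corners instead of sectors spanning an edge.\<close>

lemma vertex_neighbourhood:
  assumes v: "v \<in> pverts G"
  obtains W where "openin M W" "v \<in> W" "\<And>y. y \<in> W \<Longrightarrow> \<exists>d\<in>corners v. y \<in> page d ` patch_domain"
proof -
  define L where "L F = (\<Inter>i\<in>{i. i < fdeg F \<and> dart_start (F, i) = v}. off_sector F (real i - 1/3) (real i + 1/3) (1/3))" for F
  define W where "W = topspace M - (\<Union>F\<in>FS. face_map F ` (cball 0 1 \<inter> L F))"
  have "openin M W" unfolding W_def
    by (rule openin_avoiding) (auto simp: L_def intro!: closed_INT closed_off_sector)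
  moreover have "v \<in> W"
  proof -
    have "v \<notin> face_map F ` (cball 0 1 \<inter> L F)" if F: "F \<in> FS" for F
    proof
      assume "v \<in> face_map F ` (cball 0 1 \<inter> L F)"
      then obtain w where w: "norm w \<le> 1" "w \<in> L F" "face_map F w = v" by auto
      have "v \<notin> F" using v verts_GP face_GP[OF F] by blast
      then have "w \<notin> ball 0 1" using face_map_ball(1)[OF F] w(3) by blast
      then have "norm w = 1" using w(1) by simp
      then obtain i t where it: "i < fdeg F" "0 \<le> t" "t < 1" "w = polar (fdeg F) (of_nat i + of_real t)"
        "face_map F w = page (F, i) (of_real t)" using face_map_sphere[OF F] by metis
      have d: "(F, i) \<in> darts" using F it by (simp add: darts_def)
      have "t = 0" using page_vertex_iff[OF d, of t] it w(3) v by auto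
      then have "dart_start (F, i) = v" using page_start[OF d] it w(3) by simp
      moreover have "w \<notin> off_sector F (real i - 1/3) (real i + 1/3) (1/3)"
        unfolding it(4) by (rule off_sectorI[OF F]) (use \<open>t = 0\<close> in auto)
      ultimately show False using w(2) it unfolding L_def by blast
    qed
    then show ?thesis using v verts_sub unfolding W_def by blast
  qed
  moreover have "\<exists>d\<in>corners v. y \<in> page d ` patch_domain" if y: "y \<in> W" for y
  proof -
    have "y \<in> topspace M" using y by (simp add: W_def)
    then obtain F w where w: "F \<in> FS" "norm w \<le> 1" "y = face_map F w" using point_of_face by metis
    then have "w \<notin> L F" using y unfolding W_def by force
    then obtain i where i: "i < fdeg F" "dart_start (F, i) = v" "w \<notin> off_sector F (real i - 1/3) (real i + 1/3) (1/3)"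
      unfolding L_def by blast
    obtain u where u: "polar (fdeg F) u = w" "real i - 1/3 \<le> Re u" "Re u < real i + 1/3" "0 \<le> Im u" "Im u < 1/3"
      using off_sectorE[OF w(1,2) i(3)] by metis
    have "y = page (F, i) (u - of_nat i)" using u(1) w(3) by (simp add: page_def)
    moreover have "u - of_nat i \<in> patch_domain" using u by (simp add: patch_domain_def)
    moreover have "(F, i) \<in> corners v" using w(1) i by (simp add: corners_def darts_def)
    ultimately show ?thesis by blast
  qed
  ultimately show ?thesis using that by blast
qed

text \<open>A punctured disc about a vertex is connected, so the corners at the vertex cannot be split
  into two classes that share no edge.\<close>

lemma vertex_connected:
  assumes v: "v \<in> pverts G" and S: "S \<subseteq> corners v" "S \<noteq> {}" "S \<noteq> corners v"
  shows "\<exists>c\<in>S. \<exists>c'\<in>corners v - S. corner_edges c \<inter> corner_edges c' \<noteq> {}"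
proof (rule ccontr)
  assume no: "\<not> ?thesis"
  have fin: "finite (corners v)" using finite_darts by (simp add: corners_def)
  have closedK: "closedin M (\<Union>d\<in>B. page d ` patch_domain)" if "B \<subseteq> corners v" for B
  proof -
    have "closedin M (page d ` patch_domain)" if "d \<in> corners v" for d
    proof -
      have d: "d \<in> darts" using that by (simp add: corners_def)
      have "compactin (top_of_set {z. 0 \<le> Im z \<and> Im z \<le> 1}) patch_domain"
        using compact_rectangle[of "-1/3" "1/3" 0 "1/3"] by (auto simp: compactin_subtopology patch_domain_def)
      then show ?thesis
        using image_compactin[OF _ page_continuous[OF d]] compactin_imp_closedin[OF hausdorff] by blast
    qed
    then show ?thesis using fin that by (intro closedin_Union) (auto intro: finite_subset)
  qed
  let ?K1 = "\<Union>d\<in>S. page d ` patch_domain" and ?K2 = "\<Union>d\<in>corners v - S. page d ` patch_domain"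
  \<comment> \<open>Two closed sets that meet only in \<open>v\<close> and cover a neighbourhood of
    it would disconnect the punctured disc.\<close>
  have K12: "?K1 \<inter> ?K2 \<subseteq> {v}"
  proof
    fix y assume "y \<in> ?K1 \<inter> ?K2"
    then obtain d d' z w where *: "d \<in> S" "d' \<in> corners v - S" "z \<in> patch_domain" "w \<in> patch_domain"
      "y = page d z" "y = page d' w" by blast
    have "page d z = v"
      by (rule patch_Int[of d v d' z w]) (use * S(1) no in auto)
    then show "y \<in> {v}" using * by simp
  qed
  obtain W where W: "openin M W" "v \<in> W" "\<And>y. y \<in> W \<Longrightarrow> \<exists>d\<in>corners v. y \<in> page d ` patch_domain"
    using vertex_neighbourhood[OF v] by metis
  obtain \<psi> :: "complex \<Rightarrow> 'a" where \<psi>: "continuous_map (top_of_set (ball 0 1)) M \<psi>" "inj_on \<psi> (ball 0 1)"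
    "\<psi> 0 = v" "\<psi> ` ball 0 1 \<subseteq> W"
    using surface_disc_chart[OF surface W(1,2)] by blast
  have N: "openin M (\<psi> ` ball 0 1)" by (rule surface_invariance_of_domain[OF surface open_ball \<psi>(1,2)])
  have vN: "v \<in> \<psi> ` ball 0 1" using \<psi>(3) by (metis centre_in_ball image_eqI zero_less_one)
  let ?P = "\<psi> ` (ball 0 1 - {0})"
  have P: "?P = \<psi> ` ball 0 1 - {v}" using \<psi>(2,3) by (auto simp: inj_on_def)
  have "connectedin (top_of_set (ball (0::complex) 1)) (ball 0 1 - {0})"
    by (simp add: connectedin_subtopology connected_punctured_ball)
  then have con: "connectedin M ?P" using connectedin_continuous_map_image[OF \<psi>(1)] by blast
  \<comment> \<open>Neither part of the separation is empty: points of a patch at small positive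
    height are in the disc but differ from \<open>v\<close>.\<close>
  have meets: "page d ` patch_domain \<inter> ?P \<noteq> {}" if d: "d \<in> corners v" for d
  proof -
    have dd: "d \<in> darts" "page d 0 = v" using d page_start by (auto simp: corners_def)
    then obtain r where r: "0 < r" "r \<le> 1/3" "page d (\<i> * of_real r) \<in> \<psi> ` ball 0 1"
      using page_approach[OF dd(1) N] vN by metis
    have "page d (\<i> * of_real r) \<in> fst d" using page_face[OF dd(1)] r by simp
    moreover have "fst d \<in> FS" using dd(1) by (auto simp: darts_def)
    ultimately have "page d (\<i> * of_real r) \<noteq> v" using face_GP verts_GP v by blast
    moreover have "\<i> * of_real r \<in> patch_domain" using r by (simp add: patch_domain_def)
    ultimately show ?thesis using r(3) unfolding P by blast
  qed
  have "?P \<subseteq> ?K1 \<union> ?K2"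
  proof
    fix y assume "y \<in> ?P"
    then have "y \<in> W" using \<psi>(4) by auto
    then obtain d where "d \<in> corners v" "y \<in> page d ` patch_domain" using W(3) by metis
    then show "y \<in> ?K1 \<union> ?K2" by (cases "d \<in> S") auto
  qed
  moreover have "?K1 \<inter> ?K2 \<inter> ?P = {}" using K12 unfolding P by blast
  moreover have "(\<Union>d\<in>B. page d ` patch_domain) \<inter> ?P \<noteq> {}" if B: "B \<subseteq> corners v" "B \<noteq> {}" for B
  proof -
    obtain d where d: "d \<in> B" using B(2) by blast
    then have "page d ` patch_domain \<inter> ?P \<noteq> {}" using B(1) by (intro meets) auto
    then show ?thesis using d by blast
  qed
  then have "?K1 \<inter> ?P \<noteq> {}" "?K2 \<inter> ?P \<noteq> {}" using S by simp_all
  moreover have "closedin M ?K1" "closedin M ?K2" using closedK S by auto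
  ultimately show False using con unfolding connectedin_closedin by blast
qed

section \<open>Combinatorics of corners\<close>

definition opp :: "'a set \<times> nat \<Rightarrow> 'a set \<times> nat" where
  "opp d = (THE d'. d' \<in> darts_on (dart_edge d) \<and> d' \<noteq> d)"

lemma opp:
  assumes d: "d \<in> darts"
  shows "opp d \<in> darts" "opp d \<noteq> d" "dart_edge (opp d) = dart_edge d" "darts_on (dart_edge d) = {d, opp d}"
proof -
  have dd: "d \<in> darts_on (dart_edge d)" using d by (simp add: darts_on_def)
  obtain x y where xy: "darts_on (dart_edge d) = {x, y}" "x \<noteq> y"
    using card_darts_on[OF dart_edge_in[OF d]] card_2_iff by metis
  define d' where "d' = (if d = x then y else x)"
  have d': "darts_on (dart_edge d) = {d, d'}" "d' \<noteq> d" using dd xy unfolding xy(1) d'_def by auto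
  have "opp d = d'" unfolding opp_def by (rule the_equality) (use d' in auto)
  then show "darts_on (dart_edge d) = {d, opp d}" "opp d \<noteq> d" using d' by auto
  then have "opp d \<in> darts_on (dart_edge d)" by blast
  then show "opp d \<in> darts" "dart_edge (opp d) = dart_edge d" by (auto simp: darts_on_def)
qed

lemma finite_corners: "finite (corners v)"
  using finite_darts by (simp add: corners_def)

text \<open>Double counting of the darts that touch \<open>v\<close>: each edge at \<open>v\<close>
  carries two, and each corner accounts for one leaving and one entering dart.\<close>

lemma card_corners:
  assumes v: "v \<in> pverts G" shows "card (corners v) = vertex_degree G v"
proof -
  let ?A = "{a \<in> parcs G. fst a = v}"
  have sub: "corners v \<subseteq> darts" by (auto simp: corners_def)
  have ends: "prev_dart ` corners v = {d \<in> darts. dart_end d = v}"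
  proof
    show "prev_dart ` corners v \<subseteq> {d \<in> darts. dart_end d = v}"
      using prev_dart_in dart_end_prev by (auto simp: corners_def)
    show "{d \<in> darts. dart_end d = v} \<subseteq> prev_dart ` corners v"
    proof
      fix d assume d: "d \<in> {d \<in> darts. dart_end d = v}"
      then obtain c where "c \<in> darts" "prev_dart c = d" using prev_dart_image by (metis (no_types, lifting) imageE mem_Collect_eq)
      moreover from this have "c \<in> corners v" using d dart_end_prev[of c] by (simp add: corners_def)
      ultimately show "d \<in> prev_dart ` corners v" by blast
    qed
  qed
  have "corners v \<inter> prev_dart ` corners v = {}"
  proof (rule equals0I)
    fix d assume "d \<in> corners v \<inter> prev_dart ` corners v"
    then have "d \<in> darts" "dart_start d = v" "dart_end d = v" unfolding ends by (simp_all add: corners_def)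
    then show False using dart_start_neq_end[of d] by simp
  qed
  then have "card (corners v \<union> prev_dart ` corners v) = card (corners v) + card (prev_dart ` corners v)"
    using finite_corners by (simp add: card_Un_disjoint)
  also have "card (prev_dart ` corners v) = card (corners v)"
    using inj_on_subset[OF inj_on_prev_dart sub] by (rule card_image)
  finally have 1: "card (corners v \<union> prev_dart ` corners v) = 2 * card (corners v)" by simp
  have "corners v \<union> prev_dart ` corners v = (\<Union>e\<in>\<gamma> ` ?A. darts_on e)"
  proof -
    have mem: "d \<in> (\<Union>e\<in>\<gamma> ` ?A. darts_on e) \<longleftrightarrow> d \<in> darts \<and> (dart_start d = v \<or> dart_end d = v)" for d
    proof
      assume "d \<in> (\<Union>e\<in>\<gamma> ` ?A. darts_on e)"
      then obtain a where a: "a \<in> parcs G" "fst a = v" "d \<in> darts" "dart_edge d = \<gamma> a" by (auto simp: darts_on_def)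
      then have "v \<in> dart_edge d \<inter> pverts G" using edge_verts[OF a(1)] v by auto
      then show "d \<in> darts \<and> (dart_start d = v \<or> dart_end d = v)"
        using a(3) unfolding dart_edge_verts[OF a(3)] by auto
    next
      assume d: "d \<in> darts \<and> (dart_start d = v \<or> dart_end d = v)"
      then have arc: "(dart_start d, dart_end d) \<in> parcs G" and g: "dart_edge d = \<gamma> (dart_start d, dart_end d)"
        using dart_arc[of "fst d" "snd d"] by (auto simp: dart_start_def dart_end_def dart_edge_def)
      have "dart_edge d \<in> \<gamma> ` ?A"
      proof (cases "dart_start d = v")
        case True then show ?thesis using arc g by force
      next
        case False
        then have "dart_end d = v" using d by blast
        then show ?thesis using arcs_sym[OF arc] edge_rev[OF arc] g
          by (intro image_eqI[of _ _ "(dart_end d, dart_start d)"]) auto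
      qed
      then show "d \<in> (\<Union>e\<in>\<gamma> ` ?A. darts_on e)" using d by (auto simp: darts_on_def)
    qed
    show ?thesis
    proof (rule Set.set_eqI)
      fix d
      show "d \<in> corners v \<union> prev_dart ` corners v \<longleftrightarrow> d \<in> (\<Union>e\<in>\<gamma> ` ?A. darts_on e)"
        unfolding mem ends by (auto simp: corners_def)
    qed
  qed
  moreover have "card (\<Union>e\<in>\<gamma> ` ?A. darts_on e) = (\<Sum>e\<in>\<gamma> ` ?A. card (darts_on e))"
    using finite_arcs darts_on_le_2 by (intro card_UN_disjoint) (auto simp: darts_on_def)
  moreover have "(\<Sum>e\<in>\<gamma> ` ?A. card (darts_on e)) = (\<Sum>e\<in>\<gamma> ` ?A. 2)"
    by (intro sum.cong) (auto simp: edges_def intro!: card_darts_on)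
  moreover have "card (\<gamma> ` ?A) = card ?A"
  proof (rule card_image, rule inj_onI)
    fix a b assume ab: "a \<in> ?A" "b \<in> ?A" "\<gamma> a = \<gamma> b"
    then have "{fst a, snd a} = {fst b, snd b}" using edge_eq_iff by blast
    then show "a = b" using ab arcs_neq by (auto simp: prod_eq_iff doubleton_eq_iff)
  qed
  moreover have "vertex_degree G v = card ?A"
    by (simp add: out_degree_def out_arcs_def)
  ultimately show ?thesis using 1 by simp
qed

text \<open>In a simple graph both sides of a digon are the same edge, and a single corner uses up
  both of its darts. That corner would be a class of its own, against
  \<open>vertex_connected\<close> at a vertex of degree at least 3.\<close>

lemma fdeg_ge_3:
  assumes F: "F \<in> FS" shows "fdeg F \<ge> 3"
proof (rule ccontr)
  assume "\<not> fdeg F \<ge> 3"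
  then have n: "fdeg F = 2" using fdeg_ge_2[OF F] by linarith
  define c where "c = (F, 0::nat)"
  have c: "c \<in> darts" using F n by (simp add: c_def darts_def)
  have pp: "prev_dart (prev_dart c) = c" "prev_dart c \<noteq> c" using n by (simp_all add: c_def prev_dart_def)
  have "dart_end c = dart_start (prev_dart c)" using dart_end_prev[OF prev_dart_in[OF c]] pp by simp
  then have e: "dart_edge (prev_dart c) = dart_edge c"
    using dart_edge_eq_iff[OF prev_dart_in[OF c] c] dart_end_prev[OF c] by auto
  have on: "darts_on (dart_edge c) = {c, prev_dart c}"
  proof -
    have "prev_dart c \<in> darts_on (dart_edge c)" using e prev_dart_in[OF c] by (simp add: darts_on_def)
    then show ?thesis using opp(4)[OF c] pp by auto
  qed
  let ?x = "dart_start c"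
  have x: "?x \<in> pverts G" using dart_ends_in[OF c] by blast
  have cx: "c \<in> corners ?x" using c by (simp add: corners_def)
  have "{c} \<noteq> corners ?x"
  proof
    assume "{c} = corners ?x"
    then have "card (corners ?x) = 1" by (metis card_1_singleton_iff One_nat_def)
    then show False using card_corners[OF x] degree_ge_3[OF x] by simp
  qed
  then obtain b where b: "b \<in> corners ?x - {c}" "corner_edges c \<inter> corner_edges b \<noteq> {}"
    using vertex_connected[OF x, of "{c}"] cx by auto
  have bd: "b \<in> darts" using b by (simp add: corners_def)
  have "dart_edge b = dart_edge c \<or> dart_edge (prev_dart b) = dart_edge c" using b(2) e by (auto simp: corner_edges_def)
  then have "b \<in> darts_on (dart_edge c) \<or> prev_dart b \<in> darts_on (dart_edge c)"
    using bd prev_dart_in by (auto simp: darts_on_def)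
  then obtain d where d: "d \<in> {b, prev_dart b}" "d \<in> {c, prev_dart c}" unfolding on by blast
  show False using corner_unique[OF _ cx d] b(1) by simp
qed

text \<open>If two sides of a triangle were the same edge, the third side would be a loop.\<close>

lemma triangle_corner_edges:
  assumes c: "c \<in> darts" and n: "fdeg (fst c) = 3"
  shows "dart_edge (prev_dart c) \<noteq> dart_edge c"
proof
  assume e: "dart_edge (prev_dart c) = dart_edge c"
  have lt: "snd c < 3" using c n by (auto simp: darts_def)
  have p3: "prev_dart (prev_dart (prev_dart c)) = c"
    using n lt by (auto simp: prev_dart_def prod_eq_iff)
  have pd: "prev_dart c \<in> darts" "prev_dart (prev_dart c) \<in> darts" using c prev_dart_in by auto
  have "dart_end (prev_dart c) = dart_start c" "dart_end (prev_dart (prev_dart c)) = dart_start (prev_dart c)"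
    "dart_end c = dart_start (prev_dart (prev_dart c))"
    using dart_end_prev[OF c] dart_end_prev[OF pd(1)] dart_end_prev[OF pd(2)] p3 by simp_all
  moreover have "{dart_start (prev_dart c), dart_end (prev_dart c)} = {dart_start c, dart_end c}"
    using e dart_edge_eq_iff[OF pd(1) c] by blast
  ultimately show False using dart_start_neq_end[OF pd(2)] dart_start_neq_end[OF pd(1)] by (auto simp: doubleton_eq_iff)
qed

lemma corner_at_end:
  assumes d: "d \<in> darts" and x: "x \<in> dart_edge d" "x \<in> pverts G"
  obtains c where "c \<in> corners x" "d \<in> {c, prev_dart c}"
proof (cases "dart_start d = x")
  case True
  then show ?thesis using that[of d] d by (simp add: corners_def)
next
  case False
  moreover have "x \<in> {dart_start d, dart_end d}" unfolding dart_edge_verts[OF d, symmetric] using x by blast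
  ultimately have "dart_end d = x" by simp
  moreover obtain c where c: "c \<in> darts" "prev_dart c = d" using prev_dart_image d by (metis imageE)
  ultimately have "c \<in> corners x" using dart_end_prev[OF c(1)] by (simp add: corners_def)
  then show ?thesis using that[of c] c by simp
qed

text \<open>If the darts opposite to both sides of \<open>c\<close> belonged to one corner
  \<open>c1\<close>, then \<open>c\<close> and \<open>c1\<close> would use up all four darts of the
  two edges. No third corner could be linked to them, while the degree is at least 3.\<close>

lemma across_corners:
  assumes x: "x \<in> pverts G" and c: "c \<in> corners x" and ne: "dart_edge (prev_dart c) \<noteq> dart_edge c"
  obtains c1 c2 where "c1 \<in> corners x" "c2 \<in> corners x" "c1 \<noteq> c" "c2 \<noteq> c" "c1 \<noteq> c2"
    "fst c1 = fst (opp (prev_dart c))" "fst c2 = fst (opp c)"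
proof -
  have cd: "c \<in> darts" "dart_start c = x" "prev_dart c \<in> darts" "dart_end (prev_dart c) = x"
    using c prev_dart_in dart_end_prev by (auto simp: corners_def)
  let ?p = "prev_dart c"
  have "x \<in> dart_edge (opp ?p)" "x \<in> dart_edge (opp c)"
    using dart_edge_verts[OF cd(1)] dart_edge_verts[OF cd(3)] opp(3)[OF cd(1)] opp(3)[OF cd(3)] cd by auto
  then obtain c1 c2 where c1: "c1 \<in> corners x" "opp ?p \<in> {c1, prev_dart c1}"
    and c2: "c2 \<in> corners x" "opp c \<in> {c2, prev_dart c2}"
    using corner_at_end[OF opp(1)[OF cd(1)] _ x] corner_at_end[OF opp(1)[OF cd(3)] _ x] by metis
  have "c1 \<noteq> c" using c1(2) opp(2,3)[OF cd(3)] ne by (metis insertE singletonD)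
  moreover have "c2 \<noteq> c" using c2(2) opp(2,3)[OF cd(1)] ne by (metis insertE singletonD)
  moreover have "c1 \<noteq> c2"
  proof
    assume eq: "c1 = c2"
    have ne': "opp ?p \<noteq> opp c" using opp(3)[OF cd(3)] opp(3)[OF cd(1)] ne by auto
    then have *: "{c1, prev_dart c1} = {opp ?p, opp c}" using c1(2) c2(2)[folded eq] by auto
    have ce: "corner_edges c1 = corner_edges c"
    proof -
      have "dart_edge ` {c1, prev_dart c1} = dart_edge ` {opp ?p, opp c}"
        using * by (rule arg_cong)
      then show ?thesis using opp(3)[OF cd(1)] opp(3)[OF cd(3)] by (auto simp: corner_edges_def)
    qed
    have "corners x \<subseteq> {c, c1}"
    proof (rule ccontr)
      assume "\<not> corners x \<subseteq> {c, c1}"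
      then have "{c, c1} \<subseteq> corners x" "{c, c1} \<noteq> {}" "{c, c1} \<noteq> corners x" using c c1 by auto
      from vertex_connected[OF x this]
      obtain a b where ab: "a \<in> {c, c1}" "b \<in> corners x - {c, c1}" "corner_edges a \<inter> corner_edges b \<noteq> {}"
        by (elim bexE)
      then obtain e where e: "e \<in> corner_edges c" "e \<in> corner_edges b" using ce by auto
      have bd: "b \<in> darts" "prev_dart b \<in> darts" using ab prev_dart_in by (auto simp: corners_def)
      have "\<exists>d\<in>{b, prev_dart b}. dart_edge d = e" using e(2) by (auto simp: corner_edges_def)
      then obtain d where d: "d \<in> {b, prev_dart b}" "dart_edge d = e" by blast
      then have "d \<in> darts_on e" using bd by (auto simp: darts_on_def)
      moreover have "darts_on e \<subseteq> {c, opp c, ?p, opp ?p}"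
        using e(1) opp(4)[OF cd(1)] opp(4)[OF cd(3)] by (auto simp: corner_edges_def)
      ultimately consider "d = c \<or> d = ?p" | "d = opp ?p" | "d = opp c" by blast
      then have "d \<in> {c, prev_dart c} \<or> d \<in> {c1, prev_dart c1}"
        by cases (use c1(2) c2(2)[folded eq] in simp_all)
      moreover have "b \<in> corners x" "b \<noteq> c" "b \<noteq> c1" using ab(2) by simp_all
      ultimately show False
        using corner_unique[OF \<open>b \<in> corners x\<close> c d(1)] corner_unique[OF \<open>b \<in> corners x\<close> c1(1) d(1)] by blast
    qed
    then have "card (corners x) \<le> card {c, c1}" by (intro card_mono) auto
    also have "\<dots> \<le> 2" by (simp add: card_insert_if)
    finally show False using card_corners[OF x] degree_ge_3[OF x] by simp
  qed
  moreover have "fst c1 = fst (opp ?p)" "fst c2 = fst (opp c)" using c1(2) c2(2) by auto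
  ultimately show ?thesis using that c1(1) c2(1) by blast
qed

section \<open>Sums over corners and the total curvature\<close>

lemma incident_face_degrees_eq:
  "incident_face_degrees M G \<gamma> v = image_mset (\<lambda>c. fdeg (fst c)) (mset_set (corners v))"
proof -
  let ?I = "\<lambda>F. {i. i < fdeg F \<and> fst (walk F ! i) = v}"
  have corners: "corners v = Sigma FS ?I"
    by (auto simp: corners_def darts_def dart_start_def)
  have "image_mset (\<lambda>c. fdeg (fst c)) (mset_set (corners v)) = (\<Sum>c\<in>Sigma FS ?I. {#fdeg (fst c)#})"
    using image_mset_as_sum[OF finite_corners[of v]] by (simp only: corners)
  also have "\<dots> = (\<Sum>F\<in>FS. \<Sum>i\<in>?I F. {#fdeg F#})"
    by (subst sum.Sigma) (auto simp: finite_faces case_prod_beta)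
  also have "\<dots> = (\<Sum>F\<in>FS. replicate_mset (count_list (map fst (walk F)) v) (fdeg F))"
  proof (intro sum.cong refl)
    fix F
    have "count_list (map fst (walk F)) v = card (?I F)"
      unfolding count_list_eq_length_filter length_filter_conv_card
      by (intro arg_cong[where f=card]) (auto simp: face_degree_def)
    then show "(\<Sum>i\<in>?I F. {#fdeg F#}) = replicate_mset (count_list (map fst (walk F)) v) (fdeg F)"
      by (simp add: sum_singleton_mset)
  qed
  finally show ?thesis by (simp add: incident_face_degrees_def)
qed

lemma sum_over_corners:
  fixes f :: "'a set \<times> nat \<Rightarrow> 'c::comm_monoid_add"
  shows "(\<Sum>v\<in>pverts G. \<Sum>c\<in>corners v. f c) = (\<Sum>c\<in>darts. f c)"
proof -
  have "(\<Sum>v\<in>pverts G. \<Sum>c\<in>{c \<in> darts. dart_start c = v}. f c) = (\<Sum>c\<in>darts. f c)"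
    using dart_ends_in by (intro sum.group finite_darts finite_verts) auto
  then show ?thesis by (simp add: corners_def)
qed

lemma darts_Sigma: "darts = Sigma FS (\<lambda>F. {..<fdeg F})"
  by (auto simp: darts_def)

lemma sum_over_darts:
  fixes f :: "'a set \<times> nat \<Rightarrow> 'c::comm_monoid_add"
  shows "(\<Sum>c\<in>darts. f c) = (\<Sum>F\<in>FS. \<Sum>i<fdeg F. f (F, i))"
  unfolding darts_Sigma by (subst sum.Sigma) (auto simp: finite_faces)

lemma card_darts: "card darts = 2 * card edges"
proof -
  have "darts = (\<Union>e\<in>edges. darts_on e)" using dart_edge_in by (auto simp: darts_on_def)
  also have "card \<dots> = (\<Sum>e\<in>edges. card (darts_on e))"
    using finite_edges darts_on_le_2 by (intro card_UN_disjoint) (auto simp: darts_on_def)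
  finally show ?thesis by (simp add: card_darts_on)
qed

text \<open>Summed over darts, a face of degree n collects n times 1/n, and an edge collects -1/2
  from each of its two sides.\<close>

lemma curvature_sum:
  "(\<Sum>v\<in>pverts G. 1 + (\<Sum>c\<in>corners v. 1 / real (fdeg (fst c)) - 1/2)) = real_of_int (euler_characteristic M)"
proof -
  have "(\<Sum>c\<in>darts. 1 / real (fdeg (fst c))) = (\<Sum>F\<in>FS. \<Sum>i<fdeg F. 1 / real (fdeg F))"
    by (simp add: sum_over_darts)
  also have "\<dots> = real (card FS)"
    using fdeg_pos by (simp add: sum.cong[of FS FS _ "\<lambda>_. 1"])
  finally have "(\<Sum>c\<in>darts. 1 / real (fdeg (fst c)) - 1/2) = real (card FS) - real (card edges)"
    by (simp add: sum_subtractf card_darts)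
  then show ?thesis
    by (simp add: sum.distrib sum_over_corners euler_formula)
qed

end


section \<open>Curvature of vertices\<close>

text \<open>Spelled exactly as in the theorem, so that unfolding it yields the final goal.\<close>

definition listed :: "nat \<Rightarrow> nat multiset \<Rightarrow> bool" where
  "listed n A \<longleftrightarrow>
    (n = 3 \<and>
       ((\<exists>a. A \<in> {{#3,3,a#}, {#3,4,a#}, {#3,5,a#}, {#4,4,a#}}) \<or>
        (\<exists>a\<le>2518. A \<in> {{#3,6,a#}, {#3,7,a#}, {#3,8,a#}, {#3,9,a#}, {#3,10,a#}, {#3,11,a#},
                        {#3,12,a#}, {#4,5,a#}, {#4,6,a#}, {#4,7,a#}, {#4,8,a#},
                        {#5,5,a#}, {#5,6,a#}}) \<or>
        A = {#6,6,6#}) \<or>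
     n = 4 \<and>
       ((\<exists>a. A = {#3,3,3,a#}) \<or>
        (\<exists>a\<le>2518. A \<in> {{#3,3,4,a#}, {#3,3,5,a#}}) \<or>
        A \<in> {{#3,3,6,6#}, {#3,4,4,4#}, {#3,4,4,5#}, {#3,4,4,6#}, {#4,4,4,4#}}) \<or>
     n = 5 \<and>
       A \<in> {{#3,3,3,3,3#}, {#3,3,3,3,4#}, {#3,3,3,3,5#}, {#3,3,3,3,6#}, {#3,3,3,4,4#}} \<or>
     n = 6 \<and> A = {#3,3,3,3,3,3#})"

lemma listed3:
  "listed 3 {#3,3,a#}" "listed 3 {#3,4,a#}" "listed 3 {#3,5,a#}" "listed 3 {#4,4,a#}" "listed 3 {#6,6,6#}"
  by (auto simp: listed_def)

lemma listed3_bounded: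
  assumes "a \<le> 2518"
  shows "6 \<le> b \<Longrightarrow> b \<le> 12 \<Longrightarrow> listed 3 {#3,b,a#}" "5 \<le> b \<Longrightarrow> b \<le> 8 \<Longrightarrow> listed 3 {#4,b,a#}"
    "5 \<le> b \<Longrightarrow> b \<le> 6 \<Longrightarrow> listed 3 {#5,b,a#}"
proof -
  assume "6 \<le> b" "b \<le> 12"
  then have "b = 6 \<or> b = 7 \<or> b = 8 \<or> b = 9 \<or> b = 10 \<or> b = 11 \<or> b = 12" by linarith
  then have "{#3,b,a#} \<in> {{#3,6,a#}, {#3,7,a#}, {#3,8,a#}, {#3,9,a#}, {#3,10,a#}, {#3,11,a#}, {#3,12,a#}}"
    by blast
  then show "listed 3 {#3,b,a#}" unfolding listed_def using assms by blast
next
  assume "5 \<le> b" "b \<le> 8"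
  then have "b = 5 \<or> b = 6 \<or> b = 7 \<or> b = 8" by linarith
  then have "{#4,b,a#} \<in> {{#4,5,a#}, {#4,6,a#}, {#4,7,a#}, {#4,8,a#}}" by blast
  then show "listed 3 {#4,b,a#}" unfolding listed_def using assms by blast
next
  assume "5 \<le> b" "b \<le> 6"
  then have "b = 5 \<or> b = 6" by linarith
  then have "{#5,b,a#} \<in> {{#5,5,a#}, {#5,6,a#}}" by blast
  then show "listed 3 {#5,b,a#}" unfolding listed_def using assms by blast
qed

lemma listed4:
  "listed 4 {#3,3,3,a#}" "a \<le> 2518 \<Longrightarrow> listed 4 {#3,3,4,a#}" "a \<le> 2518 \<Longrightarrow> listed 4 {#3,3,5,a#}"
  "listed 4 {#3,3,6,6#}" "4 \<le> a \<Longrightarrow> a \<le> 6 \<Longrightarrow> listed 4 {#3,4,4,a#}" "listed 4 {#4,4,4,4#}"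
proof -
  assume "4 \<le> a" "a \<le> 6"
  then have "a = 4 \<or> a = 5 \<or> a = 6" by linarith
  then show "listed 4 {#3,4,4,a#}" unfolding listed_def by blast
qed (unfold listed_def, blast+)

lemma listed5: "3 \<le> a \<Longrightarrow> a \<le> 6 \<Longrightarrow> listed 5 {#3,3,3,3,a#}" "listed 5 {#3,3,3,4,4#}"
proof -
  assume "3 \<le> a" "a \<le> 6"
  then have "a = 3 \<or> a = 4 \<or> a = 5 \<or> a = 6" by linarith
  then show "listed 5 {#3,3,3,3,a#}" unfolding listed_def by blast
qed (unfold listed_def, blast+)

lemma listed6: "listed 6 {#3,3,3,3,3,3#}"
  unfolding listed_def by blast

section \<open>Curvature estimates by vertex degree\<close>

definition recip :: "nat \<Rightarrow> real" where "recip a = 1 / real a"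

lemma recip_numeral [simp]: "recip (numeral k) = 1 / numeral k"
  by (simp add: recip_def)

lemma recip_le: "0 < k \<Longrightarrow> k \<le> a \<Longrightarrow> recip a \<le> 1 / real k"
  by (simp add: recip_def frac_le)

lemma mset_sorted_list:
  fixes A :: "nat multiset"
  obtains xs where "A = mset xs" "sorted xs" "length xs = size A"
proof -
  have "mset (sorted_list_of_multiset A) = A" by simp
  then show ?thesis using that[of "sorted_list_of_multiset A"] by (metis size_mset sorted_sorted_list_of_multiset)
qed

text \<open>The worst type is (3,13,13), with curvature -1/78, followed by (5,7,7) with -1/70. The
  types that are listed only up to 2518 enter with a face of degree at least 2519.\<close>

lemma curvature_3:
  assumes "3 \<le> a" "a \<le> b" "b \<le> c" and unl: "\<not> listed 3 {#a, b, c#}"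
    and nb: "\<not> (a = 3 \<and> b = 6 \<and> 2519 \<le> c)"
  shows "recip a + recip b + recip c \<le> 1/2 - 1/126"
proof -
  note r = recip_le
  have "a = 3 \<or> a = 4 \<or> a = 5 \<or> 6 \<le> a" using assms by linarith
  then show ?thesis
  proof (elim disjE)
    assume a: "a = 3"
    then have "b \<noteq> 3" "b \<noteq> 4" "b \<noteq> 5" using unl listed3 by auto
    then have "6 \<le> b" using assms a by linarith
    show ?thesis
    proof (cases "b \<le> 12")
      case True
      then have c: "2519 \<le> c" using unl listed3_bounded(1)[of c b] a \<open>6 \<le> b\<close> by (cases "c \<le> 2518") auto
      then have "7 \<le> b" using nb a \<open>6 \<le> b\<close> by (cases "b = 6") auto
      then show ?thesis using r[of 7 b] r[of 2519 c] a c by simp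
    next
      case False
      then have "13 \<le> b" "13 \<le> c" using assms by linarith+
      then show ?thesis using r[of 13 b] r[of 13 c] a by simp
    qed
  next
    assume a: "a = 4"
    then have "b \<noteq> 4" using unl listed3 by auto
    then have "5 \<le> b" using assms a by linarith
    show ?thesis
    proof (cases "b \<le> 8")
      case True
      then have c: "2519 \<le> c" using unl listed3_bounded(2)[of c b] a \<open>5 \<le> b\<close> by (cases "c \<le> 2518") auto
      then show ?thesis using r[of 5 b] r[of 2519 c] a \<open>5 \<le> b\<close> by simp
    next
      case False
      then have "9 \<le> b" "9 \<le> c" using assms by linarith+
      then show ?thesis using r[of 9 b] r[of 9 c] a by simp
    qed
  next
    assume a: "a = 5"
    then have "5 \<le> b" using assms by linarith
    show ?thesis
    proof (cases "b \<le> 6")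
      case True
      then have c: "2519 \<le> c" using unl listed3_bounded(3)[of c b] a \<open>5 \<le> b\<close> by (cases "c \<le> 2518") auto
      then show ?thesis using r[of 5 b] r[of 2519 c] a \<open>5 \<le> b\<close> by simp
    next
      case False
      then have "7 \<le> b" "7 \<le> c" using assms by linarith+
      then show ?thesis using r[of 7 b] r[of 7 c] a by simp
    qed
  next
    assume a: "6 \<le> a"
    have "c \<noteq> 6"
    proof
      assume "c = 6"
      then have "a = 6" "b = 6" using assms a by linarith+
      then show False using unl listed3(5) \<open>c = 6\<close> by simp
    qed
    then have "7 \<le> c" "6 \<le> b" using assms a by linarith+
    then show ?thesis using r[of 6 a] r[of 6 b] r[of 7 c] a by simp
  qed
qed

text \<open>The worst type is (3,4,5,5), with curvature -1/60.\<close>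

lemma curvature_4:
  assumes "3 \<le> a" "a \<le> b" "b \<le> c" "c \<le> d" and unl: "\<not> listed 4 {#a, b, c, d#}"
  shows "recip a + recip b + recip c + recip d \<le> 1 - 1/126"
proof -
  note r = recip_le
  have "b = 3 \<or> a = 3 \<and> 4 \<le> b \<or> 4 \<le> a" using assms by linarith
  then show ?thesis
  proof (elim disjE conjE)
    assume b: "b = 3"
    then have a: "a = 3" using assms by linarith
    have "c \<noteq> 3" using unl listed4(1)[of d] a b by auto
    then have "4 \<le> c" using assms b by linarith
    show ?thesis
    proof (cases "c \<le> 5")
      case True
      then have "c = 4 \<or> c = 5" using \<open>4 \<le> c\<close> by linarith
      then have "2519 \<le> d" using unl listed4(2,3)[of d] a b by (cases "d \<le> 2518") auto
      then show ?thesis using r[of 4 c] r[of 2519 d] a b \<open>4 \<le> c\<close> by simp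
    next
      case False
      have "\<not> (c = 6 \<and> d = 6)" using unl listed4(4) a b by auto
      then have "6 \<le> c" "7 \<le> d" using assms False by linarith+
      then show ?thesis using r[of 6 c] r[of 7 d] a b by simp
    qed
  next
    assume a: "a = 3" and b: "4 \<le> b"
    show ?thesis
    proof (cases "7 \<le> d")
      case True
      have "4 \<le> c" using assms b by linarith
      then show ?thesis using r[of 4 b] r[of 4 c] r[of 7 d] a b True by simp
    next
      case False
      have "c \<noteq> 4"
      proof
        assume "c = 4"
        then have "b = 4" "4 \<le> d" "d \<le> 6" using assms b False by linarith+
        then show False using unl listed4(5)[of d] a \<open>c = 4\<close> by simp
      qed
      then have "5 \<le> c" "5 \<le> d" using assms b by linarith+
      then show ?thesis using r[of 4 b] r[of 5 c] r[of 5 d] a b by simp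
    qed
  next
    assume a: "4 \<le> a"
    have "d \<noteq> 4"
    proof
      assume "d = 4"
      then have "a = 4" "b = 4" "c = 4" using assms a by linarith+
      then show False using unl listed4(6) \<open>d = 4\<close> by simp
    qed
    then have "4 \<le> b" "4 \<le> c" "5 \<le> d" using assms a by linarith+
    then show ?thesis using r[of 4 a] r[of 4 b] r[of 4 c] r[of 5 d] a by simp
  qed
qed

text \<open>The worst type is (3,3,3,3,7), with curvature -1/42.\<close>

lemma curvature_5:
  assumes "3 \<le> a" "a \<le> b" "b \<le> c" "c \<le> d" "d \<le> e" and unl: "\<not> listed 5 {#a, b, c, d, e#}"
  shows "recip a + recip b + recip c + recip d + recip e \<le> 3/2 - 1/126"
proof -
  note r = recip_le
  have ge: "3 \<le> b" "3 \<le> c" "3 \<le> d" "3 \<le> e" using assms by linarith+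
  have "7 \<le> e \<or> 4 \<le> c \<or> d = 3 \<and> e \<le> 6 \<or> c = 3 \<and> 4 \<le> d" using assms by linarith
  then show ?thesis
  proof (elim disjE conjE)
    assume "7 \<le> e"
    then show ?thesis using r[of 3 a] r[of 3 b] r[of 3 c] r[of 3 d] r[of 7 e] assms(1) ge by simp
  next
    assume c: "4 \<le> c"
    then have "4 \<le> d" "4 \<le> e" using assms by linarith+
    then show ?thesis using r[of 3 a] r[of 3 b] r[of 4 c] r[of 4 d] r[of 4 e] assms(1) ge c by simp
  next
    assume d: "d = 3" and e: "e \<le> 6"
    then have "a = 3" "b = 3" "c = 3" using assms by linarith+
    then show ?thesis using unl listed5(1)[of e] d e ge by simp
  next
    assume c: "c = 3" and d: "4 \<le> d"
    then have ab: "a = 3" "b = 3" using assms by linarith+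
    have "e \<noteq> 4"
    proof
      assume "e = 4"
      then have "d = 4" using assms d by linarith
      then show False using unl listed5(2) ab c \<open>e = 4\<close> by simp
    qed
    then have "5 \<le> e" using assms d by linarith
    then show ?thesis using r[of 4 d] r[of 5 e] ab c d by simp
  qed
qed

lemma curvature_6:
  assumes "3 \<le> a" "a \<le> b" "b \<le> c" "c \<le> d" "d \<le> e" "e \<le> f" and unl: "\<not> listed 6 {#a, b, c, d, e, f#}"
  shows "recip a + recip b + recip c + recip d + recip e + recip f \<le> 2 - 1/126"
proof (cases "f = 3")
  case True
  then have "a = 3" "b = 3" "c = 3" "d = 3" "e = 3" using assms by linarith+
  then show ?thesis using unl listed6 True by auto
next
  case False
  then have "3 \<le> b" "3 \<le> c" "3 \<le> d" "3 \<le> e" "4 \<le> f" using assms by linarith+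
  then show ?thesis
    using recip_le[of 3 a] recip_le[of 3 b] recip_le[of 3 c] recip_le[of 3 d] recip_le[of 3 e] recip_le[of 4 f] assms(1) by simp
qed

lemma sum_mset_le_size:
  fixes g :: "nat \<Rightarrow> real"
  assumes "\<And>a. a \<in># A \<Longrightarrow> g a \<le> q"
  shows "(\<Sum>a\<in>#A. g a) \<le> real (size A) * q"
  using assms by (induction A) (auto simp: algebra_simps add_mono)

text \<open>The curvature of such a vertex is exactly 1/a, because 1/3 + 1/6 cancels 1 -
  3/2.\<close>

definition heavy :: "nat multiset \<Rightarrow> bool" where
  "heavy A \<longleftrightarrow> (\<exists>a\<ge>2519. A = {#3, 6, a#})"

lemma curvature_bound:
  assumes unl: "\<not> listed (size A) A" and nh: "\<not> heavy A" and n: "3 \<le> size A" and ge: "\<And>a. a \<in># A \<Longrightarrow> 3 \<le> a"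
  shows "1 + (\<Sum>a\<in>#A. recip a - 1/2) \<le> - 1/126"
proof -
  obtain xs where xs: "A = mset xs" "sorted xs" "length xs = size A" using mset_sorted_list by blast
  have "size A = 3 \<or> size A = 4 \<or> size A = 5 \<or> size A = 6 \<or> 7 \<le> size A" using n by linarith
  then consider "size A = 3" | "size A = 4" | "size A = 5" | "size A = 6" | "7 \<le> size A" by blast
  then show ?thesis
  proof cases
    case 1
    then obtain a b c where abc: "xs = [a, b, c]" using xs(3) by (auto simp: numeral_3_eq_3 length_Suc_conv)
    then have "3 \<le> a" "a \<le> b" "b \<le> c" using xs ge by auto
    moreover have "\<not> (a = 3 \<and> b = 6 \<and> 2519 \<le> c)" using nh xs abc by (auto simp: heavy_def)
    moreover have A: "A = {#a, b, c#}" using xs(1) abc by simp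
    moreover have "\<not> listed 3 A" using unl 1 by metis
    ultimately have "recip a + recip b + recip c \<le> 1/2 - 1/126"
      by (intro curvature_3) simp_all
    then show ?thesis by (simp add: A)
  next
    case 2
    then obtain a b c d where abc: "xs = [a, b, c, d]" using xs(3) by (auto simp: eval_nat_numeral length_Suc_conv)
    then have "3 \<le> a" "a \<le> b" "b \<le> c" "c \<le> d" using xs ge by auto
    moreover have A: "A = {#a, b, c, d#}" using xs(1) abc by simp
    moreover have "\<not> listed 4 A" using unl 2 by metis
    ultimately have "recip a + recip b + recip c + recip d \<le> 1 - 1/126"
      by (intro curvature_4) simp_all
    then show ?thesis by (simp add: A)
  next
    case 3
    then obtain a b c d e where abc: "xs = [a, b, c, d, e]" using xs(3) by (auto simp: eval_nat_numeral length_Suc_conv)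
    then have "3 \<le> a" "a \<le> b" "b \<le> c" "c \<le> d" "d \<le> e" using xs ge by auto
    moreover have A: "A = {#a, b, c, d, e#}" using xs(1) abc by simp
    moreover have "\<not> listed 5 A" using unl 3 by metis
    ultimately have "recip a + recip b + recip c + recip d + recip e \<le> 3/2 - 1/126"
      by (intro curvature_5) simp_all
    then show ?thesis by (simp add: A)
  next
    case 4
    then obtain a b c d e f where abc: "xs = [a, b, c, d, e, f]" using xs(3) by (auto simp: eval_nat_numeral length_Suc_conv)
    then have "3 \<le> a" "a \<le> b" "b \<le> c" "c \<le> d" "d \<le> e" "e \<le> f" using xs ge by auto
    moreover have A: "A = {#a, b, c, d, e, f#}" using xs(1) abc by simp
    moreover have "\<not> listed 6 A" using unl 4 by metis
    ultimately have "recip a + recip b + recip c + recip d + recip e + recip f \<le> 2 - 1/126"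
      by (intro curvature_6) simp_all
    then show ?thesis by (simp add: A)
  next
    \<comment> \<open>A corner contributes at most -1/6, so seven or more of them give at most 1 -
      7/6, whatever the types.\<close>
    case 5
    have "(\<Sum>a\<in>#A. recip a - 1/2) \<le> real (size A) * (- 1/6)"
    proof (rule sum_mset_le_size)
      show "recip a - 1/2 \<le> - 1/6" if "a \<in># A" for a using recip_le[of 3 a] ge[OF that] by simp
    qed
    then show ?thesis using 5 by simp
  qed
qed

section \<open>Discharging\<close>

text \<open>Only a heavy vertex, incident with faces of degrees 3, 6 and at least 2519, has positive curvature
  without being listed. It loses \<open>\<delta>\<close> through its triangle. The other corners of the triangle receive
  this charge, by a rule that depends only on the degrees \<open>a\<close> and \<open>b\<close> of the faces across the two
  sides of the triangle at the corner.\<close>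

definition \<delta> :: real where "\<delta> = 1/126 + 1/2519"

definition transfer :: "bool \<Rightarrow> nat \<Rightarrow> nat \<Rightarrow> real" where
  "transfer h a b = (if h then - \<delta>
     else if a = 6 \<and> b = 6 \<or> 2519 \<le> a \<and> 2519 \<le> b then 2 * \<delta>
     else if 2519 \<le> a \<or> 2519 \<le> b then \<delta> else 0)"

text \<open>The marks \<open>s\<close> and \<open>g\<close> stand for outer faces of degree 6 and of
  degree at least 2519. Three heavy corners would make the marks alternate around an odd cycle. With
  two, the sides at the third corner carry equal marks and it receives 2 * x; with one, the other
  end of its large side receives at least x.\<close>

lemma transfer_triangle_cases:
  fixes x :: real
  assumes "h0 \<Longrightarrow> s2 \<and> g0 \<or> g2 \<and> s0" "h1 \<Longrightarrow> s0 \<and> g1 \<or> g0 \<and> s1" "h2 \<Longrightarrow> s1 \<and> g2 \<or> g1 \<and> s2"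
    and "\<not> (s0 \<and> g0)" "\<not> (s1 \<and> g1)" "\<not> (s2 \<and> g2)" "0 \<le> x"
  shows "0 \<le> (if h0 then - x else if s2 \<and> s0 \<or> g2 \<and> g0 then 2 * x else if g2 \<or> g0 then x else 0)
    + (if h1 then - x else if s0 \<and> s1 \<or> g0 \<and> g1 then 2 * x else if g0 \<or> g1 then x else 0)
    + (if h2 then - x else if s1 \<and> s2 \<or> g1 \<and> g2 then 2 * x else if g1 \<or> g2 then x else 0)"
  using assms by (cases h0; cases h1; cases h2; auto)

lemma transfer_triangle:
  assumes "h0 \<Longrightarrow> x2 = 6 \<and> 2519 \<le> x0 \<or> 2519 \<le> x2 \<and> x0 = 6"
    and "h1 \<Longrightarrow> x0 = 6 \<and> 2519 \<le> x1 \<or> 2519 \<le> x0 \<and> x1 = 6"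
    and "h2 \<Longrightarrow> x1 = 6 \<and> 2519 \<le> x2 \<or> 2519 \<le> x1 \<and> x2 = 6"
  shows "0 \<le> transfer h0 x2 x0 + transfer h1 x0 x1 + transfer h2 x1 x2"
  unfolding transfer_def
  by (rule transfer_triangle_cases) (use assms in \<open>simp_all add: \<delta>_def\<close>)

text \<open>Every triangular corner is credited with 2 * \<delta>, the most that it can receive.
  From five corners on this is absorbed without the list; with four, the listed types (3,3,6,6) and
  (3,3,3,a) have to be excluded.\<close>

lemma discharged_bound_ge_4:
  assumes unl: "\<not> listed (size A) A" and n: "4 \<le> size A" and ge: "\<And>a. a \<in># A \<Longrightarrow> 3 \<le> a"
    and sub: "{#3, a, b#} \<subseteq># A" and ab: "a = 6 \<and> b = 6 \<or> 2519 \<le> a \<or> 2519 \<le> b"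
  shows "1 + (\<Sum>x\<in>#A. recip x - 1/2 + (if x = 3 then 2 * \<delta> else 0)) \<le> - 1/126"
proof -
  define g where "g x = recip x - 1/2 + (if x = 3 then 2 * \<delta> else 0)" for x :: nat
  have g3: "g x \<le> - 1/6 + 2 * \<delta>" if "3 \<le> x" for x
    using recip_le[of 3 x] that by (auto simp: g_def \<delta>_def)
  have g4: "g x \<le> - 1/4" if "4 \<le> x" for x using recip_le[of 4 x] that by (simp add: g_def)
  have gbig: "g x \<le> 1/2519 - 1/2" if "2519 \<le> x" for x using recip_le[of 2519 x] that by (simp add: g_def)
  define B where "B = A - {#3, a, b#}"
  have B: "A = {#3, a, b#} + B" unfolding B_def by (rule subset_mset.add_diff_inverse[OF sub, symmetric])
  have Bge: "3 \<le> x" if "x \<in># B" for x using ge B that by auto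
  have Bsum: "(\<Sum>x\<in>#B. g x) \<le> real (size B) * (- 1/6 + 2 * \<delta>)"
    by (rule sum_mset_le_size) (use g3 Bge in blast)
  have tot: "(\<Sum>x\<in>#A. g x) = g 3 + g a + g b + (\<Sum>x\<in>#B. g x)" by (simp add: B)
  have abge: "3 \<le> a" "3 \<le> b" using ge B by auto
  have d: "2 * \<delta> \<le> 1/50" "0 < \<delta>" by (simp_all add: \<delta>_def)
  have "1 + (\<Sum>x\<in>#A. g x) \<le> - 1/126"
  proof (cases "size B = 1")
    case True
    then obtain c where c: "B = {#c#}" using size_1_singleton_mset by blast
    then have A: "A = {#3, a, b, c#}" "size A = 4" using B by (auto simp: add_mset_commute)
    have unl4: "\<not> listed 4 {#3, a, b, c#}" using unl A by metis
    have c3: "3 \<le> c" using Bge c by simp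
    consider "a = 6" "b = 6" | "2519 \<le> a" | "2519 \<le> b" using ab by blast
    then show ?thesis
    proof cases
      case 1
      have "c \<noteq> 3" using unl4 listed4(4) 1 by (auto simp: add_mset_commute)
      then have "g c \<le> - 1/4" using g4 c3 by simp
      moreover have "g 3 \<le> - 1/6 + 2 * \<delta>" "g 6 = - 1/3" using g3 by (simp_all add: g_def)
      ultimately show ?thesis using tot c 1 d by simp
    next
      case 2
      have "\<not> (b = 3 \<and> c = 3)" using unl4 listed4(1)[of a] by (auto simp: add_mset_commute)
      then have "g b + g c \<le> - 1/6 + 2 * \<delta> - 1/4"
        using g3[of b] g3[of c] g4[of b] g4[of c] abge c3 by (cases "b = 3"; cases "c = 3") simp_all
      then show ?thesis using tot c d gbig[OF 2] g3[of 3] by simp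
    next
      case 3
      have "\<not> (a = 3 \<and> c = 3)" using unl4 listed4(1)[of b] by (auto simp: add_mset_commute)
      then have "g a + g c \<le> - 1/6 + 2 * \<delta> - 1/4"
        using g3[of a] g3[of c] g4[of a] g4[of c] abge c3 by (cases "a = 3"; cases "c = 3") simp_all
      then show ?thesis using tot c d gbig[OF 3] g3[of 3] by simp
    qed
  next
    case False
    then have "2 \<le> size B" using n B by simp
    \<comment> \<open>Even with its credit a corner has a negative value, so further corners only
      lower the sum.\<close>
    then have "real (size B) * (- 1/6 + 2 * \<delta>) \<le> 2 * (- 1/6 + 2 * \<delta>)"
      using d by (intro mult_right_mono_neg) auto
    then have Bs: "(\<Sum>x\<in>#B. g x) \<le> 2 * (- 1/6 + 2 * \<delta>)" using Bsum by linarith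
    have "g a + g b \<le> - 2/3 + 2 * \<delta> + 1/2519"
      using ab
    proof (elim disjE conjE)
      assume "a = 6" "b = 6"
      then show ?thesis using d by (simp add: g_def)
    next
      assume "2519 \<le> a"
      then show ?thesis using gbig[of a] g3[of b] abge by simp
    next
      assume "2519 \<le> b"
      then show ?thesis using gbig[of b] g3[of a] abge by simp
    qed
    then show ?thesis using tot Bs g3[of 3] d by simp
  qed
  then show ?thesis by (simp add: g_def)
qed

text \<open>The critical type is (3,7,a) with a at least 2519, where -1/42 + 1/2519 + \<delta> is
  still below -1/126. That \<open>a\<close> and \<open>b\<close> differ from 3 means that the vertex
  has only one triangular corner.\<close>

lemma discharged_bound_3:
  assumes unl: "\<not> listed 3 {#3, a, b#}" and nh: "\<not> heavy {#3, a, b#}" and ge: "3 \<le> a" "3 \<le> b"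
    and ab: "a = 6 \<and> b = 6 \<or> 2519 \<le> a \<or> 2519 \<le> b"
  shows "a \<noteq> 3" "b \<noteq> 3" "recip a + recip b - 1/6 + transfer False a b \<le> - 1/126"
proof -
  have not: "a \<noteq> 3 \<and> a \<noteq> 4 \<and> a \<noteq> 5 \<and> b \<noteq> 3 \<and> b \<noteq> 4 \<and> b \<noteq> 5"
    using unl listed3(1-3)[of a] listed3(1-3)[of b] by (auto simp: add_mset_commute)
  then show "a \<noteq> 3" "b \<noteq> 3" by auto
  have n66: "\<not> (a = 6 \<and> b = 6)" using unl listed3_bounded(1)[of 6 6] by auto
  have h: "\<not> (a = 6 \<and> 2519 \<le> b)" "\<not> (b = 6 \<and> 2519 \<le> a)"
    using nh by (auto simp: heavy_def add_mset_commute)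
  have ge6: "6 \<le> a" "6 \<le> b" using ge not by linarith+
  have "2519 \<le> a \<and> 2519 \<le> b \<or> 2519 \<le> a \<and> b < 2519 \<and> 7 \<le> b \<or> 2519 \<le> b \<and> a < 2519 \<and> 7 \<le> a"
    using ab n66 h ge6 by (cases "2519 \<le> a"; cases "2519 \<le> b"; cases "a = 6"; cases "b = 6") simp_all
  then consider "2519 \<le> a" "2519 \<le> b" | "2519 \<le> a" "b < 2519" "7 \<le> b" | "2519 \<le> b" "a < 2519" "7 \<le> a"
    by blast
  then show "recip a + recip b - 1/6 + transfer False a b \<le> - 1/126"
  proof cases
    case 1
    then show ?thesis using recip_le[of 2519 a] recip_le[of 2519 b] by (simp add: transfer_def \<delta>_def)
  next
    case 2
    then show ?thesis using recip_le[of 2519 a] recip_le[of 7 b] by (simp add: transfer_def \<delta>_def)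
  next
    case 3
    then show ?thesis using recip_le[of 7 a] recip_le[of 2519 b] by (simp add: transfer_def \<delta>_def)
  qed
qed

section \<open>Charges on the corners of a map\<close>

context surface_map
begin

abbreviation A :: "'a \<Rightarrow> nat multiset" where "A \<equiv> incident_face_degrees M G \<gamma>"

abbreviation across :: "'a set \<times> nat \<Rightarrow> nat" where "across c \<equiv> fdeg (fst (opp c))"

text \<open>The two degrees are those across the incoming and the outgoing side of the corner, so
  consecutive corners of a triangle share one argument of \<open>transfer\<close>.\<close>

definition received :: "'a set \<times> nat \<Rightarrow> real" where
  "received c = (if fdeg (fst c) = 3 then transfer (heavy (A (dart_start c))) (across (prev_dart c)) (across c) else 0)"

lemma size_A: "v \<in> pverts G \<Longrightarrow> size (A v) = vertex_degree G v"
  by (simp add: incident_face_degrees_eq card_corners)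

lemma A_ge_3: "a \<in># A v \<Longrightarrow> 3 \<le> a"
  using fdeg_ge_3 finite_corners by (auto simp: incident_face_degrees_eq corners_def darts_def)

lemma sum_corners_eq_sum_mset: "(\<Sum>c\<in>corners v. f (fdeg (fst c))) = (\<Sum>a\<in>#A v. f a)"
  by (simp add: incident_face_degrees_eq sum_unfold_sum_mset image_mset.compositionality o_def)

lemma triangle_corner:
  assumes x: "x \<in> pverts G" and c: "c \<in> corners x" and n: "fdeg (fst c) = 3"
  obtains c1 c2 where "c1 \<in> corners x" "c2 \<in> corners x" "c1 \<noteq> c" "c2 \<noteq> c" "c1 \<noteq> c2"
    "fdeg (fst c1) = across (prev_dart c)" "fdeg (fst c2) = across c"
    "{#3, across (prev_dart c), across c#} \<subseteq># A x"
proof -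
  have "dart_edge (prev_dart c) \<noteq> dart_edge c" using triangle_corner_edges[of c] c n by (simp add: corners_def)
  then obtain c1 c2 where cc: "c1 \<in> corners x" "c2 \<in> corners x" "c1 \<noteq> c" "c2 \<noteq> c" "c1 \<noteq> c2"
    "fst c1 = fst (opp (prev_dart c))" "fst c2 = fst (opp c)"
    using across_corners[OF x c] by metis
  have "mset_set {c, c1, c2} \<subseteq># mset_set (corners x)"
    using c cc finite_corners by (intro subset_imp_msubset_mset_set) auto
  then have "image_mset (\<lambda>c. fdeg (fst c)) (mset_set {c, c1, c2}) \<subseteq># A x"
    unfolding incident_face_degrees_eq by (rule image_mset_subseteq_mono)
  then show ?thesis using that[of c1 c2] cc n by simp
qed

text \<open>The triangle and the faces across its two sides at the corner account for all three
  degrees at a heavy vertex.\<close>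

lemma heavy_across:
  assumes c: "c \<in> darts" and n: "fdeg (fst c) = 3" and h: "heavy (A (dart_start c))"
  shows "across (prev_dart c) = 6 \<and> 2519 \<le> across c \<or> 2519 \<le> across (prev_dart c) \<and> across c = 6"
proof -
  have x: "dart_start c \<in> pverts G" "c \<in> corners (dart_start c)" using c dart_ends_in by (auto simp: corners_def)
  obtain k where k: "2519 \<le> k" "A (dart_start c) = {#3, 6, k#}" using h by (auto simp: heavy_def)
  have "{#3, across (prev_dart c), across c#} \<subseteq># {#3, 6, k#}"
    using triangle_corner[OF x n] k(2) by metis
  then have "{#across (prev_dart c), across c#} = {#6, k#}"
    by (metis add_mset_add_single size_add_mset mset_subset_eq_add_mset_cancel mset_subset_size nat_less_le size_empty subset_mset.le_neq_trans)
  then show ?thesis using k(1) by (auto simp: add_eq_conv_ex)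
qed

text \<open>Charge is balanced within each triangle, and other faces carry none.\<close>

lemma received_nonneg: "0 \<le> (\<Sum>c\<in>darts. received c)"
  unfolding sum_over_darts
proof (rule sum_nonneg)
  fix F assume F: "F \<in> FS"
  show "0 \<le> (\<Sum>i<fdeg F. received (F, i))"
  proof (cases "fdeg F = 3")
    case False
    then show ?thesis by (simp add: received_def)
  next
    case n: True
    have d: "(F, i) \<in> darts" if "i < 3" for i using F n that by (simp add: darts_def)
    have p: "prev_dart (F, 0) = (F, 2)" "prev_dart (F, 1) = (F, 0)" "prev_dart (F, 2) = (F, 1)"
      using n by (simp_all add: prev_dart_def)
    have h: "across (prev_dart (F, i)) = 6 \<and> 2519 \<le> across (F, i) \<or> 2519 \<le> across (prev_dart (F, i)) \<and> across (F, i) = 6"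
      if "i < 3" "heavy (A (dart_start (F, i)))" for i
      using heavy_across[OF d[OF that(1)]] that(2) n by simp
    have "(\<Sum>i<fdeg F. received (F, i)) = received (F, 0) + received (F, 1) + received (F, 2)"
      using n by (simp add: eval_nat_numeral)
    also have "\<dots> = transfer (heavy (A (dart_start (F, 0)))) (across (F, 2)) (across (F, 0))
       + transfer (heavy (A (dart_start (F, 1)))) (across (F, 0)) (across (F, 1))
       + transfer (heavy (A (dart_start (F, 2)))) (across (F, 1)) (across (F, 2))"
      unfolding received_def p using n by simp
    also have "\<dots> \<ge> 0"
      by (rule transfer_triangle) (use h[of 0, unfolded p] h[of 1, unfolded p] h[of 2, unfolded p] in simp_all)
    finally show ?thesis .
  qed
qed

text \<open>A heavy vertex loses \<delta>. A vertex without a gaining corner keeps the undischarged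
  bound. For a gaining vertex, degree 3 is treated apart: there the crude credit 2 * \<delta> would
  be too much for type (3,7,a).\<close>

lemma discharged_curvature:
  assumes x: "x \<in> pverts G" and unl: "\<not> listed (vertex_degree G x) (A x)"
  shows "1 + (\<Sum>c\<in>corners x. recip (fdeg (fst c)) - 1/2 + received c) \<le> - 1/126"
proof (cases "heavy (A x)")
  case True
  then obtain k where k: "2519 \<le> k" "A x = {#3, 6, k#}" by (auto simp: heavy_def)
  have "(\<Sum>c\<in>corners x. recip (fdeg (fst c)) - 1/2 + received c) =
     (\<Sum>c\<in>corners x. (\<lambda>a. recip a - 1/2 + (if a = 3 then - \<delta> else 0)) (fdeg (fst c)))"
    using True by (intro sum.cong) (auto simp: received_def transfer_def corners_def)
  also have "\<dots> = (\<Sum>a\<in>#A x. recip a - 1/2 + (if a = 3 then - \<delta> else 0))"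
    by (rule sum_corners_eq_sum_mset)
  \<comment> \<open>1/3 + 1/6 - 3/2 is -1, and exactly one of the three degrees is 3.\<close>
  also have "\<dots> = recip k - 1 - \<delta>" using k by simp
  finally show ?thesis using recip_le[of 2519 k] k(1) by (simp add: \<delta>_def)
next
  case nh: False
  have unl': "\<not> listed (size (A x)) (A x)" using unl size_A[OF x] by simp
  have n3: "3 \<le> size (A x)" using degree_ge_3[OF x] size_A[OF x] by simp
  have rec: "received c = (if fdeg (fst c) = 3 then transfer False (across (prev_dart c)) (across c) else 0)" if "c \<in> corners x" for c
    using that nh by (simp add: received_def corners_def)
  show ?thesis
  proof (cases "\<exists>c\<in>corners x. 0 < received c")
    case False
    have "(\<Sum>c\<in>corners x. recip (fdeg (fst c)) - 1/2 + received c) \<le> (\<Sum>c\<in>corners x. recip (fdeg (fst c)) - 1/2)"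
      using False by (intro sum_mono) (auto simp: not_less)
    also have "\<dots> = (\<Sum>a\<in>#A x. recip a - 1/2)"
      using sum_corners_eq_sum_mset[of "\<lambda>a. recip a - 1/2"] by simp
    finally show ?thesis using curvature_bound[OF unl' nh n3 A_ge_3[of _ x]] by linarith
  next
    case True
    then obtain c where c: "c \<in> corners x" "0 < received c" by blast
    then have n: "fdeg (fst c) = 3" by (auto simp: received_def split: if_splits)
    let ?a = "across (prev_dart c)" and ?b = "across c"
    have ab: "?a = 6 \<and> ?b = 6 \<or> 2519 \<le> ?a \<or> 2519 \<le> ?b"
      using c rec[OF c(1)] by (auto simp: transfer_def split: if_splits)
    obtain c1 c2 where cc: "c1 \<in> corners x" "c2 \<in> corners x" "c1 \<noteq> c" "c2 \<noteq> c" "c1 \<noteq> c2"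
      "fdeg (fst c1) = ?a" "fdeg (fst c2) = ?b" "{#3, ?a, ?b#} \<subseteq># A x"
      using triangle_corner[OF x c(1) n] by metis
    show ?thesis
    proof (cases "size (A x) = 3")
      case False
      have "(\<Sum>c\<in>corners x. recip (fdeg (fst c)) - 1/2 + received c) \<le>
         (\<Sum>c\<in>corners x. (\<lambda>a. recip a - 1/2 + (if a = 3 then 2 * \<delta> else 0)) (fdeg (fst c)))"
        by (intro sum_mono) (auto simp: rec transfer_def \<delta>_def)
      also have "\<dots> = (\<Sum>a\<in>#A x. recip a - 1/2 + (if a = 3 then 2 * \<delta> else 0))"
        by (rule sum_corners_eq_sum_mset)
      finally show ?thesis
        using discharged_bound_ge_4[OF unl' _ A_ge_3[of _ x] cc(8) ab] False n3 by linarith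
    next
      case True
      have "A x = {#3, ?a, ?b#}"
        using cc(8) True by (metis mset_subset_size nat_neq_iff size_add_mset size_empty subset_mset.le_neq_trans numeral_3_eq_3)
      then have A: "\<not> listed 3 {#3, ?a, ?b#}" "\<not> heavy {#3, ?a, ?b#}" "3 \<le> ?a" "3 \<le> ?b"
        using unl' nh A_ge_3[of ?a x] A_ge_3[of ?b x] unfolding True by simp_all
      \<comment> \<open>The degree is 3, so the triangle corner and the two corners across its sides
        are all corners at \<open>x\<close>.\<close>
      have "corners x = {c, c1, c2}"
      proof (rule card_seteq[symmetric])
        show "card (corners x) \<le> card {c, c1, c2}"
          using True size_A[OF x] card_corners[OF x] cc by simp
      qed (use c cc finite_corners in auto)
      then have "(\<Sum>c\<in>corners x. recip (fdeg (fst c)) - 1/2 + received c) =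
         1/3 + recip ?a + recip ?b - 3/2 + transfer False ?a ?b"
        using cc rec[OF c(1)] rec[OF cc(1)] rec[OF cc(2)] discharged_bound_3[OF A ab] n by simp
      then show ?thesis using discharged_bound_3(3)[OF A ab] by simp
    qed
  qed
qed

text \<open>The total charge is nonnegative, so adding it does not lower the curvature sum; the
  bound of -1/126 at every vertex would then make the Euler characteristic too small.\<close>

lemma exists_listed_vertex:
  assumes "int (card (pverts G)) > 126 * \<bar>euler_characteristic M\<bar>"
  shows "\<exists>v\<in>pverts G. listed (vertex_degree G v) (A v)"
proof (rule ccontr)
  assume no: "\<not> ?thesis"
  have "real_of_int (euler_characteristic M) \<le>
    (\<Sum>v\<in>pverts G. 1 + (\<Sum>c\<in>corners v. recip (fdeg (fst c)) - 1/2)) + (\<Sum>c\<in>darts. received c)"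
    using curvature_sum received_nonneg by (simp add: recip_def)
  also have "\<dots> = (\<Sum>v\<in>pverts G. 1 + (\<Sum>c\<in>corners v. recip (fdeg (fst c)) - 1/2 + received c))"
    unfolding sum_over_corners[symmetric] by (simp add: sum.distrib)
  also have "\<dots> \<le> (\<Sum>v\<in>pverts G. - 1/126)"
    using discharged_curvature no by (intro sum_mono) blast
  finally have "126 * real_of_int (euler_characteristic M) \<le> - real (card (pverts G))" by simp
  then have "126 * euler_characteristic M \<le> - int (card (pverts G))"
    by (metis (mono_tags) of_int_le_iff of_int_mult of_int_minus of_int_numeral of_int_of_nat_eq)
  then show False using assms by linarith
qed

end

theorem theorem2:
  fixes M :: "'a topology"
    and G :: "'a pair_pre_digraph"
    and \<gamma> :: "'a \<times> 'a \<Rightarrow> 'a set"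
  assumes "closed_surface M"
    and "euler_characteristic M \<le> 0"
    and "polyhedral_map M G \<gamma>"
    and "int (card (pverts G)) > 126 * \<bar>euler_characteristic M\<bar>"
  shows "\<exists>v\<in>pverts G. let A = incident_face_degrees M G \<gamma> v in
    (vertex_degree G v = 3 \<and>
       ((\<exists>a. A \<in> {{#3,3,a#}, {#3,4,a#}, {#3,5,a#}, {#4,4,a#}}) \<or>
        (\<exists>a\<le>2518. A \<in> {{#3,6,a#}, {#3,7,a#}, {#3,8,a#}, {#3,9,a#}, {#3,10,a#}, {#3,11,a#},
                        {#3,12,a#}, {#4,5,a#}, {#4,6,a#}, {#4,7,a#}, {#4,8,a#},
                        {#5,5,a#}, {#5,6,a#}}) \<or>
        A = {#6,6,6#}) \<or>
     vertex_degree G v = 4 \<and>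
       ((\<exists>a. A = {#3,3,3,a#}) \<or>
        (\<exists>a\<le>2518. A \<in> {{#3,3,4,a#}, {#3,3,5,a#}}) \<or>
        A \<in> {{#3,3,6,6#}, {#3,4,4,4#}, {#3,4,4,5#}, {#3,4,4,6#}, {#4,4,4,4#}}) \<or>
     vertex_degree G v = 5 \<and>
       A \<in> {{#3,3,3,3,3#}, {#3,3,3,3,4#}, {#3,3,3,3,5#}, {#3,3,3,3,6#}, {#3,3,3,4,4#}} \<or>
     vertex_degree G v = 6 \<and> A = {#3,3,3,3,3,3#})"
  proof -
  interpret surface_map M G \<gamma>
    using assms(1,3) by unfold_locales (auto simp: polyhedral_map_def)
  show ?thesis using exists_listed_vertex[OF assms(4)] unfolding listed_def Let_def .
qed

end
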